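(* Let $0\le k\le n-1$, let $\Omega\subset\mathbb{R}^n$ be a bounded domain and let $\sigma_0\ge 1$. There is a constant $C$, depending only on $n$, $k$, $\Omega$ and $\sigma_0$, such that for every cubical mesh $\mathcal{G}_h$ of $\Omega$ with shape regularity constant at most $\sigma_0$ and every $\boldsymbol{f}\in L^2\Lambda^k(\Omega)$ the following holds. Let $\omega\in H\Lambda^k(\Omega)$ be the solution of $$\langle d^k\omega,d^k\mu\rangle_{L^2\Lambda^{k+1}(\Omega)}+\langle\omega,\mu\rangle_{L^2\Lambda^k(\Omega)}=\langle \boldsymbol{f},\mu\rangle_{L^2\Lambda^k(\Omega)}\quad\forall\,\mu\in H\Lambda^k(\Omega),$$ and let $\omega_h\in W^{\rm def}_h\Lambda^k$ be the solution of $$\langle d^k_h\omega_h,d^k_h\mu_h\rangle_{L^2\Lambda^{k+1}(\Omega)}+\langle\omega_h,\mu_h\rangle_{L^2\Lambda^k(\Omega)}=\langle \boldsymbol{f},\mu_h\rangle_{L^2\Lambda^k(\Omega)}\quad\forall\,\mu_h\in W^{\rm def}_h\Lambda^k.$$ Then $$\|\omega-\omega_h\|_{d^k_h}\le C\Big(\inf_{\mu_h\in\mathcal{P}^-_1\Lambda^k(\mathcal{G}_h)}\|\omega-\mu_h\|_{d^k_h}+\inf_{\eta_h\in V^{\mathcal{Q}}_h\Lambda^k}\|\omega-\eta_h\|_{d^k}+\inf_{\psi_h\in V^{\mathcal{Q},*}_{h0}\Lambda^{k+1}}\|d^k\omega-\psi_h\|_{\delta_{k+1}}\Big).$$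
   Context: Forms. For a domain $\Xi\subset\mathbb{R}^n$, $L^2\Lambda^k(\Xi)$ is the Hilbert space of differential $k$-forms with $L^2(\Xi)$ coefficients, with the componentwise inner product $\langle\cdot,\cdot\rangle_{L^2\Lambda^k(\Xi)}$; $d^k$ is the exterior derivative on $k$-forms (weak sense); $\star$ is the Euclidean Hodge star; the codifferential is $\delta_k=(-1)^{n(k+1)+1}\star d^{n-k}\star$ on $k$-forms, i.e. the formal $L^2$-adjoint of $d^{k-1}$. $H\Lambda^k(\Xi)=\{\omega\in L^2\Lambda^k(\Xi): d^k\omega\in L^2\Lambda^{k+1}(\Xi)\}$, $H^*\Lambda^k(\Xi)=\{\mu\in L^2\Lambda^k(\Xi):\delta_k\mu\in L^2\Lambda^{k-1}(\Xi)\}$, and $H^*_0\Lambda^k(\Xi)$ is the closure of $\mathcal{C}^\infty_0\Lambda^k(\Xi)$ in $H^*\Lambda^k(\Xi)$ in the graph norm. It is known that $(\delta_{k+1},H^*_0\Lambda^{k+1})$ is the adjoint of $(d^k,H\Lambda^k)$; in particular $d^k\omega\in H_0^*\Lambda^{k+1}(\Omega)$ for the solution $\omega$ in the claim. Mesh. A cubical mesh $\mathcal{G}_h$ of $\Omega$ is a finite (face-to-face) subdivision of $\Omega$ into $n$-dimensional boxes $K$ (products of intervals, edges parallel to the coordinate axes). Its shape regularity constant is the maximum over $K$ of the ratio of the longest to the shortest edge of $K$. A subscript $h$ on an operator means it is applied cell by cell: $(d^k_h\omega_h)|_K=d^k(\omega_h|_K)$. Norms. $\|\omega\|_{d^k}^2=\|\omega\|_{L^2}^2+\|d^k\omega\|_{L^2}^2$,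 $\|\mu\|_{\delta_{k+1}}^2=\|\mu\|_{L^2}^2+\|\delta_{k+1}\mu\|_{L^2}^2$ on $\Omega$, and $\|\omega\|_{d^k_h}^2=\sum_{K\in\mathcal{G}_h}\|\omega\|^2_{H\Lambda^k(K)}$ with $\|\omega\|^2_{H\Lambda^k(K)}=\|\omega\|_{L^2(K)}^2+\|d^k\omega\|_{L^2(K)}^2$. Local spaces. $\mathcal{P}_0\Lambda^k$ is the space of constant-coefficient $k$-forms. The Koszul operator is $\kappa(dx^{\alpha_1}\wedge\dots\wedge dx^{\alpha_k})=\sum_{j=1}^k(-1)^{j+1}x_{\alpha_j}dx^{\alpha_1}\wedge\dots\widehat{dx^{\alpha_j}}\dots\wedge dx^{\alpha_k}$ (linear over functions). Whitney forms: $\mathcal{P}^-_1\Lambda^k=\mathcal{P}_0\Lambda^k+\kappa(\mathcal{P}_0\Lambda^{k+1})$. For a box $K=I_1\times\dots\times I_n$, $\mathcal{Q}^-_1\Lambda^k(K)=\bigoplus_{\alpha}\big[\bigotimes_{i=1}^n\mathcal{P}_{1-\delta_{i,\alpha}}(I_i)\big]dx^{\alpha_1}\wedge\dots\wedge dx^{\alpha_k}$, the sum over $1\le\alpha_1<\dots<\alpha_k\le n$, where $\delta_{i,\alpha}=1$ if $i\in\{\alpha_1,\dots,\alpha_k\}$ and $0$ otherwise, and $\mathcal{P}_r(I)$ denotes univariate polynomials of degree at most $r$. $\mathcal{Q}^{*,-}_1\Lambda^k(K)=\star(\mathcal{Q}^-_1\Lambda^{n-k}(K))$. Global spaces. $\mathcal{P}^-_1\Lambda^k(\mathcal{G}_h)=\prod_{K\in\mathcal{G}_h}\mathcal{P}^-_1\Lambda^k(K)$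 (piecewise Whitney forms, no continuity). $V^{\mathcal{Q}}_h\Lambda^k=\{\omega\in H\Lambda^k(\Omega):\omega|_K\in\mathcal{Q}^-_1\Lambda^k(K)\ \forall K\in\mathcal{G}_h\}$. $V^{\mathcal{Q},*}_{h0}\Lambda^{k}=\{\mu\in H^*_0\Lambda^{k}(\Omega):\mu|_K\in\mathcal{Q}^{*,-}_1\Lambda^{k}(K)\ \forall K\in\mathcal{G}_h\}$. Finally $$W^{\rm def}_h\Lambda^k=\Big\{\omega_h\in\mathcal{P}^-_1\Lambda^k(\mathcal{G}_h):\sum_{K\in\mathcal{G}_h}\langle d^k\omega_h,\mu_h\rangle_{L^2\Lambda^{k+1}(K)}-\langle\omega_h,\delta_{k+1}\mu_h\rangle_{L^2\Lambda^k(K)}=0\ \ \forall\mu_h\in V^{\mathcal{Q},*}_{h0}\Lambda^{k+1}\Big\}.$$ *)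

theory Defs
  imports "HOL-Analysis.Analysis" "HOL-Computational_Algebra.Polynomial"
begin

section \<open>Algebraic forms\<close>

text \<open>
  The space \<open>\<real>\<^sup>n\<close> is \<open>real ^ 'n\<close>, where the linear order on the index type \<open>'n\<close> orders the
  coordinates. An increasing multi-index \<open>\<alpha>\<^sub>1 < \<dots> < \<alpha>\<^sub>k\<close> is identified with the
  subset \<open>{\<alpha>\<^sub>1, \<dots>, \<alpha>\<^sub>k}\<close> of \<open>'n\<close>, and a differential form with the function mapping a
  point to the vector of all its coefficients. The inner product of \<open>real ^ ('n set)\<close> is the
  componentwise one. A \<open>k\<close>-form is a form whose only nonzero coefficients are those of the
  \<open>dx \<alpha>\<close> with \<open>card \<alpha> = k\<close>.
\<close>

type_synonym 'n form = "real ^ 'n \<Rightarrow> real ^ ('n set)"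

abbreviation dx :: "'n::finite set \<Rightarrow> real ^ ('n set)" where
  "dx \<alpha> \<equiv> axis \<alpha> 1"

definition alt_forms :: "nat \<Rightarrow> (real ^ ('n::finite set)) set" where
  "alt_forms k = {v. \<forall>\<alpha>. card \<alpha> \<noteq> k \<longrightarrow> v $ \<alpha> = 0}"

text \<open>
  For \<open>i \<in> \<beta>\<close> this is the sign with \<open>dx\<^sub>i \<and> dx (\<beta> - {i}) = pos_sign i \<beta> \<cdot> dx \<beta>\<close>. If
  \<open>i = \<beta>\<^sub>j\<close> is the \<open>j\<close>-th element of \<open>\<beta>\<close>, counting from one, it equals \<open>(-1)\<^sup>j\<^sup>+\<^sup>1\<close>.
\<close>

definition pos_sign :: "'n::{finite,linorder} \<Rightarrow> 'n set \<Rightarrow> real" where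
  "pos_sign i \<beta> = (-1) ^ card {j \<in> \<beta>. j < i}"

text \<open>
  The sign of the permutation \<open>(\<alpha>, -\<alpha>)\<close>, so that
  \<open>dx \<alpha> \<and> \<star>dx \<alpha> = dx UNIV\<close> is the volume form.
\<close>

definition shuffle_sign :: "'n::{finite,linorder} set \<Rightarrow> real" where
  "shuffle_sign \<alpha> = (-1) ^ card {(i, j). i \<in> \<alpha> \<and> j \<in> - \<alpha> \<and> j < i}"

definition hodge_star :: "real ^ ('n::{finite,linorder} set) \<Rightarrow> real ^ ('n set)" where
  "hodge_star v = (\<Sum>\<alpha>\<in>UNIV. (v $ \<alpha> * shuffle_sign \<alpha>) *\<^sub>R dx (- \<alpha>))"

definition koszul :: "'n::{finite,linorder} form \<Rightarrow> 'n form" where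
  "koszul \<omega> = (\<lambda>x. \<Sum>\<beta>\<in>UNIV. \<omega> x $ \<beta> *\<^sub>R (\<Sum>i\<in>\<beta>. (pos_sign i \<beta> * x $ i) *\<^sub>R dx (\<beta> - {i})))"


section \<open>Smooth compactly supported functions\<close>

definition partial_deriv :: "'n::finite \<Rightarrow> (real ^ 'n \<Rightarrow> 'b::real_normed_vector) \<Rightarrow> real ^ 'n \<Rightarrow> 'b" where
  "partial_deriv i f x = frechet_derivative f (at x) (axis i 1)"

fun times_diff :: "nat \<Rightarrow> (real ^ 'n::finite \<Rightarrow> 'b::real_normed_vector) \<Rightarrow> bool" where
  "times_diff 0 f \<longleftrightarrow> continuous_on UNIV f"
| "times_diff (Suc m) f \<longleftrightarrow> f differentiable_on UNIV \<and> (\<forall>i. times_diff m (partial_deriv i f))"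

definition test_function :: "(real ^ 'n::finite) set \<Rightarrow> (real ^ 'n \<Rightarrow> 'b::real_normed_vector) \<Rightarrow> bool" where
  "test_function \<Xi> \<phi> \<longleftrightarrow>
     (\<forall>m. times_diff m \<phi>) \<and> (\<exists>S. compact S \<and> S \<subseteq> \<Xi> \<and> (\<forall>x. x \<notin> S \<longrightarrow> \<phi> x = 0))"

definition test_forms :: "(real ^ 'n::finite) set \<Rightarrow> nat \<Rightarrow> 'n form set" where
  "test_forms \<Xi> k = {\<phi>. test_function \<Xi> \<phi> \<and> (\<forall>x. \<phi> x \<in> alt_forms k)}"


section \<open>Hilbert spaces of forms on an open set\<close>

text \<open>
  Elements of \<open>L\<^sup>2\<close> are represented by functions on the whole space; only their values almost
  everywhere in \<open>\<Xi>\<close> matter.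
\<close>

definition L2_forms :: "(real ^ 'n::finite) set \<Rightarrow> nat \<Rightarrow> 'n form set" where
  "L2_forms \<Xi> k =
     {\<omega>. \<omega> \<in> borel_measurable (lebesgue_on \<Xi>)
        \<and> (AE x in lebesgue_on \<Xi>. \<omega> x \<in> alt_forms k)
        \<and> integrable (lebesgue_on \<Xi>) (\<lambda>x. (norm (\<omega> x))\<^sup>2)}"

definition L2_inner :: "(real ^ 'n::finite) set \<Rightarrow> 'n form \<Rightarrow> 'n form \<Rightarrow> real" where
  "L2_inner \<Xi> \<omega> \<eta> = (LINT x | lebesgue_on \<Xi>. \<omega> x \<bullet> \<eta> x)"

definition L2_norm :: "(real ^ 'n::finite) set \<Rightarrow> 'n form \<Rightarrow> real" where
  "L2_norm \<Xi> \<omega> = sqrt (L2_inner \<Xi> \<omega> \<omega>)"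

text \<open>
  \<open>\<eta> = d\<^sup>k \<omega>\<close> in the sense of distributions: for every \<open>\<beta>\<close> with \<open>k + 1\<close> elements, the
  coefficient \<open>\<eta>\<^sub>\<beta>\<close> is \<open>\<Sum>i\<in>\<beta>. pos_sign i \<beta> \<cdot> \<partial>\<^sub>i \<omega>\<^bsub>\<beta>-{i}\<^esub>\<close>, tested against scalar
  test functions.
\<close>

definition is_weak_d :: "(real ^ 'n::{finite,linorder}) set \<Rightarrow> nat \<Rightarrow> 'n form \<Rightarrow> 'n form \<Rightarrow> bool" where
  "is_weak_d \<Xi> k \<omega> \<eta> \<longleftrightarrow>
     (\<forall>\<phi>. \<forall>\<beta>. test_function \<Xi> \<phi> \<and> card \<beta> = k + 1 \<longrightarrow>
        (LINT x | lebesgue_on \<Xi>. \<eta> x $ \<beta> * \<phi> x) =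
        - (\<Sum>i\<in>\<beta>. pos_sign i \<beta> *
             (LINT x | lebesgue_on \<Xi>. \<omega> x $ (\<beta> - {i}) * partial_deriv i \<phi> x)))"

definition H_space :: "(real ^ 'n::{finite,linorder}) set \<Rightarrow> nat \<Rightarrow> 'n form set" where
  "H_space \<Xi> k = {\<omega> \<in> L2_forms \<Xi> k. \<exists>\<eta> \<in> L2_forms \<Xi> (k + 1). is_weak_d \<Xi> k \<omega> \<eta>}"

text \<open>
  The weak derivative is unique up to null sets, so the choice below only selects a representative.
  It is meaningful for \<open>\<omega> \<in> H_space \<Xi> k\<close>.
\<close>

definition ext_d :: "(real ^ 'n::{finite,linorder}) set \<Rightarrow> nat \<Rightarrow> 'n form \<Rightarrow> 'n form" where
  "ext_d \<Xi> k \<omega> = (SOME \<eta>. \<eta> \<in> L2_forms \<Xi> (k + 1) \<and> is_weak_d \<Xi> k \<omega> \<eta>)"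

text \<open>For \<open>1 \<le> k \<le> n\<close>: \<open>\<delta>\<^sub>k = (-1)\<^bsup>n(k+1)+1\<^esup> \<star> d\<^bsup>n-k\<^esup> \<star>\<close> on \<open>k\<close>-forms.\<close>

definition Hstar_space :: "(real ^ 'n::{finite,linorder}) set \<Rightarrow> nat \<Rightarrow> 'n form set" where
  "Hstar_space \<Xi> k =
     {\<mu> \<in> L2_forms \<Xi> k. (\<lambda>x. hodge_star (\<mu> x)) \<in> H_space \<Xi> (CARD('n) - k)}"

definition codiff :: "(real ^ 'n::{finite,linorder}) set \<Rightarrow> nat \<Rightarrow> 'n form \<Rightarrow> 'n form" where
  "codiff \<Xi> k \<mu> = (\<lambda>x. (-1) ^ (CARD('n) * (k + 1) + 1) *\<^sub>R
      hodge_star (ext_d \<Xi> (CARD('n) - k) (\<lambda>y. hodge_star (\<mu> y)) x))"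

definition d_norm :: "(real ^ 'n::{finite,linorder}) set \<Rightarrow> nat \<Rightarrow> 'n form \<Rightarrow> real" where
  "d_norm \<Xi> k \<omega> = sqrt ((L2_norm \<Xi> \<omega>)\<^sup>2 + (L2_norm \<Xi> (ext_d \<Xi> k \<omega>))\<^sup>2)"

definition delta_norm :: "(real ^ 'n::{finite,linorder}) set \<Rightarrow> nat \<Rightarrow> 'n form \<Rightarrow> real" where
  "delta_norm \<Xi> k \<mu> = sqrt ((L2_norm \<Xi> \<mu>)\<^sup>2 + (L2_norm \<Xi> (codiff \<Xi> k \<mu>))\<^sup>2)"

definition Hstar0_space :: "(real ^ 'n::{finite,linorder}) set \<Rightarrow> nat \<Rightarrow> 'n form set" where
  "Hstar0_space \<Xi> k =
     {\<mu> \<in> Hstar_space \<Xi> k. \<forall>\<epsilon>>0. \<exists>\<phi> \<in> test_forms \<Xi> k. delta_norm \<Xi> k (\<lambda>x. \<mu> x - \<phi> x) < \<epsilon>}"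


section \<open>Cubical meshes\<close>

text \<open>
  Cells are closed boxes. A cell enters integrals and weak derivatives through its interior, which
  has to lie in \<open>\<Omega>\<close>: this is not implied by the cells covering the closure of \<open>\<Omega>\<close>, for
  example when \<open>\<Omega>\<close> is a punctured or slit square.
\<close>

definition cubical_mesh :: "(real ^ 'n::finite) set \<Rightarrow> (real ^ 'n) set set \<Rightarrow> bool" where
  "cubical_mesh \<Omega> \<G> \<longleftrightarrow>
     \<G> division_of closure \<Omega>
     \<and> (\<forall>K\<in>\<G>. interior K \<noteq> {} \<and> interior K \<subseteq> \<Omega>)
     \<and> (\<forall>K\<in>\<G>. \<forall>K'\<in>\<G>. K \<inter> K' face_of K)"

definition edge_length :: "(real ^ 'n::finite) set \<Rightarrow> 'n \<Rightarrow> real" where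
  "edge_length K i = interval_upperbound K $ i - interval_lowerbound K $ i"

definition shape_regularity :: "(real ^ 'n::finite) set set \<Rightarrow> real" where
  "shape_regularity \<G> =
     (MAX K\<in>\<G>. (MAX i\<in>UNIV. edge_length K i) / (MIN i\<in>UNIV. edge_length K i))"

definition ext_d_h :: "(real ^ 'n::{finite,linorder}) set set \<Rightarrow> nat \<Rightarrow> 'n form \<Rightarrow> 'n form" where
  "ext_d_h \<G> k \<omega> = (\<lambda>x. \<Sum>K\<in>\<G>. indicator (interior K) x *\<^sub>R ext_d (interior K) k \<omega> x)"

definition dh_norm :: "(real ^ 'n::{finite,linorder}) set set \<Rightarrow> nat \<Rightarrow> 'n form \<Rightarrow> real" where
  "dh_norm \<G> k \<omega> = sqrt (\<Sum>K\<in>\<G>. (d_norm (interior K) k \<omega>)\<^sup>2)"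


section \<open>Local spaces\<close>

definition const_forms :: "nat \<Rightarrow> 'n::finite form set" where
  "const_forms k = {(\<lambda>x. v) | v. v \<in> alt_forms k}"

definition whitney_forms :: "nat \<Rightarrow> 'n::{finite,linorder} form set" where
  "whitney_forms k =
     {(\<lambda>x. c x + koszul c' x) | c c'. c \<in> const_forms k \<and> c' \<in> const_forms (k + 1)}"

text \<open>
  The tensor product of the univariate polynomial spaces of degree at most \<open>r i\<close> in the variable
  \<open>x $ i\<close>, as the set of finite sums of pure tensors.
\<close>

definition tensor_polys :: "('n \<Rightarrow> nat) \<Rightarrow> (real ^ 'n::finite \<Rightarrow> real) set" where
  "tensor_polys r =
     {(\<lambda>x. \<Sum>j<N. \<Prod>i\<in>UNIV. poly (p j i) (x $ i)) | (N :: nat) (p :: nat \<Rightarrow> 'n \<Rightarrow> real poly).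
        \<forall>j i. degree (p j i) \<le> r i}"

definition Q_forms :: "nat \<Rightarrow> 'n::finite form set" where
  "Q_forms k =
     {(\<lambda>x. \<Sum>\<alpha> | card \<alpha> = k. f \<alpha> x *\<^sub>R dx \<alpha>) | f.
        \<forall>\<alpha>. card \<alpha> = k \<longrightarrow> f \<alpha> \<in> tensor_polys (\<lambda>i. 1 - (if i \<in> \<alpha> then 1 else 0))}"

definition Qstar_forms :: "nat \<Rightarrow> 'n::{finite,linorder} form set" where
  "Qstar_forms k = {(\<lambda>x. hodge_star (q x)) | q. q \<in> Q_forms (CARD('n) - k)}"


section \<open>Global spaces\<close>

definition piecewise_in :: "(real ^ 'n::finite) set set \<Rightarrow> 'n form set \<Rightarrow> 'n form set" where
  "piecewise_in \<G> S = {\<omega>. \<forall>K\<in>\<G>. \<exists>q\<in>S. AE x in lebesgue_on (interior K). \<omega> x = q x}"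

definition Ph_space :: "(real ^ 'n::{finite,linorder}) set set \<Rightarrow> nat \<Rightarrow> 'n form set" where
  "Ph_space \<G> k = piecewise_in \<G> (whitney_forms k)"

definition VQ_space ::
  "(real ^ 'n::{finite,linorder}) set \<Rightarrow> (real ^ 'n::{finite,linorder}) set set \<Rightarrow> nat \<Rightarrow> 'n form set" where
  "VQ_space \<Omega> \<G> k = H_space \<Omega> k \<inter> piecewise_in \<G> (Q_forms k)"

definition VQstar0_space ::
  "(real ^ 'n::{finite,linorder}) set \<Rightarrow> (real ^ 'n::{finite,linorder}) set set \<Rightarrow> nat \<Rightarrow> 'n form set" where
  "VQstar0_space \<Omega> \<G> k = Hstar0_space \<Omega> k \<inter> piecewise_in \<G> (Qstar_forms k)"

definition Wdef_space ::
  "(real ^ 'n::{finite,linorder}) set \<Rightarrow> (real ^ 'n::{finite,linorder}) set set \<Rightarrow> nat \<Rightarrow> 'n form set" where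
  "Wdef_space \<Omega> \<G> k =
     {\<omega> \<in> Ph_space \<G> k. \<forall>\<mu> \<in> VQstar0_space \<Omega> \<G> (k + 1).
        (\<Sum>K\<in>\<G>. L2_inner (interior K) (ext_d (interior K) k \<omega>) \<mu>
               - L2_inner (interior K) \<omega> (codiff \<Omega> (k + 1) \<mu>)) = 0}"


section \<open>The continuous and the discrete problem\<close>

definition is_solution ::
  "(real ^ 'n::{finite,linorder}) set \<Rightarrow> nat \<Rightarrow> 'n form \<Rightarrow> 'n form \<Rightarrow> bool" where
  "is_solution \<Omega> k f \<omega> \<longleftrightarrow> \<omega> \<in> H_space \<Omega> k \<and>
     (\<forall>\<mu> \<in> H_space \<Omega> k.
        L2_inner \<Omega> (ext_d \<Omega> k \<omega>) (ext_d \<Omega> k \<mu>) + L2_inner \<Omega> \<omega> \<mu> = L2_inner \<Omega> f \<mu>)"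

definition is_discrete_solution ::
  "(real ^ 'n::{finite,linorder}) set \<Rightarrow> (real ^ 'n::{finite,linorder}) set set \<Rightarrow> nat \<Rightarrow> 'n form \<Rightarrow> 'n form \<Rightarrow> bool" where
  "is_discrete_solution \<Omega> \<G> k f \<omega>\<^sub>h \<longleftrightarrow> \<omega>\<^sub>h \<in> Wdef_space \<Omega> \<G> k \<and>
     (\<forall>\<mu>\<^sub>h \<in> Wdef_space \<Omega> \<G> k.
        L2_inner \<Omega> (ext_d_h \<G> k \<omega>\<^sub>h) (ext_d_h \<G> k \<mu>\<^sub>h) + L2_inner \<Omega> \<omega>\<^sub>h \<mu>\<^sub>h = L2_inner \<Omega> f \<mu>\<^sub>h)"

end

theory Submission
  imports Defs
begin

text \<open>
  The argument is a Strang-type estimate. Test the discrete solution against a weakly conforming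
  \<open>v\<close>. By the defining orthogonality of the space containing \<open>v\<close>, and because
  \<open>\<delta> d \<omega> = f - \<omega>\<close> holds weakly, the consistency error equals
  \<open>\<langle>d \<omega> - \<psi>, d\<^sub>h v\<rangle> - \<langle>\<delta> (d \<omega> - \<psi>), v\<rangle>\<close> for every \<open>\<psi>\<close> in the discrete
  dual space. It is therefore bounded by the distance of \<open>d \<omega>\<close> to that space in the graph norm
  of \<open>\<delta>\<close> (\<open>solution_codiff\<close>, \<open>error_estimate\<close>).

  What remains is to approximate \<open>\<omega>\<close> by a weakly conforming piecewise Whitney form. Given a
  conforming \<open>\<eta>\<close> in the tensor product space, let \<open>J \<eta>\<close> be, on a cell with midpoint \<open>c\<close>, the
  Whitney form \<open>\<eta>(c) + \<kappa>\<^bsub>x-c\<^esub>(d \<eta>(c)) / (k + 1)\<close> (\<open>whitney_proj\<close>). It has the same value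
  and the same exterior derivative as \<open>\<eta>\<close> at \<open>c\<close>. The coefficient with index \<open>\<alpha>\<close> of a form in
  \<open>\<Q>\<^sup>-\<close> is affine in each coordinate outside \<open>\<alpha>\<close> and independent of the others; for \<open>\<Q>\<^sup>*\<^sup>,\<^sup>-\<close> the two
  groups of coordinates are exchanged. Hence the pointwise inner product of a form of the first
  kind with one of the second kind is affine in each coordinate separately, and its integral over
  a box is the volume times the value at the midpoint (\<open>integral_box_multi_affine\<close>). So
  \<open>\<langle>d \<eta>, \<mu>\<rangle>\<close> and \<open>\<langle>\<eta>, \<delta> \<mu>\<rangle>\<close> on a cell do not change when \<open>\<eta>\<close> is replaced by \<open>J \<eta>\<close>. Summing over
  the cells, \<open>J \<eta>\<close> inherits the orthogonality from the adjointness of \<open>d\<close> and \<open>\<delta>\<close>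
  (\<open>adjoint_Hstar0\<close>, \<open>VQ_projection\<close>).

  On a cell \<open>J\<close> is bounded in the graph norm, because the value at the midpoint is the mean value,
  with a constant that depends only on the dimension and the size of the domain, and it reproduces Whitney forms.
  So \<open>\<eta> - J \<eta>\<close> is controlled by \<open>\<eta> - \<mu>\<close> for every piecewise Whitney form \<open>\<mu>\<close>
  (\<open>whitney_proj_estimate\<close>). Taking infima gives the theorem.

  Weak derivatives occur through a choice of representative, so their uniqueness is needed
  throughout. It rests on the fundamental lemma of the calculus of variations
  (\<open>fundamental_lemma\<close>); the weak derivatives of piecewise polynomials and of test functions come
  from an integration by parts (\<open>integration_by_parts\<close>).
\<close>

section \<open>Square-integrable functions\<close>

text \<open>
  Square-integrability, inner product and norm for functions with values in an arbitrary Euclidean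
  space. The value space may be a product, so the graph norm of \<open>\<omega>\<close> is the norm of the single
  function \<open>x \<mapsto> (\<omega> x, d \<omega> x)\<close>.
\<close>

definition sq_int :: "'a measure \<Rightarrow> ('a \<Rightarrow> 'b::euclidean_space) \<Rightarrow> bool" where
  "sq_int M f \<longleftrightarrow> f \<in> borel_measurable M \<and> integrable M (\<lambda>x. (norm (f x))\<^sup>2)"

definition ip :: "'a measure \<Rightarrow> ('a \<Rightarrow> 'b::euclidean_space) \<Rightarrow> ('a \<Rightarrow> 'b) \<Rightarrow> real" where
  "ip M f g = (LINT x|M. f x \<bullet> g x)"

definition nrm :: "'a measure \<Rightarrow> ('a \<Rightarrow> 'b::euclidean_space) \<Rightarrow> real" where
  "nrm M f = sqrt (LINT x|M. (norm (f x))\<^sup>2)"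

lemma sq_int_integrable_inner:
  assumes "sq_int M f" "sq_int M g"
  shows "integrable M (\<lambda>x. f x \<bullet> g x)"
proof (rule Bochner_Integration.integrable_bound)
  show "integrable M (\<lambda>x. (norm (f x))\<^sup>2 + (norm (g x))\<^sup>2)"
    using assms by (auto simp: sq_int_def)
  show "(\<lambda>x. f x \<bullet> g x) \<in> borel_measurable M"
    using assms by (auto simp: sq_int_def)
  have "\<bar>f x \<bullet> g x\<bar> \<le> (norm (f x))\<^sup>2 + (norm (g x))\<^sup>2" for x
  proof -
    have "0 \<le> (norm (f x) - norm (g x))\<^sup>2" by simp
    then have "2 * (norm (f x) * norm (g x)) \<le> (norm (f x))\<^sup>2 + (norm (g x))\<^sup>2"
      by (simp add: power2_diff)
    moreover have "0 \<le> norm (f x) * norm (g x)" by simp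
    ultimately show ?thesis using Cauchy_Schwarz_ineq2[of "f x" "g x"] by linarith
  qed
  then show "AE x in M. norm (f x \<bullet> g x) \<le> norm ((norm (f x))\<^sup>2 + (norm (g x))\<^sup>2)"
    by (intro AE_I2) (simp add: abs_of_nonneg)
qed

lemma sq_int_add:
  assumes "sq_int M f" "sq_int M g"
  shows "sq_int M (\<lambda>x. f x + g x)"
proof -
  have "(norm (f x + g x))\<^sup>2 = (norm (f x))\<^sup>2 + 2 * (f x \<bullet> g x) + (norm (g x))\<^sup>2" for x
    by (simp add: power2_norm_eq_inner inner_add_left inner_add_right inner_commute)
  then show ?thesis
    using assms sq_int_integrable_inner[OF assms] by (auto simp: sq_int_def)
qed

lemma sq_int_scale:
  assumes "sq_int M f"
  shows "sq_int M (\<lambda>x. c *\<^sub>R f x)"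
  using assms by (auto simp: sq_int_def power_mult_distrib)

lemma sq_int_diff:
  assumes "sq_int M f" "sq_int M g"
  shows "sq_int M (\<lambda>x. f x - g x)"
  using sq_int_add[OF assms(1) sq_int_scale[OF assms(2), of "-1"]] by simp

lemma sq_int_Pair:
  assumes "sq_int M f" "sq_int M g"
  shows "sq_int M (\<lambda>x. (f x, g x))"
  using assms by (auto simp: sq_int_def norm_Pair)

lemma ip_diff_left:
  "sq_int M f \<Longrightarrow> sq_int M g \<Longrightarrow> sq_int M h \<Longrightarrow> ip M (\<lambda>x. f x - g x) h = ip M f h - ip M g h"
  unfolding ip_def inner_diff_left
  by (rule Bochner_Integration.integral_diff) (auto intro: sq_int_integrable_inner)

lemma ip_commute: "ip M f g = ip M g f"
  by (simp add: ip_def inner_commute)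

lemma ip_diff_right:
  "sq_int M f \<Longrightarrow> sq_int M g \<Longrightarrow> sq_int M h \<Longrightarrow> ip M h (\<lambda>x. f x - g x) = ip M h f - ip M h g"
  using ip_diff_left[of M f g h] by (simp add: ip_commute)

lemma ip_scale_right: "ip M h (\<lambda>x. c *\<^sub>R f x) = c * ip M h f"
  by (simp add: ip_def)

lemma ip_Pair:
  assumes "sq_int M f" "sq_int M g" "sq_int M f'" "sq_int M g'"
  shows "ip M (\<lambda>x. (f x, g x)) (\<lambda>x. (f' x, g' x)) = ip M f f' + ip M g g'"
  unfolding ip_def inner_Pair
  by (rule Bochner_Integration.integral_add) (auto intro: sq_int_integrable_inner assms)

lemma nrm_nonneg: "0 \<le> nrm M f"
  by (simp add: nrm_def)

lemma nrm_square: "(nrm M f)\<^sup>2 = ip M f f"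
  by (simp add: nrm_def ip_def power2_norm_eq_inner)

lemma nrm_eq_sqrt_ip: "nrm M f = sqrt (ip M f f)"
  by (simp add: nrm_def ip_def power2_norm_eq_inner)

lemma nrm_square_integral: "(nrm M f)\<^sup>2 = (LINT x|M. (norm (f x))\<^sup>2)"
  by (simp add: nrm_def)

lemma nrm_Pair_square:
  assumes "sq_int M f" "sq_int M g"
  shows "(nrm M (\<lambda>x. (f x, g x)))\<^sup>2 = (nrm M f)\<^sup>2 + (nrm M g)\<^sup>2"
  by (simp add: nrm_square ip_Pair assms)

lemma nrm_diff_square:
  assumes "sq_int M f" "sq_int M g"
  shows "(nrm M (\<lambda>x. f x - g x))\<^sup>2 = (nrm M f)\<^sup>2 - 2 * ip M f g + (nrm M g)\<^sup>2"
  unfolding nrm_square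
  by (simp add: ip_diff_left ip_diff_right sq_int_diff assms ip_commute[of M g f])

lemma ip_le_nrm:
  assumes "sq_int M f" "sq_int M g"
  shows "\<bar>ip M f g\<bar> \<le> nrm M f * nrm M g"
proof -
  have quad: "0 \<le> (nrm M f)\<^sup>2 - 2 * t * ip M f g + t\<^sup>2 * (nrm M g)\<^sup>2" for t
  proof -
    have g: "sq_int M (\<lambda>x. t *\<^sub>R g x)" by (rule sq_int_scale) fact
    have "0 \<le> (nrm M (\<lambda>x. f x - t *\<^sub>R g x))\<^sup>2" by simp
    also have "\<dots> = ip M f f - t * ip M f g - (t * ip M f g - t * (t * ip M g g))"
      unfolding nrm_square
      by (simp add: ip_diff_left ip_diff_right ip_scale_right g sq_int_diff assms
          ip_commute[of M "\<lambda>x. t *\<^sub>R g x"] ip_commute[of M g f] algebra_simps)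
    finally show ?thesis unfolding nrm_square by (simp add: power2_eq_square algebra_simps)
  qed
  have "(ip M f g)\<^sup>2 \<le> (nrm M f * nrm M g)\<^sup>2"
  proof (cases "nrm M g = 0")
    case True
    have "ip M f g = 0"
    proof (rule ccontr)
      assume "ip M f g \<noteq> 0"
      then show False
        using quad[of "((nrm M f)\<^sup>2 + 1) / (2 * ip M f g)"] True by simp
    qed
    then show ?thesis by simp
  next
    case False
    have "0 \<le> (nrm M f)\<^sup>2 - (ip M f g)\<^sup>2 / (nrm M g)\<^sup>2"
      using quad[of "ip M f g / (nrm M g)\<^sup>2"] False
      by (simp add: power2_eq_square field_simps)
    then show ?thesis using False by (simp add: field_simps power_mult_distrib)
  qed
  then show ?thesis
    by (metis abs_le_square_iff abs_of_nonneg mult_nonneg_nonneg nrm_nonneg)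
qed

lemma nrm_triangle:
  assumes "sq_int M f" "sq_int M g" "sq_int M h"
  shows "nrm M (\<lambda>x. f x - h x) \<le> nrm M (\<lambda>x. f x - g x) + nrm M (\<lambda>x. g x - h x)"
proof -
  let ?u = "\<lambda>x. f x - g x" and ?v = "\<lambda>x. h x - g x"
  have uv: "sq_int M ?u" "sq_int M ?v" by (auto intro: sq_int_diff assms)
  have v: "nrm M ?v = nrm M (\<lambda>x. g x - h x)" by (simp add: nrm_def norm_minus_commute)
  have "(nrm M (\<lambda>x. ?u x - ?v x))\<^sup>2 = (nrm M ?u)\<^sup>2 - 2 * ip M ?u ?v + (nrm M ?v)\<^sup>2"
    by (rule nrm_diff_square[OF uv])
  also have "\<dots> \<le> (nrm M ?u + nrm M ?v)\<^sup>2"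
    using ip_le_nrm[OF uv] by (simp add: power2_sum)
  finally have "(nrm M (\<lambda>x. f x - h x))\<^sup>2 \<le> (nrm M ?u + nrm M (\<lambda>x. g x - h x))\<^sup>2"
    by (simp add: v)
  then show ?thesis by (rule power2_le_imp_le) (simp add: nrm_nonneg)
qed

lemma nrm_cong_AE:
  assumes "f \<in> borel_measurable M" "g \<in> borel_measurable M" "AE x in M. f x = g x"
  shows "nrm M f = nrm M g"
proof -
  have "(LINT x|M. (norm (f x))\<^sup>2) = (LINT x|M. (norm (g x))\<^sup>2)"
    by (rule integral_cong_AE) (use assms in auto)
  then show ?thesis by (simp add: nrm_def)
qed

text \<open>
  Lebesgue measure is complete, so a function that is almost everywhere equal to a measurable one
  is measurable. The value of \<open>ext_d\<close> and the elements of the piecewise spaces are known only up to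
  null sets.
\<close>

lemma lebesgue_on_measurable_cong_AE:
  fixes f g :: "'a::euclidean_space \<Rightarrow> 'b::topological_space"
  assumes f: "f \<in> borel_measurable (lebesgue_on S)" and S: "S \<in> sets lebesgue"
    and ae: "AE x in lebesgue_on S. f x = g x"
  shows "g \<in> borel_measurable (lebesgue_on S)"
proof (rule borel_measurableI)
  fix T :: "'b set" assume T: "open T"
  have ae': "AE x in lebesgue. x \<in> S \<longrightarrow> f x = g x"
    using ae S by (simp add: AE_restrict_space_iff)
  have "f -` T \<inter> S \<in> sets (lebesgue_on S)"
    using measurable_sets[OF f, of T] T by (simp add: space_restrict_space)
  then have "f -` T \<inter> S \<in> sets lebesgue"
    using S by (simp add: sets_restrict_space_iff)
  moreover have "AE x in lebesgue. x \<in> f -` T \<inter> S \<longleftrightarrow> x \<in> g -` T \<inter> S"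
    using ae' by eventually_elim auto
  ultimately have "g -` T \<inter> S \<in> sets lebesgue"
    using completion.in_sets_AE[where A = "f -` T \<inter> S" and B = "g -` T \<inter> S" and M = lborel] by auto
  then show "g -` T \<inter> space (lebesgue_on S) \<in> sets (lebesgue_on S)"
    using S by (simp add: space_restrict_space sets_restrict_space_iff)
qed

section \<open>Smooth functions and bumps\<close>

lemma partial_derivI:
  assumes "(f has_derivative f') (at x)"
  shows "partial_deriv i f x = f' (axis i 1)"
  using frechet_derivative_at[OF assms] by (simp add: partial_deriv_def)

text \<open>
  The proofs below unfold the recursive equation one order of differentiation at a time.
\<close>

declare times_diff.simps(2) [simp del]

lemma times_diff_Suc_imp: "times_diff (Suc m) f \<Longrightarrow> times_diff m f"
proof (induction m arbitrary: f)
  case 0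
  then show ?case by (auto simp: times_diff.simps(2) intro: differentiable_imp_continuous_on)
next
  case (Suc m)
  show ?case
    unfolding times_diff.simps(2)[of m f]
  proof (intro conjI allI)
    show "f differentiable_on UNIV" using Suc.prems by (simp add: times_diff.simps(2)[of _ f])
    fix i
    have "times_diff (Suc m) (partial_deriv i f)"
      using Suc.prems by (simp add: times_diff.simps(2)[of _ f])
    then show "times_diff m (partial_deriv i f)" by (rule Suc.IH)
  qed
qed

lemma times_diff_SucI:
  assumes f: "\<And>x. (f has_derivative f' x) (at x)"
    and p: "\<And>i. times_diff m (\<lambda>x. f' x (axis i 1))"
  shows "times_diff (Suc m) f"
proof -
  have "partial_deriv i f = (\<lambda>x. f' x (axis i 1))" for i
    by (rule ext) (rule partial_derivI[OF f])
  then show ?thesis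
    using f p by (auto simp: times_diff.simps(2)[of _ f] differentiable_on_def differentiable_def)
qed

lemma times_diff_SucD:
  assumes "times_diff (Suc m) f"
  obtains f' where "\<And>x. (f has_derivative f' x) (at x)"
    and "\<And>i. times_diff m (\<lambda>x. f' x (axis i 1))" and "\<And>i. partial_deriv i f = (\<lambda>x. f' x (axis i 1))"
proof -
  have f: "(f has_derivative frechet_derivative f (at x)) (at x)" for x
    using assms frechet_derivative_works by (auto simp: times_diff.simps(2)[of _ f] differentiable_on_def)
  have e: "partial_deriv i f = (\<lambda>x. frechet_derivative f (at x) (axis i 1))" for i
    by (auto simp: partial_deriv_def)
  have "times_diff m (\<lambda>x. frechet_derivative f (at x) (axis i 1))" for i
    using assms by (simp add: times_diff.simps(2)[of _ f] flip: e)
  from that[of "\<lambda>x. frechet_derivative f (at x)", OF f this e] show ?thesis .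
qed

lemma times_diff_const: "times_diff m (\<lambda>x. c)"
proof (induction m arbitrary: c)
  case (Suc m)
  show ?case by (rule times_diff_SucI[where f' = "\<lambda>_ _. 0"]) (auto intro: Suc)
qed auto

lemma times_diff_add:
  "times_diff m f \<Longrightarrow> times_diff m g \<Longrightarrow> times_diff m (\<lambda>x. f x + g x)"
proof (induction m arbitrary: f g)
  case (Suc m)
  obtain f' where f': "\<And>x. (f has_derivative f' x) (at x)" "\<And>i. times_diff m (\<lambda>x. f' x (axis i 1))"
    using times_diff_SucD[OF Suc.prems(1)] by metis
  obtain g' where g': "\<And>x. (g has_derivative g' x) (at x)" "\<And>i. times_diff m (\<lambda>x. g' x (axis i 1))"
    using times_diff_SucD[OF Suc.prems(2)] by metis
  show ?case
    by (rule times_diff_SucI[where f' = "\<lambda>x v. f' x v + g' x v"])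
      (auto intro: has_derivative_add f' g' Suc.IH)
qed (auto intro: continuous_intros)

lemma times_diff_linear:
  assumes "bounded_linear h"
  shows "times_diff m f \<Longrightarrow> times_diff m (\<lambda>x. h (f x))"
proof (induction m arbitrary: f)
  case 0
  then show ?case by (simp add: bounded_linear.continuous_on[OF assms])
next
  case (Suc m)
  obtain f' where f': "\<And>x. (f has_derivative f' x) (at x)" "\<And>i. times_diff m (\<lambda>x. f' x (axis i 1))"
    using times_diff_SucD[OF Suc.prems(1)] by metis
  show ?case
    by (rule times_diff_SucI[where f' = "\<lambda>x v. h (f' x v)"])
      (auto intro: bounded_linear.has_derivative[OF assms] f' Suc.IH)
qed

lemma times_diff_mult:
  fixes f g :: "real ^ 'n::finite \<Rightarrow> real"
  shows "times_diff m f \<Longrightarrow> times_diff m g \<Longrightarrow> times_diff m (\<lambda>x. f x * g x)"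
proof (induction m arbitrary: f g)
  case (Suc m)
  obtain f' where f': "\<And>x. (f has_derivative f' x) (at x)" "\<And>i. times_diff m (\<lambda>x. f' x (axis i 1))"
    using times_diff_SucD[OF Suc.prems(1)] by metis
  obtain g' where g': "\<And>x. (g has_derivative g' x) (at x)" "\<And>i. times_diff m (\<lambda>x. g' x (axis i 1))"
    using times_diff_SucD[OF Suc.prems(2)] by metis
  note fg = Suc.prems[THEN times_diff_Suc_imp]
  show ?case
    by (rule times_diff_SucI[where f' = "\<lambda>x v. f x * g' x v + f' x v * g x"])
      (rule has_derivative_mult f' g' | intro times_diff_add Suc.IH fg f' g')+
qed (auto intro: continuous_intros)

lemma times_diff_prod:
  fixes f :: "'i \<Rightarrow> real ^ 'n::finite \<Rightarrow> real"
  assumes "\<And>i. i \<in> I \<Longrightarrow> times_diff m (f i)"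
  shows "times_diff m (\<lambda>x. \<Prod>i\<in>I. f i x)"
  using assms
  by (induction I rule: infinite_finite_induct) (auto intro: times_diff_const times_diff_mult)

text \<open>
  Here \<open>g j\<close> is the \<open>j\<close>-th derivative of \<open>g 0\<close>.
\<close>

lemma times_diff_univariate:
  fixes g :: "nat \<Rightarrow> real \<Rightarrow> real"
  assumes g: "\<And>j t. (g j has_real_derivative g (Suc j) t) (at t)"
  shows "times_diff m (\<lambda>x. g j (c * x $ i + d))"
proof (induction m arbitrary: j)
  case 0
  have "continuous_on UNIV (g j)" for j
    using g DERIV_continuous_on has_field_derivative_at_within by blast
  then have "continuous_on UNIV (\<lambda>x::real ^ 'a. g j (c * x $ i + d))"
    by (rule continuous_on_compose2) (intro continuous_intros, simp)
  then show ?case by simp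
next
  case (Suc m)
  have "((\<lambda>x. g j (c * x $ i + d)) has_derivative (\<lambda>v. g (Suc j) (c * x $ i + d) * (c * v $ i))) (at x)"
    for x :: "real ^ 'a"
  proof -
    have "((\<lambda>x. c * x $ i + d) has_derivative (\<lambda>v. c * v $ i)) (at x)"
      by (auto intro!: derivative_eq_intros bounded_linear.has_derivative[OF bounded_linear_vec_nth])
    from has_derivative_compose[OF this] g[of j "c * x $ i + d"]
    show ?thesis by (auto simp: has_field_derivative_def)
  qed
  then show ?case
  proof (rule times_diff_SucI)
    fix l
    show "times_diff m (\<lambda>x. g (Suc j) (c * x $ i + d) * (c * axis l 1 $ i))"
      by (intro times_diff_mult Suc times_diff_const)
  qed
qed

text \<open>
  The function \<open>p(1/t) exp (-1/t)\<close>, extended by zero to \<open>t \<le> 0\<close>, for a polynomial \<open>p\<close>. Its derivative is of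
  the same kind, with \<open>t\<^sup>2 (p - p')\<close> in place of \<open>p\<close>, so it is smooth.
\<close>

definition flat_exp :: "real poly \<Rightarrow> real \<Rightarrow> real" where
  "flat_exp p t = (if t \<le> 0 then 0 else poly p (1 / t) * exp (- (1 / t)))"

lemma poly_times_exp_tendsto_0: "((\<lambda>s::real. poly p s * exp (- s)) \<longlongrightarrow> 0) at_top"
proof -
  have "((\<lambda>s::real. \<Sum>i\<le>degree p. coeff p i * (s ^ i / exp s)) \<longlongrightarrow> (\<Sum>i\<le>degree p. coeff p i * 0)) at_top"
    by (intro tendsto_sum tendsto_mult tendsto_const tendsto_power_div_exp_0)
  then show ?thesis
    by (simp add: poly_altdef sum_distrib_right exp_minus divide_inverse mult.assoc)
qed

lemma flat_exp_tendsto_0: "((\<lambda>t. flat_exp p t) \<longlongrightarrow> 0) (at_right 0)"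
proof -
  have "((\<lambda>t. poly p (inverse t) * exp (- inverse t)) \<longlongrightarrow> 0) (at_right (0::real))"
    by (rule filterlim_compose[OF poly_times_exp_tendsto_0 filterlim_inverse_at_top_right])
  then show ?thesis
    by (rule tendsto_cong[THEN iffD1, rotated])
      (auto simp: eventually_at_right_less flat_exp_def inverse_eq_divide intro!: eventually_mono[OF eventually_at_right_less])
qed

lemma flat_exp_has_derivative:
  "(flat_exp p has_real_derivative flat_exp ([:0, 0, 1:] * (p - pderiv p)) t) (at t)"
proof -
  consider "t < 0" | "t = 0" | "t > 0" by linarith
  then show ?thesis
  proof cases
    case 1
    have "((\<lambda>t. 0) has_real_derivative 0) (at t)" by simp
    then have "(flat_exp p has_real_derivative 0) (at t)"
      by (rule has_field_derivative_transform_within_open[where S = "{..<0}"])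
        (use 1 in \<open>auto simp: flat_exp_def\<close>)
    then show ?thesis using 1 by (simp add: flat_exp_def)
  next
    case 3
    have "((\<lambda>t. poly p (1 / t) * exp (- (1 / t))) has_real_derivative
        flat_exp ([:0, 0, 1:] * (p - pderiv p)) t) (at t)"
      using 3 by (auto intro!: derivative_eq_intros simp: flat_exp_def divide_simps)
        (auto simp: algebra_simps power2_eq_square)
    then show ?thesis
      by (rule has_field_derivative_transform_within_open[where S = "{0<..}"])
        (use 3 in \<open>auto simp: flat_exp_def\<close>)
  next
    case 2
    have r: "((\<lambda>h. flat_exp p h / h) \<longlongrightarrow> 0) (at_right 0)"
    proof -
      have "flat_exp p h / h = flat_exp (pCons 0 p) h" for h
        by (simp add: flat_exp_def)
      then show ?thesis using flat_exp_tendsto_0[of "pCons 0 p"] by presburger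
    qed
    have l: "((\<lambda>h. flat_exp p h / h) \<longlongrightarrow> 0) (at_left 0)"
      by (rule tendsto_eventually) (auto simp: eventually_at_filter flat_exp_def)
    have "((\<lambda>h. flat_exp p h / h) \<longlongrightarrow> 0) (at 0)"
      using l r by (simp add: filterlim_split_at)
    moreover have "flat_exp r 0 = 0" for r by (simp add: flat_exp_def)
    ultimately show ?thesis using 2 by (simp add: DERIV_def)
  qed
qed

lemma times_diff_flat_exp:
  "times_diff m (\<lambda>x::real ^ 'n::finite. flat_exp p (c * x $ i + d))"
proof -
  define P where "P j = ((\<lambda>p. [:0, 0, 1:] * (p - pderiv p)) ^^ j) p" for j
  have P: "P 0 = p" "P (Suc j) = [:0, 0, 1:] * (P j - pderiv (P j))" for j
    unfolding P_def by (simp_all only: funpow.simps o_def id_apply)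
  have "times_diff m (\<lambda>x::real ^ 'n. flat_exp (P 0) (c * x $ i + d))"
    by (rule times_diff_univariate[where g = "\<lambda>j. flat_exp (P j)"])
      (unfold P(2), rule flat_exp_has_derivative)
  then show ?thesis by (simp only: P(1))
qed

text \<open>
  A smooth function with values in \<open>[0, 1]\<close>. For \<open>r > 0\<close> its support lies in the box obtained from \<open>box a b\<close> by moving
  each side inwards by \<open>1 / r\<close>. As \<open>r\<close> tends to infinity it tends pointwise to the indicator
  function of \<open>box a b\<close>.
\<close>

definition box_bump :: "real ^ 'n::finite \<Rightarrow> real ^ 'n \<Rightarrow> real \<Rightarrow> real ^ 'n \<Rightarrow> real" where
  "box_bump a b r x =
     (\<Prod>i\<in>UNIV. flat_exp 1 (r * x $ i + (- r * a $ i - 1)) * flat_exp 1 (- r * x $ i + (r * b $ i - 1)))"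

lemma times_diff_box_bump: "times_diff m (box_bump a b r)"
  unfolding box_bump_def by (intro times_diff_prod times_diff_mult times_diff_flat_exp)

lemma flat_exp_1_bounds: "0 \<le> flat_exp 1 t" "flat_exp 1 t \<le> 1"
  by (auto simp: flat_exp_def)

lemma box_bump_bounds: "0 \<le> box_bump a b r x" "box_bump a b r x \<le> 1"
  unfolding box_bump_def
  by (auto intro!: prod_nonneg prod_le_1 mult_le_one mult_nonneg_nonneg flat_exp_1_bounds)

lemma box_bump_eq_0:
  assumes r: "r > 0" and x: "x \<notin> cbox (\<chi> i. a $ i + 1 / r) (\<chi> i. b $ i - 1 / r)"
  shows "box_bump a b r x = 0"
proof -
  obtain i where "x $ i < a $ i + 1 / r \<or> x $ i > b $ i - 1 / r"
    using x by (auto simp: mem_box_cart not_le)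
  then have "r * x $ i + (- r * a $ i - 1) \<le> 0 \<or> - r * x $ i + (r * b $ i - 1) \<le> 0"
    using r by (auto simp: field_simps)
  then show ?thesis
    unfolding box_bump_def by (intro prod_zero) (auto simp: flat_exp_def intro!: exI[of _ i])
qed

lemma box_bump_tendsto:
  "(\<lambda>m. box_bump a b (real m) x) \<longlonglongrightarrow> indicator (box a b) x"
proof (cases "x \<in> box a b")
  case True
  have lim: "(\<lambda>m. flat_exp 1 (real m * s + - 1)) \<longlonglongrightarrow> 1" if "s > 0" for s
  proof -
    have "filterlim (\<lambda>m. real m * s) at_top sequentially"
      by (rule filterlim_at_top_mult_tendsto_pos[OF tendsto_const that filterlim_real_sequentially])
    then have f: "filterlim (\<lambda>m. real m * s + - 1) at_top sequentially"
      using filterlim_tendsto_add_at_top[OF tendsto_const[of "- 1 :: real"]] by (simp add: add.commute)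
    have "((\<lambda>t. flat_exp 1 t) \<longlongrightarrow> 1) at_top"
    proof (rule tendsto_cong[THEN iffD1])
      show "\<forall>\<^sub>F t in at_top. exp (- (1 / t)) = flat_exp 1 t"
        using eventually_gt_at_top[of 0] by eventually_elim (auto simp: flat_exp_def)
      have "((\<lambda>t::real. exp (- inverse t)) \<longlongrightarrow> exp (- 0)) at_top"
        by (intro tendsto_intros tendsto_inverse_0_at_top filterlim_ident)
      then show "((\<lambda>t::real. exp (- (1 / t))) \<longlongrightarrow> 1) at_top"
        by (simp add: inverse_eq_divide)
    qed
    from filterlim_compose[OF this f] show ?thesis .
  qed
  have "(\<lambda>m. flat_exp 1 (real m * x $ i + (- real m * a $ i - 1)) *
          flat_exp 1 (- real m * x $ i + (real m * b $ i - 1))) \<longlonglongrightarrow> 1 * 1" for i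
  proof -
    have "x $ i - a $ i > 0" "b $ i - x $ i > 0" using True by (auto simp: mem_box_cart)
    from tendsto_mult[OF lim[OF this(1)] lim[OF this(2)]]
    show ?thesis by (simp add: algebra_simps)
  qed
  then have "(\<lambda>m. box_bump a b (real m) x) \<longlonglongrightarrow> (\<Prod>i\<in>(UNIV::'a set). 1 * 1)"
    unfolding box_bump_def by (intro tendsto_prod) auto
  then show ?thesis using True by simp
next
  case False
  have "box_bump a b (real m) x = 0" if "m > 0" for m
  proof (rule box_bump_eq_0)
    have "cbox (\<chi> i. a $ i + 1 / real m) (\<chi> i. b $ i - 1 / real m) \<subseteq> box a b"
      using that by (auto simp: mem_box_cart) (smt (verit) divide_pos_pos of_nat_0_less_iff)+
    then show "x \<notin> cbox (\<chi> i. a $ i + 1 / real m) (\<chi> i. b $ i - 1 / real m)" using False by auto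
  qed (use that in auto)
  then have "\<forall>\<^sub>F m in sequentially. box_bump a b (real m) x = 0"
    using eventually_gt_at_top[of 0] by (rule eventually_mono[rotated])
  then show ?thesis using False by (simp add: tendsto_eventually)
qed

section \<open>The fundamental lemma of the calculus of variations\<close>

lemma test_functionI:
  assumes "\<And>m. times_diff m \<phi>" "compact S" "S \<subseteq> \<Xi>" "\<And>x. x \<notin> S \<Longrightarrow> \<phi> x = 0"
  shows "test_function \<Xi> \<phi>"
  using assms by (auto simp: test_function_def)

lemma cbox_shrink_subset_box:
  fixes a b :: "real ^ 'n::finite"
  assumes "r > 0"
  shows "cbox (\<chi> i. a $ i + 1 / r) (\<chi> i. b $ i - 1 / r) \<subseteq> box a b"
proof
  fix x assume x: "x \<in> cbox (\<chi> i. a $ i + 1 / r) (\<chi> i. b $ i - 1 / r)"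
  have "0 < 1 / r" using assms by simp
  moreover have "a $ i + 1 / r \<le> x $ i \<and> x $ i \<le> b $ i - 1 / r" for i
    using x by (simp add: mem_box_cart)
  ultimately show "x \<in> box a b" unfolding mem_box_cart by (meson diff_gt_0_iff_gt less_add_same_cancel1 less_le_trans le_less_trans diff_less_eq)
qed

text \<open>
  Cover \<open>W\<close> by countably many boxes with bumps \<open>\<phi>\<^sub>j\<close> and take \<open>1 - \<Prod>\<^bsub>j<m\<^esub> (1 - \<phi>\<^sub>j)\<close>, with the
  parameter of the bumps growing with \<open>m\<close>.
\<close>

lemma open_test_functions_tendsto_indicator:
  fixes W :: "(real ^ 'n::finite) set"
  assumes "open W"
  obtains F :: "nat \<Rightarrow> real ^ 'n \<Rightarrow> real" where
    "\<And>m. test_function W (F m)" "\<And>m x. \<bar>F m x\<bar> \<le> 1"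
    "\<And>x. (\<lambda>m. F m x) \<longlonglongrightarrow> indicator W x"
proof -
  obtain D where D: "countable D" "D \<subseteq> Pow W" "\<And>X. X \<in> D \<Longrightarrow> \<exists>a b. X = box a b" "\<Union>D = W"
    using open_countable_Union_open_box[OF assms] by metis
  \<comment> \<open>The empty box makes the enumeration total even if \<open>W\<close> is empty.\<close>
  define D' where "D' = insert {} D"
  have D': "countable D'" "D' \<noteq> {}" using D(1) by (auto simp: D'_def)
  have "\<exists>a b. from_nat_into D' j = box a b" for j
  proof -
    have "from_nat_into D' j \<in> D'" using D' by (simp add: from_nat_into)
    moreover have "({} :: (real ^ 'n) set) = box 0 0" by simp
    ultimately show ?thesis using D(3) unfolding D'_def by blast
  qed
  then obtain a b where ab: "\<And>j. from_nat_into D' j = box (a j) (b j)" by metis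
  have W: "W = (\<Union>j. box (a j) (b j))"
    using D(4) range_from_nat_into[OF D'(2,1)] unfolding ab[symmetric] D'_def by auto
  define F where "F m x = 1 - (\<Prod>j<m. 1 - box_bump (a j) (b j) (real m) x)" for m x
  have p: "0 \<le> (\<Prod>j<m. 1 - box_bump (a j) (b j) (real m) x)"
    "(\<Prod>j<m. 1 - box_bump (a j) (b j) (real m) x) \<le> 1" for m x
    using box_bump_bounds by (auto intro!: prod_nonneg prod_le_1 simp: diff_ge_0_iff_ge)
  let ?S = "\<lambda>m. \<Union>j<m. cbox (\<chi> i. a j $ i + 1 / real m) (\<chi> i. b j $ i - 1 / real m)"
  have S: "?S m \<subseteq> W" for m
  proof (cases "m = 0")
    case False
    then show ?thesis unfolding W by (intro UN_mono cbox_shrink_subset_box) auto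
  qed auto
  have F0: "F m x = 0" if "x \<notin> ?S m" for m x
  proof -
    have "box_bump (a j) (b j) (real m) x = 0" if j: "j < m" for j
      by (rule box_bump_eq_0) (use that \<open>x \<notin> ?S m\<close> in auto)
    then show ?thesis by (simp add: F_def)
  qed
  show ?thesis
  proof
    show "test_function W (F m)" for m
    proof (rule test_functionI[OF _ _ S F0])
      have "times_diff l (\<lambda>x. 1 + (-1) * (\<Prod>j<m. 1 + (-1) * box_bump (a j) (b j) (real m) x))" for l
        by (intro times_diff_add times_diff_const times_diff_mult times_diff_prod times_diff_box_bump)
      then show "times_diff l (F m)" for l by (simp add: F_def[abs_def])
    qed auto
    show "\<bar>F m x\<bar> \<le> 1" for m x using p[of m x] by (auto simp: F_def)
    fix x
    show "(\<lambda>m. F m x) \<longlonglongrightarrow> indicator W x"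
    proof (cases "x \<in> W")
      case True
      then obtain j where j: "x \<in> box (a j) (b j)" unfolding W by blast
      have le: "box_bump (a j) (b j) (real m) x \<le> F m x" if "m > j" for m
      proof -
        have "(\<Prod>l<m. 1 - box_bump (a l) (b l) (real m) x) =
            (1 - box_bump (a j) (b j) (real m) x) * (\<Prod>l\<in>{..<m} - {j}. 1 - box_bump (a l) (b l) (real m) x)"
          using that by (subst prod.remove[of _ j]) auto
        also have "\<dots> \<le> (1 - box_bump (a j) (b j) (real m) x) * 1"
          using box_bump_bounds by (intro mult_left_mono prod_le_1) (auto simp: diff_ge_0_iff_ge)
        finally show ?thesis by (simp add: F_def)
      qed
      have lim: "(\<lambda>m. box_bump (a j) (b j) (real m) x) \<longlonglongrightarrow> 1"
        using box_bump_tendsto[of "a j" "b j" x] j by simp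
      have "\<forall>\<^sub>F m in sequentially. box_bump (a j) (b j) (real m) x \<le> F m x"
        using eventually_gt_at_top[of j] by eventually_elim (rule le)
      moreover have "\<forall>\<^sub>F m in sequentially. F m x \<le> 1"
        using p(1)[of _ x] by (simp add: F_def)
      ultimately have "(\<lambda>m. F m x) \<longlonglongrightarrow> 1"
        using tendsto_sandwich[OF _ _ lim tendsto_const] by simp
      then show ?thesis using True by simp
    next
      case False
      then have "F m x = 0" for m using S F0 by blast
      then show ?thesis using False by simp
    qed
  qed
qed

lemma test_function_mono: "test_function \<Xi>' \<phi> \<Longrightarrow> \<Xi>' \<subseteq> \<Xi> \<Longrightarrow> test_function \<Xi> \<phi>"
  unfolding test_function_def by blast

text \<open>
  The sets on which the integral vanishes form a Dynkin system, and the open sets are an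
  intersection-stable generator.
\<close>

lemma integral_open_eq_0_imp_AE_0:
  fixes g :: "'a::euclidean_space \<Rightarrow> real"
  assumes g: "integrable lborel g" and U: "\<And>U. open U \<Longrightarrow> (LINT x:U|lborel. g x) = 0"
  shows "AE x in lborel. g x = 0"
proof (rule density_unique_real[OF g])
  show "integrable lborel (\<lambda>x. 0 :: real)" by simp
  have si: "set_integrable lborel B g" if "B \<in> sets lborel" for B
    unfolding set_integrable_def by (rule integrable_mult_indicator[OF that g])
  fix A :: "'a set" assume "A \<in> sets lborel"
  then have A: "A \<in> sigma_sets UNIV {S. open S}" by (simp add: borel_def)
  have "Int_stable {S :: 'a set. open S}" "{S :: 'a set. open S} \<subseteq> Pow UNIV"
    by (auto simp: Int_stable_def)
  then have "(LINT x:A|lborel. g x) = 0"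
    using A
  proof (induction A rule: sigma_sets_induct_disjoint)
    case (compl A)
    have A: "A \<in> sets lborel" using compl by (simp add: borel_def)
    have "(LINT x:UNIV|lborel. g x) = (LINT x:A|lborel. g x) + (LINT x:(UNIV - A)|lborel. g x)"
      using A by (subst set_integral_Un[symmetric]) (auto intro!: si)
    then show ?case using compl U[of UNIV] by simp
  next
    case (union A)
    have A: "A i \<in> sets lborel" for i using union by (auto simp: borel_def)
    have "(LINT x:(\<Union>i. A i)|lborel. g x) = (\<Sum>i. (LINT x:(A i)|lborel. g x))"
      using A union(1) by (intro lebesgue_integral_countable_add)
        (auto simp: disjoint_family_on_def intro!: si)
    then show ?case using union by simp
  qed (use U in \<open>auto simp: set_lebesgue_integral_def\<close>)
  then show "(LINT x:A|lborel. g x) = (LINT x:A|lborel. 0)"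
    by (simp add: set_lebesgue_integral_def)
qed

lemma fundamental_lemma:
  fixes g :: "real ^ 'n::finite \<Rightarrow> real"
  assumes \<Xi>: "open \<Xi>" and g: "integrable (lebesgue_on \<Xi>) g"
    and eq: "\<And>\<phi>. test_function \<Xi> \<phi> \<Longrightarrow> (LINT x|lebesgue_on \<Xi>. g x * \<phi> x) = 0"
  shows "AE x in lebesgue_on \<Xi>. g x = 0"
proof -
  have \<Xi>s: "\<Xi> \<in> sets lebesgue" using \<Xi> by simp
  define G where "G x = indicator \<Xi> x *\<^sub>R g x" for x
  have G: "integrable lebesgue G"
    using g \<Xi>s unfolding G_def by (subst (asm) integrable_restrict_space) auto
  then have "G \<in> borel_measurable lebesgue" by auto
  then obtain G' where G': "G' \<in> borel_measurable lborel" "AE x in lborel. G x = G' x"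
    using completion_ex_borel_measurable_real by blast
  have G'2: "G' \<in> borel_measurable lebesgue" using G'(1) by (rule measurable_completion)
  have ae: "AE x in lebesgue. G x = G' x" using G'(2) by (rule AE_completion)
  have "integrable lebesgue G'"
    by (rule integrable_cong_AE_imp[OF G G'2]) (use ae in auto)
  then have G'int: "integrable lborel G'"
    using G'(1) integrable_completion by blast
  have "AE x in lborel. G' x = 0"
  proof (rule integral_open_eq_0_imp_AE_0[OF G'int])
    fix U :: "(real ^ 'n) set" assume U: "open U"
    obtain F :: "nat \<Rightarrow> real ^ 'n \<Rightarrow> real" where
      F: "\<And>m. test_function (U \<inter> \<Xi>) (F m)" "\<And>m x. \<bar>F m x\<bar> \<le> 1"
        "\<And>x. (\<lambda>m. F m x) \<longlonglongrightarrow> indicator (U \<inter> \<Xi>) x"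
      using open_test_functions_tendsto_indicator[of "U \<inter> \<Xi>"] U \<Xi> by (metis open_Int)
    have Fm: "F m \<in> borel_measurable (lebesgue_on \<Xi>)" for m
    proof -
      have "continuous_on UNIV (F m)"
        using F(1)[of m] unfolding test_function_def by (metis times_diff.simps(1))
      then have "F m \<in> borel_measurable lebesgue"
        by (intro measurable_completion) (simp add: borel_measurable_continuous_onI)
      then show ?thesis by (rule measurable_restrict_space1)
    qed
    have gm: "g \<in> borel_measurable (lebesgue_on \<Xi>)" using g by auto
    have "(\<lambda>m. LINT x|lebesgue_on \<Xi>. g x * F m x) \<longlonglongrightarrow> (LINT x|lebesgue_on \<Xi>. g x * indicator (U \<inter> \<Xi>) x)"
    proof (rule integral_dominated_convergence[where w = "\<lambda>x. \<bar>g x\<bar>"])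
      have "U \<inter> \<Xi> \<in> sets (lebesgue_on \<Xi>)"
        using U \<Xi> \<Xi>s by (auto simp: sets_restrict_space_iff)
      then show "(\<lambda>x. g x * indicator (U \<inter> \<Xi>) x) \<in> borel_measurable (lebesgue_on \<Xi>)"
        using gm by measurable
      show "AE x in lebesgue_on \<Xi>. (\<lambda>m. g x * F m x) \<longlonglongrightarrow> g x * indicator (U \<inter> \<Xi>) x"
        by (intro AE_I2 tendsto_intros F)
      show "AE x in lebesgue_on \<Xi>. norm (g x * F m x) \<le> \<bar>g x\<bar>" for m
        using F(2)[of m] by (intro AE_I2) (simp add: abs_mult mult_left_le)
    qed (use g gm Fm in auto)
    moreover have "(LINT x|lebesgue_on \<Xi>. g x * F m x) = 0" for m
      using F(1)[of m] by (intro eq) (auto intro: test_function_mono)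
    ultimately have 0: "(LINT x|lebesgue_on \<Xi>. g x * indicator (U \<inter> \<Xi>) x) = 0"
      by (simp add: LIMSEQ_const_iff)
    have "(LINT x:U|lborel. G' x) = (LINT x|lebesgue. indicator U x *\<^sub>R G' x)"
      unfolding set_lebesgue_integral_def using G'(1) U by (subst integral_completion) auto
    also have "\<dots> = (LINT x|lebesgue. indicator U x *\<^sub>R G x)"
    proof (rule integral_cong_AE)
      show "AE x in lebesgue. indicator U x *\<^sub>R G' x = indicator U x *\<^sub>R G x"
        using ae by eventually_elim simp
      have "U \<in> sets lebesgue" using U by simp
      then show "(\<lambda>x. indicator U x *\<^sub>R G' x) \<in> borel_measurable lebesgue"
          "(\<lambda>x. indicator U x *\<^sub>R G x) \<in> borel_measurable lebesgue"
        using G G'2 by (auto intro!: borel_measurable_scaleR)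
    qed
    also have "\<dots> = (LINT x|lebesgue. indicator \<Xi> x *\<^sub>R (g x * indicator (U \<inter> \<Xi>) x))"
      by (rule Bochner_Integration.integral_cong) (auto simp: G_def indicator_def)
    also have "\<dots> = (LINT x|lebesgue_on \<Xi>. g x * indicator (U \<inter> \<Xi>) x)"
      using \<Xi>s by (subst integral_restrict_space) auto
    finally show "(LINT x:U|lborel. G' x) = 0" using 0 by simp
  qed
  then have "AE x in lebesgue. G' x = 0" by (rule AE_completion)
  with ae have "AE x in lebesgue. x \<in> \<Xi> \<longrightarrow> g x = 0"
    by eventually_elim (auto simp: G_def)
  then show ?thesis using \<Xi>s by (simp add: AE_restrict_space_iff)
qed

section \<open>Integration by parts\<close>

text \<open>
  \<open>F\<close> has the continuous partial derivative \<open>F'\<close> in direction \<open>i\<close>. Nothing is said about the other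
  directions, so the notion applies directly to functions that are affine in each coordinate.
\<close>

definition has_partial :: "'n::finite \<Rightarrow> (real ^ 'n \<Rightarrow> real) \<Rightarrow> (real ^ 'n \<Rightarrow> real) \<Rightarrow> bool" where
  "has_partial i F F' \<longleftrightarrow> continuous_on UNIV F \<and> continuous_on UNIV F' \<and>
     (\<forall>x. ((\<lambda>t. F (x + t *\<^sub>R axis i 1)) has_real_derivative F' x) (at 0))"

lemma has_partial_line:
  assumes "has_partial i F F'"
  shows "((\<lambda>t. F (x + t *\<^sub>R axis i 1)) has_real_derivative F' (x + s *\<^sub>R axis i 1)) (at s)"
proof -
  have "((\<lambda>t. F ((x + s *\<^sub>R axis i 1) + t *\<^sub>R axis i 1)) has_real_derivative F' (x + s *\<^sub>R axis i 1)) (at 0)"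
    using assms unfolding has_partial_def by blast
  then have "((\<lambda>t. F (x + (t + s) *\<^sub>R axis i 1)) has_real_derivative F' (x + s *\<^sub>R axis i 1)) (at 0)"
    by (simp add: scaleR_add_left algebra_simps)
  then show ?thesis
    using DERIV_shift[of "\<lambda>t. F (x + t *\<^sub>R axis i 1)" "F' (x + s *\<^sub>R axis i 1)" 0 s] by simp
qed

lemma integrable_lborel_compact_support:
  fixes h :: "'a::euclidean_space \<Rightarrow> 'b::{banach, second_countable_topology}"
  assumes h: "continuous_on UNIV h" and S: "compact S" "\<And>x. x \<notin> S \<Longrightarrow> h x = 0"
  shows "integrable lborel h"
proof -
  have "integrable lborel (\<lambda>x. indicator S x *\<^sub>R h x)"
    using S(1) continuous_on_subset[OF h] by (intro borel_integrable_compact) auto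
  also have "(\<lambda>x. indicator S x *\<^sub>R h x) = h"
    using S(2) by (auto simp: indicator_def)
  finally show ?thesis .
qed

lemma lborel_integral_shift:
  fixes G :: "'a::euclidean_space \<Rightarrow> real"
  assumes "continuous_on UNIV G"
  shows "(LINT x|lborel. G (x + c)) = (LINT x|lborel. G x)"
proof -
  have "(LINT x|lborel. G x) = (LINT x|distr lborel borel ((+) c). G x)"
    by (simp add: lborel_distr_plus)
  also have "\<dots> = (LINT x|lborel. G (c + x))"
    by (rule integral_distr) (use assms borel_measurable_continuous_onI in auto)
  finally show ?thesis by (simp add: add.commute)
qed

text \<open>
  By translation invariance the difference quotients of \<open>G\<close> have integral zero, and they converge
  dominatedly to \<open>G'\<close>.
\<close>

lemma integral_partial_eq_0:
  fixes G :: "real ^ 'n::finite \<Rightarrow> real"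
  assumes G: "has_partial i G G'" and S: "compact S" "\<And>x. x \<notin> S \<Longrightarrow> G x = 0" "\<And>x. x \<notin> S \<Longrightarrow> G' x = 0"
  shows "(LINT x|lborel. G' x) = 0"
proof -
  let ?e = "axis i 1 :: real ^ 'n"
  have cG: "continuous_on UNIV G" and cG': "continuous_on UNIV G'"
    using G by (auto simp: has_partial_def)
  have "bounded (G' ` S)"
    using S(1) continuous_on_subset[OF cG'] by (intro compact_imp_bounded compact_continuous_image) auto
  then obtain B where B: "B > 0" "\<And>x. x \<in> S \<Longrightarrow> \<bar>G' x\<bar> \<le> B"
    unfolding bounded_pos by auto
  then have B': "\<bar>G' x\<bar> \<le> B" for x using S(3)[of x] by (cases "x \<in> S") auto
  obtain R where R: "\<And>x. x \<in> S \<Longrightarrow> norm x \<le> R"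
    using compact_imp_bounded[OF S(1)] unfolding bounded_iff by auto
  define h where "h m = inverse (real (Suc m))" for m
  have h: "0 < h m" "h m \<le> 1" for m by (auto simp: h_def field_simps)
  have h0: "h \<longlonglongrightarrow> 0" unfolding h_def by (rule LIMSEQ_inverse_real_of_nat)
  define Q where "Q m x = (G (x + h m *\<^sub>R ?e) - G x) / h m" for m x
  have bound: "\<bar>Q m x\<bar> \<le> B * indicator (cball 0 (R + 1)) x" for m x
  proof (cases "x \<in> cball 0 (R + 1)")
    case True
    obtain z where "G (x + h m *\<^sub>R ?e) - G (x + 0 *\<^sub>R ?e) = (h m - 0) * G' (x + z *\<^sub>R ?e)"
      using MVT2[OF h(1)[of m], of "\<lambda>t. G (x + t *\<^sub>R ?e)" "\<lambda>t. G' (x + t *\<^sub>R ?e)"] has_partial_line[OF G]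
      by blast
    then have "Q m x = G' (x + z *\<^sub>R ?e)" using h(1)[of m] by (simp add: Q_def)
    then show ?thesis using B' True by simp
  next
    case False
    have "norm x \<le> norm (x + h m *\<^sub>R ?e) + norm (h m *\<^sub>R ?e)"
      by (metis add_diff_cancel_right' norm_triangle_ineq4)
    also have "norm (h m *\<^sub>R ?e) \<le> 1" using h[of m] by simp
    finally have "norm x \<le> norm (x + h m *\<^sub>R ?e) + 1" by simp
    then have "x \<notin> S" "x + h m *\<^sub>R ?e \<notin> S" using False R by (force simp: not_le)+
    then show ?thesis using False S(2) by (simp add: Q_def)
  qed
  have iG: "integrable lborel G" using cG S by (intro integrable_lborel_compact_support)
  have cGh: "continuous_on UNIV (\<lambda>x. G (x + c))" for c
    by (rule continuous_on_compose2[OF cG]) (auto intro: continuous_intros)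
  have iGh: "integrable lborel (\<lambda>x. G (x + c))" for c
  proof (rule integrable_lborel_compact_support[OF cGh])
    show "compact ((\<lambda>x. x - c) ` S)"
      using S(1) by (intro compact_continuous_image continuous_intros)
    show "G (x + c) = 0" if "x \<notin> (\<lambda>x. x - c) ` S" for x
      using that S(2)[of "x + c"] by (metis add_diff_cancel_right' image_eqI)
  qed
  have "(\<lambda>m. LINT x|lborel. Q m x) \<longlonglongrightarrow> (LINT x|lborel. G' x)"
  proof (rule integral_dominated_convergence[where w = "\<lambda>x. B * indicator (cball 0 (R + 1)) x"])
    show "integrable lborel (\<lambda>x :: real ^ 'n. B * indicator (cball 0 (R + 1)) x)"
      by (intro integrable_mult_right integrable_real_indicator) 
        (use emeasure_bounded_finite[of "cball (0 :: real ^ 'n) (R + 1)"] in auto)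
    show "AE x in lborel. (\<lambda>m. Q m x) \<longlonglongrightarrow> G' x"
    proof (intro AE_I2)
      fix x
      have "((\<lambda>t. (G (x + t *\<^sub>R ?e) - G x) / t) \<longlongrightarrow> G' x) (at 0)"
        using has_partial_line[OF G, of x 0] by (simp add: DERIV_def)
      moreover have "filterlim h (at 0) sequentially"
        using h0 h(1) by (auto simp: filterlim_at intro!: eventually_sequentiallyI less_imp_neq[symmetric])
      ultimately show "(\<lambda>m. Q m x) \<longlonglongrightarrow> G' x"
        unfolding Q_def by (rule filterlim_compose)
    qed
    show "AE x in lborel. norm (Q m x) \<le> B * indicator (cball 0 (R + 1)) x" for m
      using bound by (intro AE_I2) auto
    show "Q m \<in> borel_measurable lborel" for m
      unfolding Q_def using iG iGh by (intro borel_measurable_divide borel_measurable_diff) auto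
  qed (use cG' borel_measurable_continuous_onI in auto)
  moreover have "(LINT x|lborel. Q m x) = 0" for m
    using iG iGh lborel_integral_shift[OF cG] by (simp add: Q_def)
  ultimately show ?thesis by (simp add: LIMSEQ_const_iff)
qed

lemma has_partial_mult:
  assumes "has_partial i F F'" "has_partial i H H'"
  shows "has_partial i (\<lambda>x. F x * H x) (\<lambda>x. F' x * H x + F x * H' x)"
  using assms has_partial_line[OF assms(1), of _ 0] has_partial_line[OF assms(2), of _ 0]
  unfolding has_partial_def
  by (auto intro!: continuous_intros derivative_eq_intros)

lemma test_function_partial:
  fixes \<phi> :: "real ^ 'n::finite \<Rightarrow> 'b::real_normed_vector"
  assumes "test_function \<Xi> \<phi>"
  shows "test_function \<Xi> (partial_deriv i \<phi>)"
proof -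
  obtain S where S: "compact S" "S \<subseteq> \<Xi>" "\<And>x. x \<notin> S \<Longrightarrow> \<phi> x = 0"
    and t: "\<And>m. times_diff m \<phi>" using assms by (auto simp: test_function_def)
  have "times_diff m (partial_deriv i \<phi>)" for m
    using t[of "Suc m"] by (simp add: times_diff.simps(2)[of _ \<phi>])
  moreover have "partial_deriv i \<phi> x = 0" if "x \<notin> S" for x
  proof -
    have "((\<lambda>_. 0 :: 'b) has_derivative (\<lambda>_. 0)) (at x)" by simp
    then have "(\<phi> has_derivative (\<lambda>_. 0)) (at x)"
      by (rule has_derivative_transform_within_open[where s = "- S"])
        (use that S compact_imp_closed in auto)
    from partial_derivI[OF this] show ?thesis by simp
  qed
  ultimately show ?thesis using S(1,2) by (intro test_functionI) auto
qed

lemma test_function_continuous: "test_function \<Xi> \<phi> \<Longrightarrow> continuous_on UNIV \<phi>"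
  unfolding test_function_def by (metis times_diff.simps(1))

lemma has_partial_test_function:
  assumes "test_function \<Xi> \<phi>"
  shows "has_partial i \<phi> (partial_deriv i \<phi>)"
proof -
  have "times_diff (Suc 0) \<phi>" using assms unfolding test_function_def by blast
  then obtain f' where f': "\<And>x. (\<phi> has_derivative f' x) (at x)"
    "\<And>i. partial_deriv i \<phi> = (\<lambda>x. f' x (axis i 1))" using times_diff_SucD by metis
  have "((\<lambda>t. \<phi> (x + t *\<^sub>R axis i 1)) has_real_derivative partial_deriv i \<phi> x) (at 0)" for x
  proof -
    have "((\<lambda>t. x + t *\<^sub>R axis i 1) has_derivative (\<lambda>t. t *\<^sub>R axis i 1)) (at 0)"
      by (auto intro!: derivative_eq_intros)
    from has_derivative_compose[OF this, of \<phi> "f' x"] f'(1)[of x]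
    have "((\<lambda>t. \<phi> (x + t *\<^sub>R axis i 1)) has_derivative (\<lambda>t. f' x (t *\<^sub>R axis i 1))) (at 0)"
      by simp
    moreover have "f' x (t *\<^sub>R axis i 1) = f' x (axis i 1) * t" for t
      using has_derivative_linear[OF f'(1)[of x]] by (simp add: linear_scale)
    ultimately show ?thesis by (simp add: has_field_derivative_def f'(2))
  qed
  then show ?thesis
    using test_function_continuous[OF assms] test_function_continuous[OF test_function_partial[OF assms]]
    by (auto simp: has_partial_def)
qed

lemma lebesgue_on_integral_compact_support:
  fixes h :: "real ^ 'n::finite \<Rightarrow> real"
  assumes h: "continuous_on UNIV h" and S: "compact S" "S \<subseteq> \<Xi>" "\<And>x. x \<notin> S \<Longrightarrow> h x = 0" and \<Xi>: "open \<Xi>"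
  shows "(LINT x|lebesgue_on \<Xi>. h x) = (LINT x|lborel. h x)"
    and "integrable (lebesgue_on \<Xi>) h"
proof -
  have i: "integrable lborel h" by (rule integrable_lborel_compact_support[OF h S(1,3)])
  have e: "(\<lambda>x. indicator \<Xi> x *\<^sub>R h x) = h"
    using S(2,3) by (force simp: indicator_def)
  show "integrable (lebesgue_on \<Xi>) h"
    using i \<Xi> by (subst integrable_restrict_space) (auto simp: e[simplified] integrable_completion)
  show "(LINT x|lebesgue_on \<Xi>. h x) = (LINT x|lborel. h x)"
    using i \<Xi> by (subst integral_restrict_space) (auto simp: e[simplified] integral_completion)
qed

lemma integration_by_parts:
  fixes F :: "real ^ 'n::finite \<Rightarrow> real"
  assumes F: "has_partial i F F'" and \<phi>: "test_function \<Xi> \<phi>" and \<Xi>: "open \<Xi>"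
  shows "(LINT x|lebesgue_on \<Xi>. F' x * \<phi> x) = - (LINT x|lebesgue_on \<Xi>. F x * partial_deriv i \<phi> x)"
proof -
  note p = has_partial_test_function[OF \<phi>, of i]
  obtain S where S: "compact S" "S \<subseteq> \<Xi>" "\<And>x. x \<notin> S \<Longrightarrow> \<phi> x = 0"
    using \<phi> by (auto simp: test_function_def)
  obtain T where T: "compact T" "T \<subseteq> \<Xi>" "\<And>x. x \<notin> T \<Longrightarrow> partial_deriv i \<phi> x = 0"
    using test_function_partial[OF \<phi>, of i] by (auto simp: test_function_def)
  have ST: "compact (S \<union> T)" "S \<union> T \<subseteq> \<Xi>" using S T by auto
  have cont: "continuous_on UNIV (\<lambda>x. F' x * \<phi> x)" "continuous_on UNIV (\<lambda>x. F x * partial_deriv i \<phi> x)"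
    using F p by (auto simp: has_partial_def intro: continuous_intros)
  have "(LINT x|lborel. F' x * \<phi> x + F x * partial_deriv i \<phi> x) = 0"
    by (rule integral_partial_eq_0[OF has_partial_mult[OF F p] ST(1)]) (use S T in auto)
  moreover have "integrable lborel (\<lambda>x. F' x * \<phi> x)" "integrable lborel (\<lambda>x. F x * partial_deriv i \<phi> x)"
    by (rule integrable_lborel_compact_support[OF _ ST(1)]; use cont S T in auto)+
  ultimately have "(LINT x|lborel. F' x * \<phi> x) + (LINT x|lborel. F x * partial_deriv i \<phi> x) = 0"
    by simp
  moreover have "(LINT x|lebesgue_on \<Xi>. F' x * \<phi> x) = (LINT x|lborel. F' x * \<phi> x)"
    "(LINT x|lebesgue_on \<Xi>. F x * partial_deriv i \<phi> x) = (LINT x|lborel. F x * partial_deriv i \<phi> x)"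
    by (rule lebesgue_on_integral_compact_support(1)[OF _ ST _ \<Xi>]; use cont S T in auto)+
  ultimately show ?thesis by simp
qed

section \<open>Weak exterior derivatives\<close>

lemma pos_sign_square [simp]: "pos_sign i \<beta> * pos_sign i \<beta> = 1"
  by (simp add: pos_sign_def flip: power_mult_distrib)

text \<open>
  Pairs of a set \<open>\<beta>\<close> of size \<open>k + 1\<close> and \<open>i \<in> \<beta>\<close> correspond to pairs of a set \<open>\<alpha> = \<beta> - {i}\<close> of size \<open>k\<close>
  and \<open>i \<notin> \<alpha>\<close>. This is the algebraic part of the adjointness of \<open>d\<close> and \<open>\<delta>\<close>.
\<close>

lemma sum_faces:
  fixes g :: "'n::finite \<Rightarrow> 'n set \<Rightarrow> real"
  shows "(\<Sum>\<beta> | card \<beta> = k + 1. \<Sum>i\<in>\<beta>. g i (\<beta> - {i})) = (\<Sum>\<alpha> | card \<alpha> = k. \<Sum>i\<in>-\<alpha>. g i \<alpha>)"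
proof -
  have "(\<Sum>\<beta> | card \<beta> = k + 1. \<Sum>i\<in>\<beta>. g i (\<beta> - {i})) =
      (\<Sum>(\<beta>, i) \<in> Sigma {\<beta>. card \<beta> = k + 1} (\<lambda>\<beta>. \<beta>). g i (\<beta> - {i}))"
    by (rule sum.Sigma) auto
  also have "\<dots> = (\<Sum>(\<alpha>, i) \<in> Sigma {\<alpha>. card \<alpha> = k} (\<lambda>\<alpha>. - \<alpha>). g i \<alpha>)"
    by (rule sum.reindex_bij_witness[where i = "\<lambda>(\<alpha>, i). (insert i \<alpha>, i)" and j = "\<lambda>(\<beta>, i). (\<beta> - {i}, i)"])
      (auto simp: insert_absorb)
  also have "\<dots> = (\<Sum>\<alpha> | card \<alpha> = k. \<Sum>i\<in>-\<alpha>. g i \<alpha>)"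
    by (rule sum.Sigma[symmetric]) auto
  finally show ?thesis .
qed

lemma L2_inner_eq_ip: "L2_inner \<Xi> = ip (lebesgue_on \<Xi>)"
  by (intro ext) (simp add: L2_inner_def ip_def)

lemma L2_norm_eq_nrm: "L2_norm \<Xi> = nrm (lebesgue_on \<Xi>)"
  by (intro ext) (simp add: L2_norm_def L2_inner_eq_ip nrm_eq_sqrt_ip)

lemma L2_forms_iff:
  "\<omega> \<in> L2_forms \<Xi> k \<longleftrightarrow> sq_int (lebesgue_on \<Xi>) \<omega> \<and> (AE x in lebesgue_on \<Xi>. \<omega> x \<in> alt_forms k)"
  by (auto simp: L2_forms_def sq_int_def)

lemma alt_forms_diff: "v \<in> alt_forms k \<Longrightarrow> w \<in> alt_forms k \<Longrightarrow> v - w \<in> alt_forms k"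
  by (simp add: alt_forms_def)

lemma L2_forms_diff:
  "\<omega> \<in> L2_forms \<Xi> k \<Longrightarrow> \<eta> \<in> L2_forms \<Xi> k \<Longrightarrow> (\<lambda>x. \<omega> x - \<eta> x) \<in> L2_forms \<Xi> k"
  unfolding L2_forms_iff by (auto intro: sq_int_diff alt_forms_diff elim: eventually_elim2)

lemma integrable_continuous_bounded:
  fixes q :: "real ^ 'n::finite \<Rightarrow> 'b::{banach, second_countable_topology}"
  assumes q: "continuous_on UNIV q" and \<Xi>: "open \<Xi>" "bounded \<Xi>"
  shows "integrable (lebesgue_on \<Xi>) q"
proof -
  obtain R where "\<forall>x\<in>\<Xi>. norm x \<le> R" using \<Xi>(2) unfolding bounded_iff by auto
  then have R: "\<Xi> \<subseteq> cball 0 R" by auto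
  have "integrable lborel (\<lambda>x. indicator (cball 0 R) x *\<^sub>R q x)"
    using continuous_on_subset[OF q] by (intro borel_integrable_compact) auto
  then have "integrable lebesgue (\<lambda>x. indicator (cball 0 R) x *\<^sub>R q x)"
    by (simp add: integrable_completion)
  then have "integrable lebesgue (\<lambda>x. indicator \<Xi> x *\<^sub>R indicator (cball 0 R) x *\<^sub>R q x)"
    by (rule integrable_mult_indicator[rotated]) (use \<Xi>(1) in auto)
  also have "(\<lambda>x. indicator \<Xi> x *\<^sub>R indicator (cball 0 R) x *\<^sub>R q x) = (\<lambda>x. indicator \<Xi> x *\<^sub>R q x)"
    using R by (intro ext) (auto split: split_indicator)
  finally show ?thesis using \<Xi>(1) by (subst integrable_restrict_space) auto
qed

lemma continuous_measurable_lebesgue_on: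
  fixes q :: "'a::euclidean_space \<Rightarrow> 'b::topological_space"
  assumes "continuous_on UNIV q"
  shows "q \<in> borel_measurable (lebesgue_on \<Xi>)"
  using assms by (intro measurable_restrict_space1 measurable_completion) (simp add: borel_measurable_continuous_onI)

lemma continuous_sq_int:
  fixes q :: "real ^ 'n::finite \<Rightarrow> 'b::euclidean_space"
  assumes q: "continuous_on UNIV q" and \<Xi>: "open \<Xi>" "bounded \<Xi>"
  shows "sq_int (lebesgue_on \<Xi>) q"
  unfolding sq_int_def
  using q \<Xi> by (auto intro!: continuous_measurable_lebesgue_on integrable_continuous_bounded continuous_intros)

lemma continuous_L2_forms:
  assumes "continuous_on UNIV q" "open \<Xi>" "bounded \<Xi>" "\<And>x. q x \<in> alt_forms k"
  shows "q \<in> L2_forms \<Xi> k"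
  unfolding L2_forms_iff using assms by (auto intro: continuous_sq_int)

lemma sq_int_coeff_integrable:
  fixes \<omega> :: "real ^ 'n::finite \<Rightarrow> real ^ 'm::finite"
  assumes \<omega>: "sq_int (lebesgue_on \<Xi>) \<omega>" and "continuous_on UNIV \<phi>" and \<Xi>: "open \<Xi>" "bounded \<Xi>"
  shows "integrable (lebesgue_on \<Xi>) (\<lambda>x. \<omega> x $ \<beta> * \<phi> x)"
proof -
  have "sq_int (lebesgue_on \<Xi>) (\<lambda>x. \<phi> x *\<^sub>R axis \<beta> (1 :: real) :: real ^ 'm)"
    using assms by (intro continuous_sq_int continuous_intros) auto
  from sq_int_integrable_inner[OF \<omega> this] show ?thesis
    by (simp add: inner_axis mult.commute)
qed

text \<open>
  Uniqueness of the weak exterior derivative and of the weak codifferential both follow from this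
  lemma.
\<close>

lemma L2_forms_eqI:
  assumes \<omega>: "\<omega> \<in> L2_forms \<Xi> k" "\<eta> \<in> L2_forms \<Xi> k" and \<Xi>: "open \<Xi>" "bounded \<Xi>"
    and eq: "\<And>\<phi> \<beta>. test_function \<Xi> \<phi> \<Longrightarrow> card \<beta> = k \<Longrightarrow>
      (LINT x|lebesgue_on \<Xi>. \<omega> x $ \<beta> * \<phi> x) = (LINT x|lebesgue_on \<Xi>. \<eta> x $ \<beta> * \<phi> x)"
  shows "AE x in lebesgue_on \<Xi>. \<omega> x = \<eta> x"
proof -
  have s: "sq_int (lebesgue_on \<Xi>) \<omega>" "sq_int (lebesgue_on \<Xi>) \<eta>"
    and alt: "AE x in lebesgue_on \<Xi>. \<omega> x \<in> alt_forms k" "AE x in lebesgue_on \<Xi>. \<eta> x \<in> alt_forms k"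
    using \<omega> by (auto simp: L2_forms_iff)
  have "AE x in lebesgue_on \<Xi>. \<omega> x $ \<beta> = \<eta> x $ \<beta>" for \<beta>
  proof (cases "card \<beta> = k")
    case True
    have i: "integrable (lebesgue_on \<Xi>) (\<lambda>x. \<omega> x $ \<beta> * \<phi> x)"
      "integrable (lebesgue_on \<Xi>) (\<lambda>x. \<eta> x $ \<beta> * \<phi> x)" if "continuous_on UNIV \<phi>" for \<phi>
      using sq_int_coeff_integrable s that \<Xi> by blast+
    have "AE x in lebesgue_on \<Xi>. \<omega> x $ \<beta> - \<eta> x $ \<beta> = 0"
    proof (rule fundamental_lemma[OF \<Xi>(1)])
      show "integrable (lebesgue_on \<Xi>) (\<lambda>x. \<omega> x $ \<beta> - \<eta> x $ \<beta>)"
        using i[of "\<lambda>_. 1"] by simp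
      fix \<phi> :: "real ^ 'a \<Rightarrow> real" assume \<phi>: "test_function \<Xi> \<phi>"
      then show "(LINT x|lebesgue_on \<Xi>. (\<omega> x $ \<beta> - \<eta> x $ \<beta>) * \<phi> x) = 0"
        using eq[OF \<phi> True] i[OF test_function_continuous[OF \<phi>]] by (simp add: left_diff_distrib)
    qed
    then show ?thesis by simp
  next
    case False
    from alt show ?thesis by eventually_elim (simp add: alt_forms_def False)
  qed
  then have "AE x in lebesgue_on \<Xi>. \<forall>\<beta>\<in>UNIV. \<omega> x $ \<beta> = \<eta> x $ \<beta>"
    by (intro AE_finite_allI) auto
  then show ?thesis by eventually_elim (simp add: vec_eq_iff)
qed

lemma ext_d_eqI:
  assumes \<Xi>: "open \<Xi>" "bounded \<Xi>" and \<eta>: "\<eta> \<in> L2_forms \<Xi> (k + 1)" "is_weak_d \<Xi> k \<omega> \<eta>"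
  shows "ext_d \<Xi> k \<omega> \<in> L2_forms \<Xi> (k + 1)" "is_weak_d \<Xi> k \<omega> (ext_d \<Xi> k \<omega>)"
    "AE x in lebesgue_on \<Xi>. ext_d \<Xi> k \<omega> x = \<eta> x"
proof -
  have *: "ext_d \<Xi> k \<omega> \<in> L2_forms \<Xi> (k + 1) \<and> is_weak_d \<Xi> k \<omega> (ext_d \<Xi> k \<omega>)"
    unfolding ext_d_def
    by (rule someI[of "\<lambda>\<eta>. \<eta> \<in> L2_forms \<Xi> (k + 1) \<and> is_weak_d \<Xi> k \<omega> \<eta>" \<eta>]) (use \<eta> in blast)
  then show "ext_d \<Xi> k \<omega> \<in> L2_forms \<Xi> (k + 1)" "is_weak_d \<Xi> k \<omega> (ext_d \<Xi> k \<omega>)" by auto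
  show "AE x in lebesgue_on \<Xi>. ext_d \<Xi> k \<omega> x = \<eta> x"
    by (rule L2_forms_eqI[OF _ \<eta>(1) \<Xi>]) (use * \<eta>(2) in \<open>auto simp: is_weak_d_def\<close>)
qed

lemma H_space_ext_d:
  assumes "\<omega> \<in> H_space \<Xi> k" "open \<Xi>" "bounded \<Xi>"
  shows "\<omega> \<in> L2_forms \<Xi> k" "ext_d \<Xi> k \<omega> \<in> L2_forms \<Xi> (k + 1)" "is_weak_d \<Xi> k \<omega> (ext_d \<Xi> k \<omega>)"
  using assms ext_d_eqI(1,2) unfolding H_space_def by blast+

lemma is_weak_d_diff:
  fixes \<omega> :: "'n::{finite,linorder} form"
  assumes "is_weak_d \<Xi> k \<omega> \<omega>'" "is_weak_d \<Xi> k \<eta> \<eta>'" and \<Xi>: "open \<Xi>" "bounded \<Xi>"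
    and s: "sq_int (lebesgue_on \<Xi>) \<omega>" "sq_int (lebesgue_on \<Xi>) \<omega>'"
      "sq_int (lebesgue_on \<Xi>) \<eta>" "sq_int (lebesgue_on \<Xi>) \<eta>'"
  shows "is_weak_d \<Xi> k (\<lambda>x. \<omega> x - \<eta> x) (\<lambda>x. \<omega>' x - \<eta>' x)"
  unfolding is_weak_d_def
proof (intro allI impI)
  fix \<phi> :: "(real, 'n) vec \<Rightarrow> real" and \<beta> :: "'n set" assume *: "test_function \<Xi> \<phi> \<and> card \<beta> = k + 1"
  note i = sq_int_coeff_integrable[OF _ _ \<Xi>]
  have c: "continuous_on UNIV \<phi>" "continuous_on UNIV (partial_deriv i \<phi>)" for i
    using * test_function_continuous test_function_partial by blast+
  show "(LINT x|lebesgue_on \<Xi>. (\<omega>' x - \<eta>' x) $ \<beta> * \<phi> x) =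
      - (\<Sum>i\<in>\<beta>. pos_sign i \<beta> * (LINT x|lebesgue_on \<Xi>. (\<omega> x - \<eta> x) $ (\<beta> - {i}) * partial_deriv i \<phi> x))"
    using assms(1,2) * by (simp add: is_weak_d_def left_diff_distrib i s c right_diff_distrib sum_subtractf)
qed

lemma integral_coeff_cong_AE:
  fixes \<omega> :: "real ^ 'n::finite \<Rightarrow> real ^ 'm::finite"
  assumes m: "\<omega> \<in> borel_measurable (lebesgue_on \<Xi>)" and \<Xi>: "open \<Xi>"
    and ae: "AE x in lebesgue_on \<Xi>. \<omega> x = \<omega>' x" and \<phi>: "continuous_on UNIV \<phi>"
  shows "(LINT x|lebesgue_on \<Xi>. \<omega> x $ \<beta> * \<phi> x) = (LINT x|lebesgue_on \<Xi>. \<omega>' x $ \<beta> * \<phi> x)"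
proof (rule integral_cong_AE)
  have m': "\<omega>' \<in> borel_measurable (lebesgue_on \<Xi>)"
    using \<Xi> by (intro lebesgue_on_measurable_cong_AE[OF m _ ae]) auto
  have "(\<lambda>x. \<omega> x $ \<beta>) \<in> borel_measurable (lebesgue_on \<Xi>)"
    "(\<lambda>x. \<omega>' x $ \<beta>) \<in> borel_measurable (lebesgue_on \<Xi>)"
    using measurable_compose[OF m, of "\<lambda>v. v $ \<beta>"] measurable_compose[OF m', of "\<lambda>v. v $ \<beta>"]
    by (simp_all add: borel_measurable_continuous_onI continuous_intros)
  then show "(\<lambda>x. \<omega> x $ \<beta> * \<phi> x) \<in> borel_measurable (lebesgue_on \<Xi>)"
    "(\<lambda>x. \<omega>' x $ \<beta> * \<phi> x) \<in> borel_measurable (lebesgue_on \<Xi>)"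
    using continuous_measurable_lebesgue_on[OF \<phi>] by simp_all
  show "AE x in lebesgue_on \<Xi>. \<omega> x $ \<beta> * \<phi> x = \<omega>' x $ \<beta> * \<phi> x"
    using ae by eventually_elim simp
qed

lemma is_weak_d_cong_AE:
  fixes \<omega> :: "'n::{finite,linorder} form"
  assumes "is_weak_d \<Xi> k \<omega> \<eta>" and ae: "AE x in lebesgue_on \<Xi>. \<omega> x = \<omega>' x"
    and \<Xi>: "open \<Xi>" and m: "\<omega> \<in> borel_measurable (lebesgue_on \<Xi>)"
  shows "is_weak_d \<Xi> k \<omega>' \<eta>"
  unfolding is_weak_d_def
proof (intro allI impI)
  fix \<phi> :: "(real, 'n) vec \<Rightarrow> real" and \<beta> :: "'n set" assume *: "test_function \<Xi> \<phi> \<and> card \<beta> = k + 1"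
  have "continuous_on UNIV (partial_deriv i \<phi>)" for i
    using * test_function_continuous test_function_partial by blast
  note integral_coeff_cong_AE[OF m \<Xi> ae this]
  then show "(LINT x|lebesgue_on \<Xi>. \<eta> x $ \<beta> * \<phi> x) =
      - (\<Sum>i\<in>\<beta>. pos_sign i \<beta> * (LINT x|lebesgue_on \<Xi>. \<omega>' x $ (\<beta> - {i}) * partial_deriv i \<phi> x))"
    using assms(1) * by (simp add: is_weak_d_def)
qed

lemma lebesgue_on_integral_test_subset:
  fixes h :: "real ^ 'n::finite \<Rightarrow> real"
  assumes "open \<Xi>" "open \<Xi>'" "\<Xi>' \<subseteq> \<Xi>" "\<And>x. x \<notin> \<Xi>' \<Longrightarrow> h x = 0"
  shows "(LINT x|lebesgue_on \<Xi>'. h x) = (LINT x|lebesgue_on \<Xi>. h x)"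
proof -
  have "(\<lambda>x. indicator \<Xi>' x *\<^sub>R h x) = (\<lambda>x. indicator \<Xi> x *\<^sub>R h x)"
    using assms(3,4) by (force simp: indicator_def)
  then show ?thesis using assms(1,2) by (simp add: integral_restrict_space)
qed

lemma test_function_eq_0: "test_function \<Xi> \<phi> \<Longrightarrow> x \<notin> \<Xi> \<Longrightarrow> \<phi> x = 0"
  unfolding test_function_def by blast

lemma is_weak_d_subset:
  fixes \<omega> :: "'n::{finite,linorder} form"
  assumes "is_weak_d \<Xi> k \<omega> \<eta>" and \<Xi>: "open \<Xi>" "open \<Xi>'" "\<Xi>' \<subseteq> \<Xi>"
  shows "is_weak_d \<Xi>' k \<omega> \<eta>"
  unfolding is_weak_d_def
proof (intro allI impI)
  fix \<phi> :: "(real, 'n) vec \<Rightarrow> real" and \<beta> :: "'n set" assume *: "test_function \<Xi>' \<phi> \<and> card \<beta> = k + 1"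
  then have "test_function \<Xi> \<phi>" using test_function_mono \<Xi>(3) by blast
  moreover have "(LINT x|lebesgue_on \<Xi>'. \<eta> x $ \<beta> * \<phi> x) = (LINT x|lebesgue_on \<Xi>. \<eta> x $ \<beta> * \<phi> x)"
    using * test_function_eq_0 by (intro lebesgue_on_integral_test_subset[OF \<Xi>]) fastforce
  moreover have "(LINT x|lebesgue_on \<Xi>'. \<omega> x $ (\<beta> - {i}) * partial_deriv i \<phi> x) =
      (LINT x|lebesgue_on \<Xi>. \<omega> x $ (\<beta> - {i}) * partial_deriv i \<phi> x)" for i
    using * test_function_eq_0[OF test_function_partial, of \<Xi>' \<phi>]
    by (intro lebesgue_on_integral_test_subset[OF \<Xi>]) auto
  ultimately show "(LINT x|lebesgue_on \<Xi>'. \<eta> x $ \<beta> * \<phi> x) =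
      - (\<Sum>i\<in>\<beta>. pos_sign i \<beta> * (LINT x|lebesgue_on \<Xi>'. \<omega> x $ (\<beta> - {i}) * partial_deriv i \<phi> x))"
    using assms(1) * by (simp add: is_weak_d_def)
qed

lemma integrable_lebesgue_on_subset:
  fixes f :: "'a::euclidean_space \<Rightarrow> 'b::{banach, second_countable_topology}"
  assumes f: "integrable (lebesgue_on \<Xi>) f" and \<Xi>: "open \<Xi>" "open \<Xi>'" "\<Xi>' \<subseteq> \<Xi>"
  shows "integrable (lebesgue_on \<Xi>') f"
proof -
  have "integrable lebesgue (\<lambda>x. indicator \<Xi>' x *\<^sub>R indicator \<Xi> x *\<^sub>R f x)"
    by (rule integrable_mult_indicator) (use f \<Xi> in \<open>auto simp: integrable_restrict_space\<close>)
  also have "(\<lambda>x. indicator \<Xi>' x *\<^sub>R indicator \<Xi> x *\<^sub>R f x) = (\<lambda>x. indicator \<Xi>' x *\<^sub>R f x)"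
    using \<Xi>(3) by (intro ext) (auto split: split_indicator)
  finally show ?thesis using \<Xi>(2) by (subst integrable_restrict_space) auto
qed

lemma borel_measurable_lebesgue_on_subset:
  assumes f: "f \<in> borel_measurable (lebesgue_on \<Xi>)" and \<Xi>: "open \<Xi>" "open \<Xi>'" "\<Xi>' \<subseteq> \<Xi>"
  shows "f \<in> borel_measurable (lebesgue_on \<Xi>')"
proof -
  have "restrict_space (lebesgue_on \<Xi>) \<Xi>' = lebesgue_on \<Xi>'"
    using \<Xi> by (simp add: restrict_restrict_space Int_absorb1 Int_absorb2)
  then show ?thesis using measurable_restrict_space1[OF f, of \<Xi>'] by simp
qed

lemma sq_int_subset:
  assumes "sq_int (lebesgue_on \<Xi>) f" and \<Xi>: "open \<Xi>" "open \<Xi>'" "\<Xi>' \<subseteq> \<Xi>"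
  shows "sq_int (lebesgue_on \<Xi>') f"
  using assms unfolding sq_int_def
  by (auto intro: borel_measurable_lebesgue_on_subset[OF _ \<Xi>] integrable_lebesgue_on_subset[OF _ \<Xi>])

lemma AE_lebesgue_on_subset:
  assumes "AE x in lebesgue_on \<Xi>. P x" and \<Xi>: "open \<Xi>" "open \<Xi>'" "\<Xi>' \<subseteq> \<Xi>"
  shows "AE x in lebesgue_on \<Xi>'. P x"
proof -
  have "AE x in lebesgue. x \<in> \<Xi> \<longrightarrow> P x" using assms by (simp add: AE_restrict_space_iff)
  then have "AE x in lebesgue. x \<in> \<Xi>' \<longrightarrow> P x" by eventually_elim (use \<Xi>(3) in auto)
  then show ?thesis using \<Xi> by (simp add: AE_restrict_space_iff)
qed

lemma L2_forms_subset:
  assumes "\<omega> \<in> L2_forms \<Xi> k" "open \<Xi>" "open \<Xi>'" "\<Xi>' \<subseteq> \<Xi>"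
  shows "\<omega> \<in> L2_forms \<Xi>' k"
  using assms unfolding L2_forms_iff by (auto intro: sq_int_subset AE_lebesgue_on_subset)

text \<open>
  The classical exterior derivative of \<open>k\<close>-forms and the classical codifferential of \<open>(k + 1)\<close>-forms, where
  \<open>D i \<alpha>\<close> is the partial derivative in direction \<open>i\<close> of the coefficient with index \<open>\<alpha>\<close>.
\<close>

definition grad_d :: "nat \<Rightarrow> ('n \<Rightarrow> 'n set \<Rightarrow> real ^ 'n::{finite,linorder} \<Rightarrow> real) \<Rightarrow> 'n form" where
  "grad_d k D = (\<lambda>x. \<chi> \<beta>. if card \<beta> = k + 1 then \<Sum>i\<in>\<beta>. pos_sign i \<beta> * D i (\<beta> - {i}) x else 0)"

definition grad_delta :: "nat \<Rightarrow> ('n \<Rightarrow> 'n set \<Rightarrow> real ^ 'n::{finite,linorder} \<Rightarrow> real) \<Rightarrow> 'n form" where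
  "grad_delta k D =
     (\<lambda>x. \<chi> \<alpha>. if card \<alpha> = k then - (\<Sum>i\<in>-\<alpha>. pos_sign i (insert i \<alpha>) * D i (insert i \<alpha>) x) else 0)"

text \<open>
  \<open>\<zeta> = \<delta> \<mu>\<close> in the sense of distributions for a \<open>(k + 1)\<close>-form \<open>\<mu>\<close>: the coefficient \<open>\<zeta>\<^sub>\<alpha>\<close> is
  \<open>- \<Sum>i\<notin>\<alpha>. pos_sign i (insert i \<alpha>) \<cdot> \<partial>\<^sub>i \<mu>\<^bsub>insert i \<alpha>\<^esub>\<close>, tested against scalar test functions. The
  Hodge star does not occur.
\<close>

definition is_weak_delta :: "(real ^ 'n::{finite,linorder}) set \<Rightarrow> nat \<Rightarrow> 'n form \<Rightarrow> 'n form \<Rightarrow> bool" where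
  "is_weak_delta \<Xi> k \<mu> \<zeta> \<longleftrightarrow>
     (\<forall>\<phi>. \<forall>\<alpha>. test_function \<Xi> \<phi> \<and> card \<alpha> = k \<longrightarrow>
        (LINT x | lebesgue_on \<Xi>. \<zeta> x $ \<alpha> * \<phi> x) =
        (\<Sum>i\<in>-\<alpha>. pos_sign i (insert i \<alpha>) *
             (LINT x | lebesgue_on \<Xi>. \<mu> x $ (insert i \<alpha>) * partial_deriv i \<phi> x)))"

lemma continuous_on_vec_lambda_if:
  assumes "\<And>\<beta>. P \<beta> \<Longrightarrow> continuous_on UNIV (f \<beta>)"
  shows "continuous_on UNIV (\<lambda>x. \<chi> \<beta>. if P \<beta> then f \<beta> x else (0 :: real))"
proof (rule continuous_on_vec_lambda)
  show "continuous_on UNIV (\<lambda>x. if P \<beta> then f \<beta> x else 0)" for \<beta>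
    using assms by (cases "P \<beta>") auto
qed

lemma continuous_grad_d:
  assumes "\<And>i \<alpha>. continuous_on UNIV (D i \<alpha>)"
  shows "continuous_on UNIV (grad_d k D)"
  unfolding grad_d_def using assms by (intro continuous_on_vec_lambda_if continuous_intros)

lemma continuous_grad_delta:
  assumes "\<And>i \<alpha>. continuous_on UNIV (D i \<alpha>)"
  shows "continuous_on UNIV (grad_delta k D)"
  unfolding grad_delta_def using assms by (intro continuous_on_vec_lambda_if continuous_intros)

lemma has_partialD:
  assumes "has_partial i F F'" shows "continuous_on UNIV F" "continuous_on UNIV F'"
  using assms by (auto simp: has_partial_def)

lemma test_function_mult_integrable:
  assumes "test_function \<Xi> \<phi>" "continuous_on UNIV (F :: real ^ 'n::finite \<Rightarrow> real)" "open \<Xi>" "bounded \<Xi>"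
  shows "integrable (lebesgue_on \<Xi>) (\<lambda>x. F x * \<phi> x)"
  using assms test_function_continuous by (intro integrable_continuous_bounded continuous_intros) auto

lemma is_weak_d_grad_d:
  fixes \<omega> :: "'n::{finite,linorder} form"
  assumes D: "\<And>i \<alpha>. has_partial i (\<lambda>x. \<omega> x $ \<alpha>) (D i \<alpha>)" and \<Xi>: "open \<Xi>" "bounded \<Xi>"
  shows "is_weak_d \<Xi> k \<omega> (grad_d k D)"
  unfolding is_weak_d_def
proof (intro allI impI)
  fix \<phi> :: "(real, 'n) vec \<Rightarrow> real" and \<beta> :: "'n set" assume *: "test_function \<Xi> \<phi> \<and> card \<beta> = k + 1"
  then have \<phi>: "test_function \<Xi> \<phi>" by simp
  have "(LINT x|lebesgue_on \<Xi>. grad_d k D x $ \<beta> * \<phi> x) =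
      (\<Sum>i\<in>\<beta>. LINT x|lebesgue_on \<Xi>. pos_sign i \<beta> * (D i (\<beta> - {i}) x * \<phi> x))"
    using * test_function_mult_integrable[OF \<phi> has_partialD(2)[OF D] \<Xi>]
    by (subst Bochner_Integration.integral_sum[symmetric])
      (auto simp: grad_d_def sum_distrib_right mult.assoc)
  also have "\<dots> = (\<Sum>i\<in>\<beta>. - pos_sign i \<beta> * (LINT x|lebesgue_on \<Xi>. \<omega> x $ (\<beta> - {i}) * partial_deriv i \<phi> x))"
    using integration_by_parts[OF D \<phi> \<Xi>(1)] by simp
  finally show "(LINT x|lebesgue_on \<Xi>. grad_d k D x $ \<beta> * \<phi> x) =
      - (\<Sum>i\<in>\<beta>. pos_sign i \<beta> * (LINT x|lebesgue_on \<Xi>. \<omega> x $ (\<beta> - {i}) * partial_deriv i \<phi> x))"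
    by (simp add: sum_negf)
qed

lemma is_weak_delta_grad_delta:
  fixes \<mu> :: "'n::{finite,linorder} form"
  assumes D: "\<And>i \<beta>. has_partial i (\<lambda>x. \<mu> x $ \<beta>) (D i \<beta>)" and \<Xi>: "open \<Xi>" "bounded \<Xi>"
  shows "is_weak_delta \<Xi> k \<mu> (grad_delta k D)"
  unfolding is_weak_delta_def
proof (intro allI impI)
  fix \<phi> :: "(real, 'n) vec \<Rightarrow> real" and \<alpha> :: "'n set" assume *: "test_function \<Xi> \<phi> \<and> card \<alpha> = k"
  then have \<phi>: "test_function \<Xi> \<phi>" by simp
  have "(LINT x|lebesgue_on \<Xi>. grad_delta k D x $ \<alpha> * \<phi> x) =
      (LINT x|lebesgue_on \<Xi>. (\<Sum>i\<in>-\<alpha>. - (pos_sign i (insert i \<alpha>) * (D i (insert i \<alpha>) x * \<phi> x))))"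
    using * by (simp add: grad_delta_def sum_distrib_right sum_negf mult.assoc)
  also have "\<dots> = (\<Sum>i\<in>-\<alpha>. LINT x|lebesgue_on \<Xi>. - (pos_sign i (insert i \<alpha>) * (D i (insert i \<alpha>) x * \<phi> x)))"
    using test_function_mult_integrable[OF \<phi> has_partialD(2)[OF D] \<Xi>]
    by (intro Bochner_Integration.integral_sum) auto
  also have "\<dots> = (\<Sum>i\<in>-\<alpha>. pos_sign i (insert i \<alpha>) * (LINT x|lebesgue_on \<Xi>. \<mu> x $ (insert i \<alpha>) * partial_deriv i \<phi> x))"
    using integration_by_parts[OF D \<phi> \<Xi>(1)] by simp
  finally show "(LINT x|lebesgue_on \<Xi>. grad_delta k D x $ \<alpha> * \<phi> x) = \<dots>" .
qed

section \<open>The codifferential\<close>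

lemma hodge_star_nth: "hodge_star v $ \<gamma> = v $ (- \<gamma>) * shuffle_sign (- \<gamma>)"
proof -
  have "hodge_star v $ \<gamma> = (\<Sum>\<alpha>\<in>UNIV. if \<alpha> = - \<gamma> then v $ \<alpha> * shuffle_sign \<alpha> else 0)"
    unfolding hodge_star_def sum_component by (intro sum.cong) (auto simp: axis_def)
  then show ?thesis by simp
qed

lemma shuffle_sign_square [simp]: "shuffle_sign \<alpha> * shuffle_sign \<alpha> = 1"
  by (simp add: shuffle_sign_def flip: power_mult_distrib)

text \<open>
  The signs in \<open>(-1)\<^bsup>n(k+2)+1\<^esup> \<star> d \<star>\<close> combine to the sign of the codifferential in coordinates.
  The proof counts inversions: \<open>R\<close> contains the inversions common to \<open>\<alpha>\<close> and \<open>insert i \<alpha>\<close>,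
  and an inversion of \<open>(\<alpha>, -\<alpha>)\<close> is a non-inversion of \<open>(-\<alpha>, \<alpha>)\<close>.
\<close>

lemma shuffle_sign_codiff:
  fixes \<alpha> :: "'n::{finite,linorder} set"
  assumes i: "i \<notin> \<alpha>" and k: "card \<alpha> = k"
  shows "(-1) ^ (CARD('n) * (k + 2) + 1) * shuffle_sign (- \<alpha>) * pos_sign i (- \<alpha>) * shuffle_sign (insert i \<alpha>)
    = - pos_sign i (insert i \<alpha>)"
proof -
  define N where "N A = card {(a, b). a \<in> A \<and> b \<in> - A \<and> b < a}" for A :: "'n set"
  define R where "R = {(a, b). a \<in> \<alpha> \<and> b \<in> - \<alpha> - {i} \<and> b < a}"
  define l where "l = card {b \<in> - \<alpha>. b < i}"
  define L where "L = card {a \<in> \<alpha>. a < i}"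
  define U where "U = card {a \<in> \<alpha>. i < a}"
  define m where "m = card (- \<alpha>)"
  have n: "CARD('n) = k + m"
    unfolding m_def using k by (metis card_Un_disjoint Compl_disjoint Compl_partition finite)
  have "a < i \<or> i < a" if "a \<in> \<alpha>" for a using i that by (metis linorder_neqE)
  then have "\<alpha> = {a \<in> \<alpha>. a < i} \<union> {a \<in> \<alpha>. i < a}" by auto
  then have "k = card ({a \<in> \<alpha>. a < i} \<union> {a \<in> \<alpha>. i < a})"
    using k by simp
  also have "\<dots> = L + U" unfolding L_def U_def by (rule card_Un_disjoint) auto
  finally have LU: "k = L + U" .
  have "{(a, b). a \<in> insert i \<alpha> \<and> b \<in> - insert i \<alpha> \<and> b < a} = R \<union> Pair i ` {b \<in> - \<alpha>. b < i}"
    using i by (auto simp: R_def)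
  then have "N (insert i \<alpha>) = card R + card (Pair i ` {b \<in> - \<alpha>. b < i})"
    unfolding N_def using i by (simp only:) (rule card_Un_disjoint, auto simp: R_def)
  then have Nins: "N (insert i \<alpha>) = card R + l"
    by (simp add: l_def card_image inj_on_def)
  have "{(a, b). a \<in> \<alpha> \<and> b \<in> - \<alpha> \<and> b < a} = R \<union> (\<lambda>a. (a, i)) ` {a \<in> \<alpha>. i < a}"
    using i by (auto simp: R_def)
  then have "N \<alpha> = card R + card ((\<lambda>a. (a, i)) ` {a \<in> \<alpha>. i < a})"
    unfolding N_def by (simp only:) (rule card_Un_disjoint, auto simp: R_def)
  then have N\<alpha>: "N \<alpha> = card R + U"
    by (simp add: U_def card_image inj_on_def)
  have "\<alpha> \<times> (- \<alpha>) = {(a, b). a \<in> \<alpha> \<and> b \<in> - \<alpha> \<and> b < a} \<union>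
      prod.swap ` {(a, b). a \<in> - \<alpha> \<and> b \<in> - (- \<alpha>) \<and> b < a}"
    by (auto simp: image_iff) (metis neqE)
  then have "card (\<alpha> \<times> (- \<alpha>)) = N \<alpha> + card (prod.swap ` {(a, b). a \<in> - \<alpha> \<and> b \<in> - (- \<alpha>) \<and> b < a})"
    unfolding N_def by (simp only:) (rule card_Un_disjoint, auto)
  then have Ncompl: "k * m = N \<alpha> + N (- \<alpha>)"
    by (simp add: N_def card_image card_cartesian_product k m_def)
  have "{j \<in> insert i \<alpha>. j < i} = {a \<in> \<alpha>. a < i}" by auto
  then have p: "pos_sign i (insert i \<alpha>) = (-1) ^ L" "pos_sign i (- \<alpha>) = (-1) ^ l"
    by (simp_all add: pos_sign_def L_def l_def)
  have s: "shuffle_sign A = (-1) ^ N A" for A :: "'n set"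
    by (simp add: shuffle_sign_def N_def)
  have "even (N \<alpha> + N (- \<alpha>)) \<longleftrightarrow> even (k * m)" by (simp add: Ncompl)
  then have "even ((k + m) * (k + 2) + 1 + N (- \<alpha>) + l + (card R + l)) \<longleftrightarrow> even (1 + L)"
    unfolding N\<alpha> LU by auto
  then have "(-1 :: real) ^ ((k + m) * (k + 2) + 1 + N (- \<alpha>) + l + (card R + l)) = (-1) ^ (1 + L)"
    unfolding minus_one_power_iff by simp
  then show ?thesis
    unfolding s p Nins n by (simp only: power_add[symmetric]) simp
qed

lemma bounded_linear_hodge_star: "bounded_linear (hodge_star :: real ^ ('n::{finite,linorder} set) \<Rightarrow> _)"
proof (rule linear_conv_bounded_linear[THEN iffD1])
  show "linear (hodge_star :: real ^ ('n set) \<Rightarrow> _)"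
    by (rule linearI) (simp_all add: vec_eq_iff hodge_star_nth algebra_simps)
qed

lemma sq_int_bounded_linear:
  assumes f: "sq_int M f" and h: "bounded_linear h"
  shows "sq_int M (\<lambda>x. h (f x))"
proof -
  obtain K where K: "\<And>x. norm (h x) \<le> norm x * K" "K > 0"
    using bounded_linear.pos_bounded[OF h] by blast
  have m: "(\<lambda>x. h (f x)) \<in> borel_measurable M"
    using f h by (intro measurable_compose[of f M borel h])
      (auto simp: sq_int_def linear_continuous_on borel_measurable_continuous_onI)
  have "integrable M (\<lambda>x. (norm (h (f x)))\<^sup>2)"
  proof (rule Bochner_Integration.integrable_bound)
    show "integrable M (\<lambda>x. K\<^sup>2 * (norm (f x))\<^sup>2)" using f by (auto simp: sq_int_def)
    have "(norm (h (f x)))\<^sup>2 \<le> (norm (f x) * K)\<^sup>2" for x using K by (intro power_mono) auto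
    then show "AE x in M. norm ((norm (h (f x)))\<^sup>2) \<le> norm (K\<^sup>2 * (norm (f x))\<^sup>2)"
      by (auto simp: power_mult_distrib mult.commute)
  qed (use m in auto)
  with m show ?thesis by (simp add: sq_int_def)
qed

lemma L2_forms_scale: "\<omega> \<in> L2_forms \<Xi> k \<Longrightarrow> (\<lambda>x. c *\<^sub>R \<omega> x) \<in> L2_forms \<Xi> k"
  unfolding L2_forms_iff by (auto intro: sq_int_scale simp: alt_forms_def elim: eventually_mono)

lemma card_Compl: "card (- A) = CARD('n) - card (A :: 'n::finite set)"
  by (simp add: card_Diff_subset Compl_eq_Diff_UNIV)

lemma card_le_CARD: "card (A :: 'n::finite set) \<le> CARD('n)"
  by (rule card_mono) auto

lemma hodge_star_alt_forms:
  assumes "v \<in> alt_forms k" "k \<le> CARD('n)"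
  shows "hodge_star (v :: real ^ ('n::{finite,linorder} set)) \<in> alt_forms (CARD('n) - k)"
proof -
  have "card (- \<gamma>) \<noteq> k" if "card \<gamma> \<noteq> CARD('n) - k" for \<gamma> :: "'n set"
    using that assms(2) card_le_CARD[of \<gamma>] by (simp add: card_Compl)
  then show ?thesis using assms(1) by (auto simp: alt_forms_def hodge_star_nth)
qed

lemma hodge_star_L2_forms:
  fixes \<omega> :: "'n::{finite,linorder} form"
  assumes "\<omega> \<in> L2_forms \<Xi> k" "k \<le> CARD('n)"
  shows "(\<lambda>x. hodge_star (\<omega> x)) \<in> L2_forms \<Xi> (CARD('n) - k)"
  using assms unfolding L2_forms_iff
  by (auto intro: sq_int_bounded_linear bounded_linear_hodge_star hodge_star_alt_forms elim: eventually_mono)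

lemma is_weak_delta_hodge:
  fixes \<mu> :: "'n::{finite,linorder} form"
  assumes k: "k < CARD('n)"
  shows "is_weak_delta \<Xi> k \<mu> (\<lambda>x. (-1) ^ (CARD('n) * (k + 2) + 1) *\<^sub>R hodge_star (\<xi> x)) \<longleftrightarrow>
    is_weak_d \<Xi> (CARD('n) - (k + 1)) (\<lambda>x. hodge_star (\<mu> x)) \<xi>"
proof -
  define c :: real where "c = (-1) ^ (CARD('n) * (k + 2) + 1)"
  define PD where "PD \<phi> \<beta> i = (LINT x|lebesgue_on \<Xi>. \<mu> x $ \<beta> * partial_deriv i \<phi> x)" for \<phi> \<beta> i
  have cc: "c * c = 1" by (simp add: c_def flip: power_mult_distrib)
  have eq: "(LINT x|lebesgue_on \<Xi>. (c *\<^sub>R hodge_star (\<xi> x)) $ \<alpha> * \<phi> x) =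
        (\<Sum>i\<in>-\<alpha>. pos_sign i (insert i \<alpha>) * PD \<phi> (insert i \<alpha>) i)
      \<longleftrightarrow> (LINT x|lebesgue_on \<Xi>. \<xi> x $ (- \<alpha>) * \<phi> x) =
        - (\<Sum>i\<in>-\<alpha>. pos_sign i (- \<alpha>) *
            (LINT x|lebesgue_on \<Xi>. hodge_star (\<mu> x) $ (- \<alpha> - {i}) * partial_deriv i \<phi> x))" (is "?l = ?r \<longleftrightarrow> ?l' = ?r'")
    if "card \<alpha> = k" for \<alpha> :: "'n set" and \<phi>
  proof -
    let ?d = "c * shuffle_sign (- \<alpha>)"
    have d: "?d * ?d = 1"
      using cc shuffle_sign_square[of "- \<alpha>"] by (metis mult.assoc mult.commute mult.right_neutral)
    have l: "?l = ?d * ?l'"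
      by (simp add: hodge_star_nth mult.assoc mult.left_commute flip: integral_mult_right_zero)
    have "(LINT x|lebesgue_on \<Xi>. hodge_star (\<mu> x) $ (- \<alpha> - {i}) * partial_deriv i \<phi> x) =
        shuffle_sign (insert i \<alpha>) * PD \<phi> (insert i \<alpha>) i" if "i \<in> - \<alpha>" for i
    proof -
      have "- (- \<alpha> - {i}) = insert i \<alpha>" by auto
      then show ?thesis
        by (simp add: hodge_star_nth PD_def mult.assoc mult.left_commute flip: integral_mult_right_zero)
    qed
    then have "?d * ?r' = (\<Sum>i\<in>-\<alpha>. - (?d * (pos_sign i (- \<alpha>) * (shuffle_sign (insert i \<alpha>) * PD \<phi> (insert i \<alpha>) i))))"
      by (simp add: sum_distrib_left sum_negf)
    also have "\<dots> = ?r"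
    proof (rule sum.cong)
      fix i assume "i \<in> - \<alpha>"
      then have "c * shuffle_sign (- \<alpha>) * pos_sign i (- \<alpha>) * shuffle_sign (insert i \<alpha>) = - pos_sign i (insert i \<alpha>)"
        unfolding c_def by (intro shuffle_sign_codiff) (use that in auto)
      then show "- (?d * (pos_sign i (- \<alpha>) * (shuffle_sign (insert i \<alpha>) * PD \<phi> (insert i \<alpha>) i))) =
          pos_sign i (insert i \<alpha>) * PD \<phi> (insert i \<alpha>) i"
        by (simp only: mult.assoc[symmetric])
    qed simp
    finally have r: "?r = ?d * ?r'" ..
    have "?d \<noteq> 0" using d by auto
    then show ?thesis unfolding l r mult_cancel_left by simp
  qed
  have bij: "(\<forall>\<gamma>. card \<gamma> = CARD('n) - (k + 1) + 1 \<longrightarrow> P \<gamma>) \<longleftrightarrow> (\<forall>\<alpha> :: 'n set. card \<alpha> = k \<longrightarrow> P (- \<alpha>))" for P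
  proof -
    have "card (- \<alpha>) = CARD('n) - (k + 1) + 1 \<longleftrightarrow> card \<alpha> = k" for \<alpha> :: "'n set"
      using card_le_CARD[of \<alpha>] k by (auto simp: card_Compl)
    then show ?thesis by (metis double_complement)
  qed
  have "is_weak_delta \<Xi> k \<mu> (\<lambda>x. c *\<^sub>R hodge_star (\<xi> x)) \<longleftrightarrow>
      (\<forall>\<phi>. test_function \<Xi> \<phi> \<longrightarrow> (\<forall>\<alpha>. card \<alpha> = k \<longrightarrow>
        (LINT x|lebesgue_on \<Xi>. (c *\<^sub>R hodge_star (\<xi> x)) $ \<alpha> * \<phi> x) =
        (\<Sum>i\<in>-\<alpha>. pos_sign i (insert i \<alpha>) * PD \<phi> (insert i \<alpha>) i)))"
    unfolding is_weak_delta_def PD_def by blast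
  also have "\<dots> \<longleftrightarrow> (\<forall>\<phi>. test_function \<Xi> \<phi> \<longrightarrow> (\<forall>\<alpha>. card \<alpha> = k \<longrightarrow>
      (LINT x|lebesgue_on \<Xi>. \<xi> x $ (- \<alpha>) * \<phi> x) =
        - (\<Sum>i\<in>-\<alpha>. pos_sign i (- \<alpha>) *
            (LINT x|lebesgue_on \<Xi>. hodge_star (\<mu> x) $ (- \<alpha> - {i}) * partial_deriv i \<phi> x))))"
    using eq by simp
  also have "\<dots> \<longleftrightarrow> is_weak_d \<Xi> (CARD('n) - (k + 1)) (\<lambda>x. hodge_star (\<mu> x)) \<xi>"
    unfolding is_weak_d_def
    by (subst bij[where P = "\<lambda>\<gamma>. (LINT x|lebesgue_on \<Xi>. \<xi> x $ \<gamma> * _ x) =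
        - (\<Sum>i\<in>\<gamma>. pos_sign i \<gamma> *
            (LINT x|lebesgue_on \<Xi>. hodge_star (\<mu> x) $ (\<gamma> - {i}) * partial_deriv i _ x))", symmetric]) blast
  finally show ?thesis unfolding c_def .
qed

text \<open>
  A form with a square-integrable weak codifferential in the sense of \<open>is_weak_delta\<close> belongs to
  \<open>Hstar_space\<close>, and \<open>codiff\<close> selects that codifferential.
\<close>

lemma codiff_eqI:
  fixes \<mu> :: "'n::{finite,linorder} form"
  assumes \<Xi>: "open \<Xi>" "bounded \<Xi>" and k: "k < CARD('n)"
    and \<mu>: "\<mu> \<in> L2_forms \<Xi> (k + 1)" and \<zeta>: "\<zeta> \<in> L2_forms \<Xi> k" "is_weak_delta \<Xi> k \<mu> \<zeta>"
  shows "\<mu> \<in> Hstar_space \<Xi> (k + 1)" "AE x in lebesgue_on \<Xi>. codiff \<Xi> (k + 1) \<mu> x = \<zeta> x"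
proof -
  define c :: real where "c = (-1) ^ (CARD('n) * (k + 2) + 1)"
  have cc: "c * c = 1" by (simp add: c_def flip: power_mult_distrib)
  \<comment> \<open>The inverse of \<open>c\<close> times the Hodge star.\<close>
  define s where "s v = (\<chi> \<gamma>. c * shuffle_sign \<gamma> * v $ (- \<gamma>))" for v :: "real ^ ('n set)"
  have inv: "c *\<^sub>R hodge_star (s v) = v" for v
  proof -
    have "c * (c * shuffle_sign (- \<gamma>) * v $ \<gamma> * shuffle_sign (- \<gamma>)) =
        (c * c) * (shuffle_sign (- \<gamma>) * shuffle_sign (- \<gamma>)) * v $ \<gamma>" for \<gamma>
      by (simp only: mult.assoc mult.left_commute mult.commute)
    then show ?thesis
      by (simp add: vec_eq_iff hodge_star_nth s_def cc)
  qed
  have lin: "bounded_linear s"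
  proof (rule linear_conv_bounded_linear[THEN iffD1])
    show "linear s"
      by (rule linearI) (simp_all add: vec_eq_iff s_def algebra_simps)
  qed
  have deg: "CARD('n) - (k + 1) + 1 = CARD('n) - k" using k by simp
  have "s v \<in> alt_forms (CARD('n) - k)" if "v \<in> alt_forms k" for v
  proof -
    have "card (- \<gamma>) \<noteq> k" if "card \<gamma> \<noteq> CARD('n) - k" for \<gamma> :: "'n set"
      using that k card_le_CARD[of \<gamma>] by (simp add: card_Compl)
    then show ?thesis using that by (auto simp: alt_forms_def s_def)
  qed
  then have s\<zeta>: "(\<lambda>x. s (\<zeta> x)) \<in> L2_forms \<Xi> (CARD('n) - (k + 1) + 1)"
    using \<zeta>(1) sq_int_bounded_linear[OF _ lin] unfolding L2_forms_iff deg
    by (auto elim: eventually_mono)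
  have w: "is_weak_d \<Xi> (CARD('n) - (k + 1)) (\<lambda>x. hodge_star (\<mu> x)) (\<lambda>x. s (\<zeta> x))"
    using \<zeta>(2) is_weak_delta_hodge[OF k, of \<Xi> \<mu> "\<lambda>x. s (\<zeta> x)"] inv by (simp add: c_def)
  have "(\<lambda>x. hodge_star (\<mu> x)) \<in> L2_forms \<Xi> (CARD('n) - (k + 1))"
    using \<mu> k by (intro hodge_star_L2_forms) auto
  then show "\<mu> \<in> Hstar_space \<Xi> (k + 1)"
    using \<mu> s\<zeta> w by (auto simp: Hstar_space_def H_space_def)
  have "AE x in lebesgue_on \<Xi>. ext_d \<Xi> (CARD('n) - (k + 1)) (\<lambda>x. hodge_star (\<mu> x)) x = s (\<zeta> x)"
    by (rule ext_d_eqI(3)[OF \<Xi> s\<zeta> w])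
  then show "AE x in lebesgue_on \<Xi>. codiff \<Xi> (k + 1) \<mu> x = \<zeta> x"
    by eventually_elim (use inv in \<open>simp add: codiff_def c_def\<close>)
qed

lemma Hstar_space_codiff:
  fixes \<mu> :: "'n::{finite,linorder} form"
  assumes \<mu>: "\<mu> \<in> Hstar_space \<Xi> (k + 1)" and \<Xi>: "open \<Xi>" "bounded \<Xi>" and k: "k < CARD('n)"
  shows "\<mu> \<in> L2_forms \<Xi> (k + 1)" "codiff \<Xi> (k + 1) \<mu> \<in> L2_forms \<Xi> k"
    "is_weak_delta \<Xi> k \<mu> (codiff \<Xi> (k + 1) \<mu>)"
proof -
  let ?\<mu> = "\<lambda>x. hodge_star (\<mu> x)" and ?m = "CARD('n) - (k + 1)"
  have H: "?\<mu> \<in> H_space \<Xi> ?m" and "\<mu> \<in> L2_forms \<Xi> (k + 1)" using \<mu> by (auto simp: Hstar_space_def)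
  then show "\<mu> \<in> L2_forms \<Xi> (k + 1)" by simp
  have deg: "CARD('n) - (?m + 1) = k" using k by simp
  have "(\<lambda>x. hodge_star (ext_d \<Xi> ?m ?\<mu> x)) \<in> L2_forms \<Xi> (CARD('n) - (?m + 1))"
    using H_space_ext_d(2)[OF H \<Xi>] k by (intro hodge_star_L2_forms) auto
  then show "codiff \<Xi> (k + 1) \<mu> \<in> L2_forms \<Xi> k"
    unfolding deg codiff_def by (rule L2_forms_scale)
  show "is_weak_delta \<Xi> k \<mu> (codiff \<Xi> (k + 1) \<mu>)"
    using is_weak_delta_hodge[OF k, of \<Xi> \<mu> "ext_d \<Xi> ?m ?\<mu>"] H_space_ext_d(3)[OF H \<Xi>]
    by (simp add: codiff_def)
qed

lemma is_weak_delta_diff: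
  fixes \<mu> :: "'n::{finite,linorder} form"
  assumes "is_weak_delta \<Xi> k \<mu> \<mu>'" "is_weak_delta \<Xi> k \<eta> \<eta>'" and \<Xi>: "open \<Xi>" "bounded \<Xi>"
    and s: "sq_int (lebesgue_on \<Xi>) \<mu>" "sq_int (lebesgue_on \<Xi>) \<mu>'"
      "sq_int (lebesgue_on \<Xi>) \<eta>" "sq_int (lebesgue_on \<Xi>) \<eta>'"
  shows "is_weak_delta \<Xi> k (\<lambda>x. \<mu> x - \<eta> x) (\<lambda>x. \<mu>' x - \<eta>' x)"
  unfolding is_weak_delta_def
proof (intro allI impI)
  fix \<phi> :: "(real, 'n) vec \<Rightarrow> real" and \<alpha> :: "'n set" assume *: "test_function \<Xi> \<phi> \<and> card \<alpha> = k"
  note i = sq_int_coeff_integrable[OF _ _ \<Xi>]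
  have c: "continuous_on UNIV \<phi>" "continuous_on UNIV (partial_deriv i \<phi>)" for i
    using * test_function_continuous test_function_partial by blast+
  show "(LINT x|lebesgue_on \<Xi>. (\<mu>' x - \<eta>' x) $ \<alpha> * \<phi> x) =
      (\<Sum>i\<in>-\<alpha>. pos_sign i (insert i \<alpha>) *
        (LINT x|lebesgue_on \<Xi>. (\<mu> x - \<eta> x) $ (insert i \<alpha>) * partial_deriv i \<phi> x))"
    using assms(1,2) * by (simp add: is_weak_delta_def left_diff_distrib i s c right_diff_distrib sum_subtractf)
qed

lemma is_weak_delta_subset:
  fixes \<mu> :: "'n::{finite,linorder} form"
  assumes "is_weak_delta \<Xi> k \<mu> \<zeta>" and \<Xi>: "open \<Xi>" "open \<Xi>'" "\<Xi>' \<subseteq> \<Xi>"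
  shows "is_weak_delta \<Xi>' k \<mu> \<zeta>"
  unfolding is_weak_delta_def
proof (intro allI impI)
  fix \<phi> :: "(real, 'n) vec \<Rightarrow> real" and \<alpha> :: "'n set" assume *: "test_function \<Xi>' \<phi> \<and> card \<alpha> = k"
  then have "test_function \<Xi> \<phi>" using test_function_mono \<Xi>(3) by blast
  moreover have "(LINT x|lebesgue_on \<Xi>'. \<zeta> x $ \<alpha> * \<phi> x) = (LINT x|lebesgue_on \<Xi>. \<zeta> x $ \<alpha> * \<phi> x)"
    using * test_function_eq_0 by (intro lebesgue_on_integral_test_subset[OF \<Xi>]) fastforce
  moreover have "(LINT x|lebesgue_on \<Xi>'. \<mu> x $ \<beta> * partial_deriv i \<phi> x) =
      (LINT x|lebesgue_on \<Xi>. \<mu> x $ \<beta> * partial_deriv i \<phi> x)" for i \<beta>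
    using * test_function_eq_0[OF test_function_partial, of \<Xi>' \<phi>]
    by (intro lebesgue_on_integral_test_subset[OF \<Xi>]) auto
  ultimately show "(LINT x|lebesgue_on \<Xi>'. \<zeta> x $ \<alpha> * \<phi> x) =
      (\<Sum>i\<in>-\<alpha>. pos_sign i (insert i \<alpha>) * (LINT x|lebesgue_on \<Xi>'. \<mu> x $ (insert i \<alpha>) * partial_deriv i \<phi> x))"
    using assms(1) * by (simp add: is_weak_delta_def)
qed

lemma is_weak_delta_unique:
  fixes \<mu> :: "'n::{finite,linorder} form"
  assumes \<Xi>: "open \<Xi>" "bounded \<Xi>" and "is_weak_delta \<Xi> k \<mu> \<zeta>" "is_weak_delta \<Xi> k \<mu>' \<zeta>'"
    and "\<zeta> \<in> L2_forms \<Xi> k" "\<zeta>' \<in> L2_forms \<Xi> k"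
    and ae: "AE x in lebesgue_on \<Xi>. \<mu> x = \<mu>' x" and m: "\<mu> \<in> borel_measurable (lebesgue_on \<Xi>)"
  shows "AE x in lebesgue_on \<Xi>. \<zeta> x = \<zeta>' x"
proof (rule L2_forms_eqI[OF assms(5,6) \<Xi>])
  fix \<phi> :: "(real, 'n) vec \<Rightarrow> real" and \<alpha> :: "'n set"
  assume *: "test_function \<Xi> \<phi>" "card \<alpha> = k"
  have "continuous_on UNIV (partial_deriv i \<phi>)" for i
    using * test_function_continuous test_function_partial by blast
  note integral_coeff_cong_AE[OF m \<Xi>(1) ae this]
  then show "(LINT x|lebesgue_on \<Xi>. \<zeta> x $ \<alpha> * \<phi> x) = (LINT x|lebesgue_on \<Xi>. \<zeta>' x $ \<alpha> * \<phi> x)"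
    using assms(3,4) * by (simp add: is_weak_delta_def)
qed

section \<open>Adjointness of the exterior derivative and the codifferential\<close>

lemma grad_d_alt_forms: "grad_d k D x \<in> alt_forms (k + 1)"
  by (simp add: grad_d_def alt_forms_def)

lemma grad_delta_alt_forms: "grad_delta k D x \<in> alt_forms k"
  by (simp add: grad_delta_def alt_forms_def)

lemma ip_cong_AE:
  assumes "f \<in> borel_measurable M" "f' \<in> borel_measurable M" "g \<in> borel_measurable M" "g' \<in> borel_measurable M"
    and "AE x in M. f x = f' x" "AE x in M. g x = g' x"
  shows "ip M f g = ip M f' g'"
  unfolding ip_def
proof (rule integral_cong_AE)
  show "AE x in M. f x \<bullet> g x = f' x \<bullet> g' x" using assms(5,6) by eventually_elim simp
qed (use assms in auto)

lemma ip_grad_d: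
  fixes \<sigma> :: "'n::{finite,linorder} form"
  assumes s: "sq_int (lebesgue_on \<Xi>) \<sigma>" and D: "\<And>i \<alpha>. continuous_on UNIV (D i \<alpha>)" and \<Xi>: "open \<Xi>" "bounded \<Xi>"
  shows "ip (lebesgue_on \<Xi>) \<sigma> (grad_d k D) =
    (\<Sum>\<alpha> | card \<alpha> = k. \<Sum>i\<in>-\<alpha>. pos_sign i (insert i \<alpha>) * (LINT x|lebesgue_on \<Xi>. \<sigma> x $ (insert i \<alpha>) * D i \<alpha> x))"
proof -
  note int = sq_int_coeff_integrable[OF s D \<Xi>]
  have "\<sigma> x \<bullet> grad_d k D x =
      (\<Sum>\<beta> | card \<beta> = k + 1. \<Sum>i\<in>\<beta>. pos_sign i \<beta> * (\<sigma> x $ \<beta> * D i (\<beta> - {i}) x))" for x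
    unfolding inner_vec_def grad_d_def
    by (simp add: if_distrib[of "(*) _"] sum_distrib_left mult.left_commute sum.If_cases cong: if_cong)
  then have "ip (lebesgue_on \<Xi>) \<sigma> (grad_d k D) =
      (\<Sum>\<beta> | card \<beta> = k + 1. \<Sum>i\<in>\<beta>. pos_sign i \<beta> * (LINT x|lebesgue_on \<Xi>. \<sigma> x $ \<beta> * D i (\<beta> - {i}) x))"
    unfolding ip_def using int by (simp add: Bochner_Integration.integral_sum)
  also have "\<dots> = (\<Sum>\<beta> | card \<beta> = k + 1. \<Sum>i\<in>\<beta>. pos_sign i (insert i (\<beta> - {i})) *
      (LINT x|lebesgue_on \<Xi>. \<sigma> x $ (insert i (\<beta> - {i})) * D i (\<beta> - {i}) x))"
    by (intro sum.cong) (simp_all add: insert_absorb)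
  also have "\<dots> = (\<Sum>\<alpha> | card \<alpha> = k. \<Sum>i\<in>-\<alpha>. pos_sign i (insert i \<alpha>) * (LINT x|lebesgue_on \<Xi>. \<sigma> x $ (insert i \<alpha>) * D i \<alpha> x))"
    by (rule sum_faces)
  finally show ?thesis .
qed

lemma ip_grad_delta:
  fixes \<eta> :: "'n::{finite,linorder} form"
  assumes s: "sq_int (lebesgue_on \<Xi>) \<eta>" and D: "\<And>i \<alpha>. continuous_on UNIV (D i \<alpha>)" and \<Xi>: "open \<Xi>" "bounded \<Xi>"
  shows "ip (lebesgue_on \<Xi>) \<eta> (grad_delta k D) =
    - (\<Sum>\<alpha> | card \<alpha> = k. \<Sum>i\<in>-\<alpha>. pos_sign i (insert i \<alpha>) * (LINT x|lebesgue_on \<Xi>. \<eta> x $ \<alpha> * D i (insert i \<alpha>) x))"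
proof -
  note int = sq_int_coeff_integrable[OF s D \<Xi>]
  have "\<eta> x \<bullet> grad_delta k D x =
      - (\<Sum>\<alpha> | card \<alpha> = k. \<Sum>i\<in>-\<alpha>. pos_sign i (insert i \<alpha>) * (\<eta> x $ \<alpha> * D i (insert i \<alpha>) x))" for x
    unfolding inner_vec_def grad_delta_def
    by (simp add: if_distrib[of "(*) _"] sum_distrib_left mult.left_commute sum.If_cases sum_negf cong: if_cong)
  then show ?thesis
    unfolding ip_def using int by (simp add: Bochner_Integration.integral_sum)
qed

lemma test_form_coeff:
  assumes "test_function \<Xi> \<phi>"
  shows "test_function \<Xi> (\<lambda>x. \<phi> x $ \<beta>)"
proof -
  obtain S where "compact S" "S \<subseteq> \<Xi>" "\<And>x. x \<notin> S \<Longrightarrow> \<phi> x = 0"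
    and "\<And>m. times_diff m \<phi>" using assms by (auto simp: test_function_def)
  then show ?thesis
    by (intro test_functionI[of _ S] times_diff_linear[OF bounded_linear_vec_nth]) auto
qed

lemma adjoint_test_forms:
  fixes \<eta> :: "'n::{finite,linorder} form"
  assumes \<eta>: "\<eta> \<in> H_space \<Xi> k" and \<phi>: "\<phi> \<in> test_forms \<Xi> (k + 1)" and \<Xi>: "open \<Xi>" "bounded \<Xi>"
    and k: "k < CARD('n)"
  shows "\<phi> \<in> Hstar_space \<Xi> (k + 1)"
    and "ip (lebesgue_on \<Xi>) (ext_d \<Xi> k \<eta>) \<phi> = ip (lebesgue_on \<Xi>) \<eta> (codiff \<Xi> (k + 1) \<phi>)"
proof -
  let ?M = "lebesgue_on \<Xi>"
  define D where "D i \<beta> = partial_deriv i (\<lambda>x. \<phi> x $ \<beta>)" for i \<beta>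
  have t: "test_function \<Xi> \<phi>" and alt: "\<And>x. \<phi> x \<in> alt_forms (k + 1)" using \<phi> by (auto simp: test_forms_def)
  note tc = test_form_coeff[OF t]
  have D: "has_partial i (\<lambda>x. \<phi> x $ \<beta>) (D i \<beta>)" for i \<beta>
    unfolding D_def by (rule has_partial_test_function[OF tc])
  note Dc = has_partialD(2)[OF D]
  have \<phi>L: "\<phi> \<in> L2_forms \<Xi> (k + 1)"
    using test_function_continuous[OF t] \<Xi> alt by (rule continuous_L2_forms)
  have ZL: "grad_delta k D \<in> L2_forms \<Xi> k"
    using continuous_grad_delta[OF Dc] \<Xi> grad_delta_alt_forms by (rule continuous_L2_forms)
  note w = is_weak_delta_grad_delta[OF D \<Xi>, of k]
  show H: "\<phi> \<in> Hstar_space \<Xi> (k + 1)" by (rule codiff_eqI(1)[OF \<Xi> k \<phi>L ZL w])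
  have ae: "AE x in ?M. codiff \<Xi> (k + 1) \<phi> x = grad_delta k D x"
    by (rule codiff_eqI(2)[OF \<Xi> k \<phi>L ZL w])
  note \<eta>' = H_space_ext_d[OF \<eta> \<Xi>]
  have s: "sq_int ?M \<eta>" "sq_int ?M (ext_d \<Xi> k \<eta>)" "sq_int ?M (codiff \<Xi> (k + 1) \<phi>)" "sq_int ?M (grad_delta k D)"
    using \<eta>'(1,2) ZL Hstar_space_codiff(2)[OF H \<Xi> k] by (auto simp: L2_forms_iff)
  have "ext_d \<Xi> k \<eta> x \<bullet> \<phi> x = (\<Sum>\<beta> | card \<beta> = k + 1. ext_d \<Xi> k \<eta> x $ \<beta> * \<phi> x $ \<beta>)" for x
    unfolding inner_vec_def using alt[of x] by (intro sum.mono_neutral_cong_right) (auto simp: alt_forms_def)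
  then have "ip ?M (ext_d \<Xi> k \<eta>) \<phi> = (\<Sum>\<beta> | card \<beta> = k + 1. LINT x|?M. ext_d \<Xi> k \<eta> x $ \<beta> * \<phi> x $ \<beta>)"
    unfolding ip_def
    using sq_int_coeff_integrable[OF s(2) test_function_continuous[OF tc] \<Xi>]
    by (simp add: Bochner_Integration.integral_sum)
  also have "\<dots> = - (\<Sum>\<beta> | card \<beta> = k + 1. \<Sum>i\<in>\<beta>. pos_sign i (insert i (\<beta> - {i})) *
      (LINT x|?M. \<eta> x $ (\<beta> - {i}) * D i (insert i (\<beta> - {i})) x))"
    unfolding sum_negf[symmetric]
    using \<eta>'(3) tc by (intro sum.cong) (auto simp: is_weak_d_def D_def insert_absorb sum_negf)
  also have "\<dots> = - (\<Sum>\<alpha> | card \<alpha> = k. \<Sum>i\<in>-\<alpha>. pos_sign i (insert i \<alpha>) * (LINT x|?M. \<eta> x $ \<alpha> * D i (insert i \<alpha>) x))"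
    by (subst sum_faces) simp
  also have "\<dots> = ip ?M \<eta> (grad_delta k D)"
    by (rule ip_grad_delta[OF s(1) Dc \<Xi>, symmetric])
  also have "\<dots> = ip ?M \<eta> (codiff \<Xi> (k + 1) \<phi>)"
    by (rule ip_cong_AE) (use s ae in \<open>auto simp: sq_int_def\<close>)
  finally show "ip ?M (ext_d \<Xi> k \<eta>) \<phi> = ip ?M \<eta> (codiff \<Xi> (k + 1) \<phi>)" .
qed

lemma codiff_diff:
  fixes \<mu> :: "'n::{finite,linorder} form"
  assumes \<mu>: "\<mu> \<in> Hstar_space \<Xi> (k + 1)" "\<nu> \<in> Hstar_space \<Xi> (k + 1)"
    and \<Xi>: "open \<Xi>" "bounded \<Xi>" and k: "k < CARD('n)"
  shows "(\<lambda>x. \<mu> x - \<nu> x) \<in> Hstar_space \<Xi> (k + 1)"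
    and "AE x in lebesgue_on \<Xi>. codiff \<Xi> (k + 1) (\<lambda>x. \<mu> x - \<nu> x) x = codiff \<Xi> (k + 1) \<mu> x - codiff \<Xi> (k + 1) \<nu> x"
proof -
  note 1 = Hstar_space_codiff[OF \<mu>(1) \<Xi> k] and 2 = Hstar_space_codiff[OF \<mu>(2) \<Xi> k]
  have w: "is_weak_delta \<Xi> k (\<lambda>x. \<mu> x - \<nu> x) (\<lambda>x. codiff \<Xi> (k + 1) \<mu> x - codiff \<Xi> (k + 1) \<nu> x)"
    by (rule is_weak_delta_diff[OF 1(3) 2(3) \<Xi>]) (use 1 2 in \<open>auto simp: L2_forms_iff\<close>)
  note * = codiff_eqI[OF \<Xi> k L2_forms_diff[OF 1(1) 2(1)] L2_forms_diff[OF 1(2) 2(2)] w]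
  show "(\<lambda>x. \<mu> x - \<nu> x) \<in> Hstar_space \<Xi> (k + 1)" by (rule *(1))
  show "AE x in lebesgue_on \<Xi>. codiff \<Xi> (k + 1) (\<lambda>x. \<mu> x - \<nu> x) x = codiff \<Xi> (k + 1) \<mu> x - codiff \<Xi> (k + 1) \<nu> x"
    by (rule *(2))
qed

lemma nrm_le_delta_norm: "nrm (lebesgue_on \<Xi>) \<mu> \<le> delta_norm \<Xi> k \<mu>"
    "nrm (lebesgue_on \<Xi>) (codiff \<Xi> k \<mu>) \<le> delta_norm \<Xi> k \<mu>"
  unfolding delta_norm_def L2_norm_eq_nrm by (auto intro!: real_le_rsqrt)

text \<open>
  Adjointness extends from test forms to their closure in the graph norm of the codifferential.
\<close>

lemma adjoint_Hstar0:
  fixes \<eta> :: "'n::{finite,linorder} form"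
  assumes \<eta>: "\<eta> \<in> H_space \<Xi> k" and \<mu>: "\<mu> \<in> Hstar0_space \<Xi> (k + 1)" and \<Xi>: "open \<Xi>" "bounded \<Xi>"
    and k: "k < CARD('n)"
  shows "ip (lebesgue_on \<Xi>) (ext_d \<Xi> k \<eta>) \<mu> = ip (lebesgue_on \<Xi>) \<eta> (codiff \<Xi> (k + 1) \<mu>)"
proof -
  let ?M = "lebesgue_on \<Xi>"
  let ?N = "nrm ?M (ext_d \<Xi> k \<eta>) + nrm ?M \<eta>"
  have \<mu>H: "\<mu> \<in> Hstar_space \<Xi> (k + 1)" using \<mu> by (simp add: Hstar0_space_def)
  let ?e = "ip ?M (ext_d \<Xi> k \<eta>) \<mu> - ip ?M \<eta> (codiff \<Xi> (k + 1) \<mu>)"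
  have bound: "\<bar>?e\<bar> \<le> ?N * \<epsilon>" if \<epsilon>: "\<epsilon> > 0" for \<epsilon>
  proof -
    obtain \<phi> where \<phi>: "\<phi> \<in> test_forms \<Xi> (k + 1)" "delta_norm \<Xi> (k + 1) (\<lambda>x. \<mu> x - \<phi> x) < \<epsilon>"
      using \<mu> \<epsilon> by (auto simp: Hstar0_space_def)
    note \<phi>' = adjoint_test_forms[OF \<eta> \<phi>(1) \<Xi> k]
    note d = codiff_diff[OF \<mu>H \<phi>'(1) \<Xi> k]
    note L = Hstar_space_codiff[OF \<mu>H \<Xi> k] Hstar_space_codiff[OF \<phi>'(1) \<Xi> k] Hstar_space_codiff[OF d(1) \<Xi> k]
      H_space_ext_d[OF \<eta> \<Xi>]
    then have s: "sq_int ?M \<mu>" "sq_int ?M \<phi>" "sq_int ?M (codiff \<Xi> (k + 1) \<mu>)" "sq_int ?M (codiff \<Xi> (k + 1) \<phi>)"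
      "sq_int ?M (codiff \<Xi> (k + 1) (\<lambda>x. \<mu> x - \<phi> x))" "sq_int ?M \<eta>" "sq_int ?M (ext_d \<Xi> k \<eta>)"
      by (auto simp: L2_forms_iff)
    have "ip ?M \<eta> (codiff \<Xi> (k + 1) (\<lambda>x. \<mu> x - \<phi> x)) = ip ?M \<eta> (\<lambda>x. codiff \<Xi> (k + 1) \<mu> x - codiff \<Xi> (k + 1) \<phi> x)"
      by (rule ip_cong_AE) (use s d(2) sq_int_diff[OF s(3,4)] in \<open>auto simp: sq_int_def\<close>)
    then have "?e = ip ?M (ext_d \<Xi> k \<eta>) (\<lambda>x. \<mu> x - \<phi> x) - ip ?M \<eta> (codiff \<Xi> (k + 1) (\<lambda>x. \<mu> x - \<phi> x))"
      using \<phi>'(2) ip_diff_right[OF s(3,4,6)] ip_diff_right[OF s(1,2,7)] by linarith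
    then have "\<bar>?e\<bar> \<le> nrm ?M (ext_d \<Xi> k \<eta>) * nrm ?M (\<lambda>x. \<mu> x - \<phi> x) +
        nrm ?M \<eta> * nrm ?M (codiff \<Xi> (k + 1) (\<lambda>x. \<mu> x - \<phi> x))"
      using ip_le_nrm[OF s(7) sq_int_diff[OF s(1,2)]] ip_le_nrm[OF s(6) s(5)] by linarith
    also have "\<dots> \<le> nrm ?M (ext_d \<Xi> k \<eta>) * \<epsilon> + nrm ?M \<eta> * \<epsilon>"
      using \<phi>(2) nrm_le_delta_norm(1)[where k = "k + 1" and \<Xi> = \<Xi> and \<mu> = "\<lambda>x. \<mu> x - \<phi> x"]
        nrm_le_delta_norm(2)[where k = "k + 1" and \<Xi> = \<Xi> and \<mu> = "\<lambda>x. \<mu> x - \<phi> x"]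
      by (intro add_mono mult_left_mono nrm_nonneg) linarith+
    finally show ?thesis by (simp add: distrib_right)
  qed
  have "\<bar>?e\<bar> \<le> 0 + \<delta>" if "\<delta> > 0" for \<delta>
  proof -
    have N: "?N \<ge> 0" by (intro add_nonneg_nonneg nrm_nonneg)
    have *: "m * (\<delta> / (m + 1)) \<le> \<delta>" "0 < \<delta> / (m + 1)" if "m \<ge> 0" for m :: real
      using that \<open>\<delta> > 0\<close> by (simp_all add: field_simps)
    have "\<bar>?e\<bar> \<le> ?N * (\<delta> / (?N + 1))" by (rule bound[OF *(2)[OF N]])
    also have "\<dots> \<le> \<delta>" by (rule *(1)[OF N])
    finally show ?thesis by simp
  qed
  then have "\<bar>?e\<bar> \<le> 0" by (rule field_le_epsilon)
  then show ?thesis by simp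
qed

text \<open>
  Testing the variational equation with \<open>\<phi> dx\<^sub>\<alpha>\<close> for test functions \<open>\<phi>\<close> shows \<open>\<delta> d \<omega> = f - \<omega>\<close>. The error
  estimate uses this identity only, not the vanishing trace of \<open>d \<omega>\<close>.
\<close>

lemma solution_codiff:
  fixes \<Omega> :: "(real ^ 'n::{finite,linorder}) set"
  assumes \<Omega>: "open \<Omega>" "bounded \<Omega>" and k: "k < CARD('n)"
    and f: "f \<in> L2_forms \<Omega> k" and sol: "is_solution \<Omega> k f \<omega>"
  shows "ext_d \<Omega> k \<omega> \<in> Hstar_space \<Omega> (k + 1)"
    and "AE x in lebesgue_on \<Omega>. codiff \<Omega> (k + 1) (ext_d \<Omega> k \<omega>) x = f x - \<omega> x"
proof -
  let ?M = "lebesgue_on \<Omega>" and ?\<sigma> = "ext_d \<Omega> k \<omega>"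
  have H: "\<omega> \<in> H_space \<Omega> k" using sol by (simp add: is_solution_def)
  note \<omega> = H_space_ext_d[OF H \<Omega>]
  have s: "sq_int ?M \<omega>" "sq_int ?M ?\<sigma>" "sq_int ?M f" using \<omega> f by (auto simp: L2_forms_iff)
  have w: "is_weak_delta \<Omega> k ?\<sigma> (\<lambda>x. f x - \<omega> x)"
    unfolding is_weak_delta_def
  proof (intro allI impI)
    fix \<phi> :: "(real, 'n) vec \<Rightarrow> real" and \<alpha> :: "'n set" assume *: "test_function \<Omega> \<phi> \<and> card \<alpha> = k"
    then have t: "test_function \<Omega> \<phi>" by simp
    note c = test_function_continuous[OF t]
    define \<mu> :: "'n form" where "\<mu> x = \<phi> x *\<^sub>R axis \<alpha> 1" for x
    define D where "D i \<gamma> = (if \<gamma> = \<alpha> then partial_deriv i \<phi> else (\<lambda>_. 0))" for i \<gamma>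
    have \<mu>n: "\<mu> x $ \<gamma> = (if \<gamma> = \<alpha> then \<phi> x else 0)" for x \<gamma> by (simp add: \<mu>_def axis_def)
    have D: "has_partial i (\<lambda>x. \<mu> x $ \<gamma>) (D i \<gamma>)" for i \<gamma>
      using has_partial_test_function[OF t, of i] by (auto simp: \<mu>n D_def has_partial_def)
    note Dc = has_partialD(2)[OF D]
    have \<mu>c: "continuous_on UNIV \<mu>" unfolding \<mu>_def by (intro continuous_intros c)
    have \<mu>L: "\<mu> \<in> L2_forms \<Omega> k"
      using \<mu>c \<Omega> by (rule continuous_L2_forms) (use * in \<open>auto simp: alt_forms_def \<mu>n\<close>)
    have dL: "grad_d k D \<in> L2_forms \<Omega> (k + 1)"
      using continuous_grad_d[OF Dc] \<Omega> grad_d_alt_forms by (rule continuous_L2_forms)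
    note wd = is_weak_d_grad_d[OF D \<Omega>, of k]
    note d = ext_d_eqI[OF \<Omega> dL wd]
    have \<mu>H: "\<mu> \<in> H_space \<Omega> k" using \<mu>L dL wd by (auto simp: H_space_def)
    have s\<mu>: "sq_int ?M \<mu>" using \<mu>L by (simp add: L2_forms_iff)
    have "(LINT x|?M. (f x - \<omega> x) $ \<alpha> * \<phi> x) = ip ?M (\<lambda>x. f x - \<omega> x) \<mu>"
      unfolding ip_def \<mu>_def by (simp add: inner_axis mult.commute)
    also have "\<dots> = ip ?M ?\<sigma> (ext_d \<Omega> k \<mu>)"
      using sol \<mu>H by (force simp: is_solution_def L2_inner_eq_ip ip_diff_left s s\<mu>)
    also have "\<dots> = ip ?M ?\<sigma> (grad_d k D)"
      by (rule ip_cong_AE) (use s d dL in \<open>auto simp: sq_int_def L2_forms_iff\<close>)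
    also have "\<dots> = (\<Sum>\<gamma> | card \<gamma> = k. \<Sum>i\<in>-\<gamma>. pos_sign i (insert i \<gamma>) * (LINT x|?M. ?\<sigma> x $ (insert i \<gamma>) * D i \<gamma> x))"
      by (rule ip_grad_d[OF s(2) Dc \<Omega>])
    also have "\<dots> = (\<Sum>\<gamma> | card \<gamma> = k. if \<gamma> = \<alpha> then
        \<Sum>i\<in>-\<alpha>. pos_sign i (insert i \<alpha>) * (LINT x|?M. ?\<sigma> x $ (insert i \<alpha>) * partial_deriv i \<phi> x) else 0)"
      by (rule sum.cong) (auto simp: D_def)
    also have "\<dots> = (\<Sum>i\<in>-\<alpha>. pos_sign i (insert i \<alpha>) * (LINT x|?M. ?\<sigma> x $ (insert i \<alpha>) * partial_deriv i \<phi> x))"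
      using * by simp
    finally show "(LINT x|?M. (f x - \<omega> x) $ \<alpha> * \<phi> x) = \<dots>" .
  qed
  note r = codiff_eqI[OF \<Omega> k \<omega>(2) L2_forms_diff[OF f \<omega>(1)] w]
  show "?\<sigma> \<in> Hstar_space \<Omega> (k + 1)" by (rule r(1))
  show "AE x in ?M. codiff \<Omega> (k + 1) ?\<sigma> x = f x - \<omega> x" by (rule r(2))
qed

section \<open>Multi-affine functions and the midpoint rule\<close>

text \<open>
  The difference with unit step. For a function that is affine in the coordinate \<open>i\<close> it is the
  partial derivative.
\<close>

definition fdiff :: "'n::finite \<Rightarrow> (real ^ 'n \<Rightarrow> real) \<Rightarrow> real ^ 'n \<Rightarrow> real" where
  "fdiff i F x = F (x + axis i 1) - F x"

text \<open>
  \<open>F\<close> is affine in each coordinate in \<open>S\<close> and independent of the other coordinates.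
\<close>

definition multi_affine :: "'n::finite set \<Rightarrow> (real ^ 'n \<Rightarrow> real) \<Rightarrow> bool" where
  "multi_affine S F \<longleftrightarrow> continuous_on UNIV F \<and>
     (\<forall>i x t. F (x + t *\<^sub>R axis i 1) = F x + t * fdiff i F x) \<and> (\<forall>i x. i \<notin> S \<longrightarrow> fdiff i F x = 0)"

lemma multi_affineD:
  assumes "multi_affine S F"
  shows "continuous_on UNIV F" "F (x + t *\<^sub>R axis i 1) = F x + t * fdiff i F x"
    "i \<notin> S \<Longrightarrow> fdiff i F x = 0"
  using assms by (auto simp: multi_affine_def)

lemma continuous_on_shift:
  fixes F :: "'a::real_normed_vector \<Rightarrow> 'b::topological_space"
  assumes "continuous_on UNIV F"
  shows "continuous_on UNIV (\<lambda>x. F (x + v))"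
  by (rule continuous_on_compose2[OF assms]) (auto intro: continuous_intros)

lemma multi_affine_fdiff:
  assumes "multi_affine S F"
  shows "multi_affine (S - {i}) (fdiff i F)"
  unfolding multi_affine_def
proof (intro conjI allI impI)
  note F = multi_affineD[OF assms]
  show "continuous_on UNIV (fdiff i F)"
    unfolding fdiff_def using F(1) by (intro continuous_intros continuous_on_shift)
  have sh: "F (x + t *\<^sub>R axis j 1 + axis i 1) = F (x + axis i 1) + t * fdiff j F (x + axis i 1)" for x t j
    using F(2)[of "x + axis i 1" t j] by (simp add: algebra_simps)
  show "fdiff i F (x + t *\<^sub>R axis j 1) = fdiff i F x + t * fdiff j (fdiff i F) x" for j x t
    using sh[of x t j] sh[of x 1 j] F(2)[of x t j] F(2)[of x 1 j]
    by (simp add: fdiff_def algebra_simps)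
  show "fdiff j (fdiff i F) x = 0" if "j \<notin> S - {i}" for j x
  proof (cases "j = i")
    case True
    have "F (x + axis i 1 + axis i 1) = F x + 2 * fdiff i F x"
      using F(2)[of x 2 i] by (simp add: add.assoc scaleR_2 flip: scaleR_left_distrib)
    then show ?thesis using True by (simp add: fdiff_def)
  next
    case False
    then have "fdiff j F y = 0" for y using F(3) that by blast
    then have *: "F (y + axis j 1) = F y" for y by (simp add: fdiff_def)
    have "x + axis j 1 + axis i 1 = x + axis i 1 + axis j 1" by (simp add: algebra_simps)
    then have "F (x + axis j 1 + axis i 1) = F (x + axis i 1)" by (simp only: *)
    then show ?thesis unfolding fdiff_def by (simp add: *)
  qed
qed

lemma multi_affine_has_partial:
  assumes "multi_affine S F"
  shows "has_partial i F (fdiff i F)"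
proof -
  have "((\<lambda>t. F x + t * fdiff i F x) has_real_derivative fdiff i F x) (at 0)" for x
    by (auto intro!: derivative_eq_intros)
  then show ?thesis
    using multi_affineD[OF assms] multi_affineD(1)[OF multi_affine_fdiff[OF assms]]
    by (simp add: has_partial_def)
qed

lemma multi_affine_mono: "multi_affine S F \<Longrightarrow> S \<subseteq> T \<Longrightarrow> multi_affine T F"
  by (auto simp: multi_affine_def)

lemma multi_affine_const: "multi_affine S (\<lambda>_. c)"
  by (auto simp: multi_affine_def fdiff_def)

lemma multi_affine_add:
  "multi_affine S F \<Longrightarrow> multi_affine S G \<Longrightarrow> multi_affine S (\<lambda>x. F x + G x)"
  unfolding multi_affine_def fdiff_def by (auto intro: continuous_intros simp: algebra_simps)

lemma multi_affine_mult:
  assumes "multi_affine S F" "multi_affine T G" "S \<inter> T = {}"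
  shows "multi_affine (S \<union> T) (\<lambda>x. F x * G x)"
  unfolding multi_affine_def
proof (intro conjI allI impI)
  note F = multi_affineD[OF assms(1)] and G = multi_affineD[OF assms(2)]
  show "continuous_on UNIV (\<lambda>x. F x * G x)" using F G by (intro continuous_intros)
  fix i x
  have e: "F (x + axis i 1) = F x + fdiff i F x" "G (x + axis i 1) = G x + fdiff i G x"
    by (simp_all add: fdiff_def)
  show "F (x + t *\<^sub>R axis i 1) * G (x + t *\<^sub>R axis i 1) = F x * G x + t * fdiff i (\<lambda>x. F x * G x) x" for t
  proof (cases "i \<in> S")
    case True
    then have "fdiff i G x = 0" using G(3) assms(3) by blast
    then show ?thesis unfolding F(2) G(2) by (simp add: fdiff_def[of _ "\<lambda>x. F x * G x"] e algebra_simps)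
  next
    case False
    then have "fdiff i F x = 0" using F(3) by blast
    then show ?thesis unfolding F(2) G(2) by (simp add: fdiff_def[of _ "\<lambda>x. F x * G x"] e algebra_simps)
  qed
  show "fdiff i (\<lambda>x. F x * G x) x = 0" if "i \<notin> S \<union> T"
    using that F(3)[of i x] G(3)[of i x] by (simp add: fdiff_def[of _ "\<lambda>x. F x * G x"] e)
qed

lemma multi_affine_cmult: "multi_affine S F \<Longrightarrow> multi_affine S (\<lambda>x. c * F x)"
  using multi_affine_mult[OF multi_affine_const[of "{}" c], of S F] by simp

lemma multi_affine_diff:
  "multi_affine S F \<Longrightarrow> multi_affine S G \<Longrightarrow> multi_affine S (\<lambda>x. F x - G x)"
  using multi_affine_add[of S F "\<lambda>x. -1 * G x"] multi_affine_cmult[of S G "-1"] by simp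

lemma multi_affine_sum:
  "(\<And>j. j \<in> I \<Longrightarrow> multi_affine S (F j)) \<Longrightarrow> multi_affine S (\<lambda>x. \<Sum>j\<in>I. F j x)"
  by (induction I rule: infinite_finite_induct) (auto intro: multi_affine_const multi_affine_add)

lemma multi_affine_univariate:
  assumes "degree p \<le> 1"
  shows "multi_affine (if degree p = 0 then {} else {i}) (\<lambda>x. poly p (x $ i))"
proof -
  define a b where "a = coeff p 0" and "b = coeff p 1"
  have p: "p = [:a, b:]"
    by (rule poly_eqI) (use assms in \<open>auto simp: a_def b_def coeff_pCons intro: coeff_eq_0 split: nat.splits\<close>)
  have d: "degree p = 0 \<longleftrightarrow> b = 0" by (simp add: p)
  show ?thesis
    unfolding multi_affine_def d
    by (auto simp: p fdiff_def axis_def algebra_simps intro!: continuous_intros split: if_splits)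
qed

lemma multi_affine_prod:
  assumes "finite I" "\<And>i. i \<in> I \<Longrightarrow> multi_affine (S i) (F i)"
    and "\<And>i j. i \<in> I \<Longrightarrow> j \<in> I \<Longrightarrow> i \<noteq> j \<Longrightarrow> S i \<inter> S j = {}"
  shows "multi_affine (\<Union>i\<in>I. S i) (\<lambda>x. \<Prod>i\<in>I. F i x)"
  using assms
proof (induction I)
  case (insert i I)
  then have "multi_affine (S i \<union> (\<Union>i\<in>I. S i)) (\<lambda>x. F i x * (\<Prod>i\<in>I. F i x))"
    by (intro multi_affine_mult) auto
  then show ?case using insert by simp
qed (simp add: multi_affine_const)

lemma tensor_polys_multi_affine:
  assumes F: "F \<in> tensor_polys r" and r: "\<And>i. r i \<le> 1"
  shows "multi_affine {i. r i \<noteq> 0} F"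
proof -
  obtain N :: nat and p where p: "\<And>j i. degree (p j i) \<le> r i"
    and F: "F = (\<lambda>x. \<Sum>j<N. \<Prod>i\<in>UNIV. poly (p j i) (x $ i))"
    using F by (auto simp: tensor_polys_def)
  have "multi_affine {i. r i \<noteq> 0} (\<lambda>x. \<Prod>i\<in>UNIV. poly (p j i) (x $ i))" for j
  proof (rule multi_affine_mono)
    show "multi_affine (\<Union>i\<in>UNIV. if degree (p j i) = 0 then {} else {i}) (\<lambda>x. \<Prod>i\<in>UNIV. poly (p j i) (x $ i))"
      using p r by (intro multi_affine_prod multi_affine_univariate) (auto intro: order_trans)
    show "(\<Union>i\<in>UNIV. if degree (p j i) = 0 then {} else {i}) \<subseteq> {i. r i \<noteq> 0}"
      by (auto split: if_splits intro: less_le_trans[OF _ p])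
  qed
  then show ?thesis unfolding F by (intro multi_affine_sum)
qed

text \<open>
  Reflection in the hyperplane \<open>x\<^sub>i = c\<^sub>i\<close> preserves Lebesgue measure.
\<close>

lemma lborel_reflect:
  fixes c :: "real ^ 'n::finite" and i :: 'n
  defines "T \<equiv> \<lambda>x. x + (2 * (c $ i - x $ i)) *\<^sub>R axis i 1"
  shows "distr lborel borel T = lborel"
proof -
  define \<sigma> :: "real ^ 'n \<Rightarrow> real" where "\<sigma> j = (if j = axis i 1 then -1 else 1)" for j
  let ?t = "(2 * c $ i) *\<^sub>R axis i (1 :: real)"
  have T: "T = (\<lambda>x. ?t + (\<Sum>j\<in>Basis. (\<sigma> j * (x \<bullet> j)) *\<^sub>R j))"
  proof (rule ext, rule euclidean_eqI)
    fix x b :: "real ^ 'n" assume "b \<in> Basis"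
    then obtain l where b: "b = axis l 1" by (auto simp: Basis_vec_def)
    have *: "(\<Sum>j\<in>Basis. (\<sigma> j * (x \<bullet> j)) *\<^sub>R j) \<bullet> b = \<sigma> b * (x \<bullet> b)"
      using \<open>b \<in> Basis\<close> by (rule inner_sum_left_Basis)
    have "axis l (1::real) = axis i 1 \<longleftrightarrow> l = i" by (simp add: axis_eq_axis)
    then have "\<sigma> b = (if l = i then -1 else 1)" by (simp add: \<sigma>_def b)
    moreover have "axis i 1 \<bullet> b = (if l = i then 1 else 0)" by (simp add: b inner_axis_axis)
    moreover have "x \<bullet> b = x $ l" by (simp add: b inner_axis)
    ultimately show "T x \<bullet> b = (?t + (\<Sum>j\<in>Basis. (\<sigma> j * (x \<bullet> j)) *\<^sub>R j)) \<bullet> b"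
      unfolding inner_add_left * T_def by simp
  qed
  have "lborel = density (distr lborel borel (\<lambda>x. ?t + (\<Sum>j\<in>Basis. (\<sigma> j * (x \<bullet> j)) *\<^sub>R j))) (\<lambda>_. (\<Prod>j\<in>(Basis :: (real ^ 'n) set). \<bar>\<sigma> j\<bar>))"
    by (rule lborel_affine_euclidean) (simp add: \<sigma>_def)
  also have "(\<Prod>j\<in>(Basis :: (real ^ 'n) set). \<bar>\<sigma> j\<bar>) = 1" by (intro prod.neutral) (simp add: \<sigma>_def)
  finally show ?thesis by (simp add: T[symmetric] density_1)
qed

lemma lebesgue_on_box_integral:
  fixes F :: "real ^ 'n::finite \<Rightarrow> real"
  assumes F: "continuous_on UNIV F"
  shows "(LINT x|lebesgue_on (box a b). F x) = (LINT x|lborel. indicator (box a b) x * F x)"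
proof -
  have "(\<lambda>x. indicator (box a b) x * F x) \<in> borel_measurable lborel"
    by (rule borel_measurable_times) (use F in \<open>auto intro: borel_measurable_continuous_onI\<close>)
  then show ?thesis by (simp add: integral_restrict_space integral_completion)
qed

text \<open>
  If \<open>F\<close> is affine in \<open>x\<^sub>i\<close>, then \<open>F\<close> plus its reflection in the hyperplane \<open>x\<^sub>i = c\<^sub>i\<close> is twice the value
  of \<open>F\<close> on the hyperplane, and the box is invariant under this reflection.
\<close>

lemma integral_box_fix_coordinate:
  fixes F :: "real ^ 'n::finite \<Rightarrow> real" and i :: 'n
  assumes F: "multi_affine UNIV F" and c: "c = (1/2) *\<^sub>R (a + b)"
  defines "P \<equiv> \<lambda>x. x + (c $ i - x $ i) *\<^sub>R axis i 1"
  shows "(LINT x|lebesgue_on (box a b). F x) = (LINT x|lebesgue_on (box a b). F (P x))"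
    and "multi_affine UNIV (\<lambda>x. F (P x))"
proof -
  note F' = multi_affineD[OF F]
  define T where "T x = x + (2 * (c $ i - x $ i)) *\<^sub>R axis i 1" for x
  have Tc: "continuous_on UNIV T" and Pc: "continuous_on UNIV P"
    unfolding T_def P_def by (intro continuous_intros)+
  have FT: "continuous_on UNIV (\<lambda>x. F (T x))" and FP: "continuous_on UNIV (\<lambda>x. F (P x))"
    using continuous_on_compose2[OF F'(1)] Tc Pc by auto
  have box: "T x \<in> box a b \<longleftrightarrow> x \<in> box a b" for x
  proof -
    have "a $ l < T x $ l \<and> T x $ l < b $ l \<longleftrightarrow> a $ l < x $ l \<and> x $ l < b $ l" for l
      by (auto simp: T_def axis_def c field_simps)
    then show ?thesis by (simp add: mem_box_cart)
  qed
  have "(LINT x|lebesgue_on (box a b). F x) = (LINT x|distr lborel borel T. indicator (box a b) x * F x)"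
    using lborel_reflect[of c i] unfolding T_def by (simp add: lebesgue_on_box_integral F'(1))
  also have "\<dots> = (LINT x|lborel. indicator (box a b) (T x) * F (T x))"
  proof (rule integral_distr)
    show "T \<in> borel_measurable lborel" using Tc by (simp add: borel_measurable_continuous_onI)
    show "(\<lambda>x. indicator (box a b) x * F x) \<in> borel_measurable borel"
      by (rule borel_measurable_times) (use F'(1) in \<open>auto intro: borel_measurable_continuous_onI\<close>)
  qed
  also have "\<dots> = (LINT x|lebesgue_on (box a b). F (T x))"
    by (simp add: lebesgue_on_box_integral FT indicator_def box)
  finally have refl: "(LINT x|lebesgue_on (box a b). F x) = (LINT x|lebesgue_on (box a b). F (T x))" .
  note int = integrable_continuous_bounded[OF _ open_box bounded_box]
  have "F x + F (T x) = 2 * F (P x)" for x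
    unfolding T_def P_def F'(2) by (simp add: algebra_simps)
  then have "(LINT x|lebesgue_on (box a b). F x + F (T x)) = 2 * (LINT x|lebesgue_on (box a b). F (P x))"
    by simp
  then show "(LINT x|lebesgue_on (box a b). F x) = (LINT x|lebesgue_on (box a b). F (P x))"
    using refl int[OF F'(1)] int[OF FT] by simp
  show "multi_affine UNIV (\<lambda>x. F (P x))"
    unfolding multi_affine_def
  proof (intro conjI allI impI FP)
    fix j x t
    show "F (P (x + t *\<^sub>R axis j 1)) = F (P x) + t * fdiff j (\<lambda>x. F (P x)) x"
    proof (cases "j = i")
      case True
      have "P (x + s *\<^sub>R axis i 1) = P x" for s
        by (simp add: P_def algebra_simps)
      from this[of t] this[of 1] show ?thesis using True by (simp add: fdiff_def)
    next
      case False
      have "P (x + s *\<^sub>R axis j 1) = P x + s *\<^sub>R axis j 1" for s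
        using False by (simp add: P_def axis_def[of j] algebra_simps)
      from this[of t] this[of 1] F'(2)[of "P x" t j] show ?thesis by (simp add: fdiff_def)
    qed
  qed auto
qed

lemma integral_box_multi_affine:
  fixes F :: "real ^ 'n::finite \<Rightarrow> real"
  assumes F: "multi_affine UNIV F" and c: "c = (1/2) *\<^sub>R (a + b)"
  shows "(LINT x|lebesgue_on (box a b). F x) = measure (lebesgue_on (box a b)) (box a b) * F c"
proof -
  define p where "p A x = (\<chi> i. if i \<in> A then c $ i else x $ i)" for A and x :: "real ^ 'n"
  have "multi_affine UNIV (\<lambda>x. F (p A x)) \<and>
      (LINT x|lebesgue_on (box a b). F x) = (LINT x|lebesgue_on (box a b). F (p A x))" if "finite A" for A
    using that
  proof (induction A)
    case empty
    have "p {} x = x" for x by (simp add: p_def vec_eq_iff)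
    then show ?case using F by simp
  next
    case (insert i A)
    have "p (insert i A) x = p A (x + (c $ i - x $ i) *\<^sub>R axis i 1)" for x
      by (auto simp: p_def vec_eq_iff axis_def)
    then show ?case using integral_box_fix_coordinate[OF conjunct1[OF insert.IH] c, of i] insert.IH by simp
  qed
  from conjunct2[OF this[of UNIV]]
  have "(LINT x|lebesgue_on (box a b). F x) = (LINT x|lebesgue_on (box a b). F (p UNIV x))" by simp
  also have "\<dots> = (LINT x|lebesgue_on (box a b). F c)" by (simp add: p_def)
  finally show ?thesis by (simp add: space_restrict_space)
qed

section \<open>The local spaces on one cell\<close>

text \<open>
  The only property of \<open>\<Q>\<^sup>-\<close> and \<open>\<Q>\<^sup>*\<^sup>,\<^sup>-\<close> that the argument uses: the coefficient with index \<open>\<alpha>\<close> depends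
  on the coordinates outside \<open>\<alpha>\<close>, respectively inside \<open>\<alpha>\<close>, and is affine in each of them.
\<close>

definition Q_like :: "nat \<Rightarrow> 'n::finite form \<Rightarrow> bool" where
  "Q_like k q \<longleftrightarrow> (\<forall>x. q x \<in> alt_forms k) \<and> (\<forall>\<alpha>. multi_affine (- \<alpha>) (\<lambda>x. q x $ \<alpha>))"

definition Qstar_like :: "nat \<Rightarrow> 'n::finite form \<Rightarrow> bool" where
  "Qstar_like k \<mu> \<longleftrightarrow> (\<forall>x. \<mu> x \<in> alt_forms k) \<and> (\<forall>\<alpha>. multi_affine \<alpha> (\<lambda>x. \<mu> x $ \<alpha>))"

text \<open>
  The classical exterior derivative of a \<open>Q_like\<close> form and the classical codifferential of a
  \<open>Qstar_like\<close> form.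
\<close>

definition cell_d :: "nat \<Rightarrow> 'n::{finite,linorder} form \<Rightarrow> 'n form" where
  "cell_d k q = grad_d k (\<lambda>i \<alpha>. fdiff i (\<lambda>x. q x $ \<alpha>))"

definition cell_delta :: "nat \<Rightarrow> 'n::{finite,linorder} form \<Rightarrow> 'n form" where
  "cell_delta k \<mu> = grad_delta k (\<lambda>i \<beta>. fdiff i (\<lambda>x. \<mu> x $ \<beta>))"

lemma Q_forms_Q_like:
  fixes q :: "'n::finite form"
  assumes "q \<in> Q_forms k"
  shows "Q_like k q"
proof -
  obtain f where q: "q = (\<lambda>x. \<Sum>\<alpha> | card \<alpha> = k. f \<alpha> x *\<^sub>R dx \<alpha>)"
    and f: "\<And>\<alpha>. card \<alpha> = k \<Longrightarrow> f \<alpha> \<in> tensor_polys (\<lambda>i. 1 - (if i \<in> \<alpha> then 1 else 0))"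
    using assms by (auto simp: Q_forms_def)
  have qn: "q x $ \<alpha> = (if card \<alpha> = k then f \<alpha> x else 0)" for x \<alpha>
  proof -
    have "q x $ \<alpha> = (\<Sum>\<beta> | card \<beta> = k. if \<beta> = \<alpha> then f \<alpha> x else 0)"
      unfolding q sum_component by (intro sum.cong) (auto simp: axis_def)
    then show ?thesis by simp
  qed
  have "multi_affine (- \<alpha>) (\<lambda>x. q x $ \<alpha>)" for \<alpha>
  proof (cases "card \<alpha> = k")
    case True
    have "multi_affine {i. (1 - (if i \<in> \<alpha> then 1 else 0) :: nat) \<noteq> 0} (f \<alpha>)"
      by (rule tensor_polys_multi_affine[OF f[OF True]]) simp
    moreover have "{i. (1 - (if i \<in> \<alpha> then 1 else 0) :: nat) \<noteq> 0} = - \<alpha>" by auto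
    ultimately show ?thesis using True by (simp add: qn)
  qed (simp add: qn multi_affine_const)
  then show ?thesis by (simp add: Q_like_def qn alt_forms_def)
qed

lemma Qstar_forms_Qstar_like:
  fixes \<mu> :: "'n::{finite,linorder} form"
  assumes "\<mu> \<in> Qstar_forms k" and k: "k \<le> CARD('n)"
  shows "Qstar_like k \<mu>"
proof -
  obtain q where \<mu>: "\<mu> = (\<lambda>x. hodge_star (q x))" and q: "q \<in> Q_forms (CARD('n) - k)"
    using assms by (auto simp: Qstar_forms_def)
  note q' = Q_forms_Q_like[OF q]
  have "\<mu> x \<in> alt_forms k" for x
    using hodge_star_alt_forms[of "q x" "CARD('n) - k"] q' k by (simp add: \<mu> Q_like_def)
  moreover have "multi_affine \<alpha> (\<lambda>x. \<mu> x $ \<alpha>)" for \<alpha>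
  proof -
    have "multi_affine (- (- \<alpha>)) (\<lambda>x. q x $ (- \<alpha>))" using q' unfolding Q_like_def by blast
    then have "multi_affine \<alpha> (\<lambda>x. shuffle_sign (- \<alpha>) * q x $ (- \<alpha>))"
      by (intro multi_affine_cmult) simp
    then show ?thesis by (simp add: \<mu> hodge_star_nth mult.commute)
  qed
  ultimately show ?thesis by (simp add: Qstar_like_def)
qed

lemma Q_like_continuous:
  assumes "Q_like k q" shows "continuous_on UNIV q"
proof -
  have "continuous_on UNIV (\<lambda>x. \<chi> \<alpha>. q x $ \<alpha>)"
    by (rule continuous_on_vec_lambda) (use assms multi_affineD(1) in \<open>auto simp: Q_like_def\<close>)
  then show ?thesis by simp
qed

lemma Qstar_like_continuous:
  assumes "Qstar_like k q" shows "continuous_on UNIV q"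
proof -
  have "continuous_on UNIV (\<lambda>x. \<chi> \<alpha>. q x $ \<alpha>)"
    by (rule continuous_on_vec_lambda) (use assms multi_affineD(1) in \<open>auto simp: Qstar_like_def\<close>)
  then show ?thesis by simp
qed

lemma cell_d_alt_forms: "cell_d k q x \<in> alt_forms (k + 1)"
  unfolding cell_d_def by (rule grad_d_alt_forms)

lemma cell_d_Q_like:
  assumes "Q_like k q"
  shows "Q_like (k + 1) (cell_d k q)"
proof -
  have "multi_affine (- \<beta>) (\<lambda>x. cell_d k q x $ \<beta>)" for \<beta>
  proof -
    have "multi_affine (- \<beta>) (fdiff i (\<lambda>x. q x $ (\<beta> - {i})))" for i
    proof -
      have "multi_affine (- (\<beta> - {i})) (\<lambda>x. q x $ (\<beta> - {i}))" using assms unfolding Q_like_def by blast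
      from multi_affine_fdiff[OF this, of i] show ?thesis by (rule multi_affine_mono) auto
    qed
    then have "multi_affine (- \<beta>) (\<lambda>x. \<Sum>i\<in>\<beta>. pos_sign i \<beta> * fdiff i (\<lambda>x. q x $ (\<beta> - {i})) x)"
      by (intro multi_affine_sum multi_affine_cmult)
    then show ?thesis
      by (cases "card \<beta> = k + 1") (simp_all add: cell_d_def grad_d_def multi_affine_const)
  qed
  then show ?thesis by (simp add: Q_like_def cell_d_alt_forms[simplified])
qed

lemma cell_delta_Qstar_like:
  assumes "Qstar_like (k + 1) \<mu>"
  shows "Qstar_like k (cell_delta k \<mu>)"
proof -
  have "multi_affine \<alpha> (\<lambda>x. cell_delta k \<mu> x $ \<alpha>)" for \<alpha>
  proof -
    have "multi_affine \<alpha> (fdiff i (\<lambda>x. \<mu> x $ (insert i \<alpha>)))" for i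
    proof -
      have "multi_affine (insert i \<alpha>) (\<lambda>x. \<mu> x $ (insert i \<alpha>))" using assms unfolding Qstar_like_def by blast
      from multi_affine_fdiff[OF this, of i] show ?thesis by (rule multi_affine_mono) auto
    qed
    then have "multi_affine \<alpha> (\<lambda>x. -1 * (\<Sum>i\<in>-\<alpha>. pos_sign i (insert i \<alpha>) * fdiff i (\<lambda>x. \<mu> x $ (insert i \<alpha>)) x))"
      by (intro multi_affine_sum multi_affine_cmult)
    then show ?thesis
      by (cases "card \<alpha> = k") (simp_all add: cell_delta_def grad_delta_def multi_affine_const)
  qed
  moreover have "cell_delta k \<mu> x \<in> alt_forms k" for x
    unfolding cell_delta_def by (rule grad_delta_alt_forms)
  ultimately show ?thesis by (simp add: Qstar_like_def)
qed

lemma Q_like_L2_forms: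
  "Q_like k q \<Longrightarrow> open \<Xi> \<Longrightarrow> bounded \<Xi> \<Longrightarrow> q \<in> L2_forms \<Xi> k"
  by (intro continuous_L2_forms Q_like_continuous) (auto simp: Q_like_def)

lemma Qstar_like_L2_forms:
  "Qstar_like k q \<Longrightarrow> open \<Xi> \<Longrightarrow> bounded \<Xi> \<Longrightarrow> q \<in> L2_forms \<Xi> k"
  by (intro continuous_L2_forms Qstar_like_continuous) (auto simp: Qstar_like_def)

lemma is_weak_d_cell_d:
  assumes "Q_like k q" "open \<Xi>" "bounded \<Xi>"
  shows "is_weak_d \<Xi> k q (cell_d k q)"
  unfolding cell_d_def
  using assms by (intro is_weak_d_grad_d multi_affine_has_partial) (auto simp: Q_like_def)

lemma is_weak_delta_cell_delta:
  assumes "Qstar_like (k + 1) \<mu>" "open \<Xi>" "bounded \<Xi>"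
  shows "is_weak_delta \<Xi> k \<mu> (cell_delta k \<mu>)"
  unfolding cell_delta_def
  using assms by (intro is_weak_delta_grad_delta multi_affine_has_partial) (auto simp: Qstar_like_def)

lemma integral_inner_Q_Qstar:
  assumes q: "Q_like k q" and \<mu>: "Qstar_like l \<mu>" and c: "c = (1/2) *\<^sub>R (a + b)"
  shows "ip (lebesgue_on (box a b)) q \<mu> = measure (lebesgue_on (box a b)) (box a b) * (q c \<bullet> \<mu> c)"
  unfolding ip_def
proof (rule integral_box_multi_affine[OF _ c])
  have "multi_affine UNIV (\<lambda>x. q x $ \<alpha> * \<mu> x $ \<alpha>)" for \<alpha>
    using multi_affine_mult[of "- \<alpha>" "\<lambda>x. q x $ \<alpha>" \<alpha> "\<lambda>x. \<mu> x $ \<alpha>"] q \<mu> by (simp add: Q_like_def Qstar_like_def)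
  then show "multi_affine UNIV (\<lambda>x. q x \<bullet> \<mu> x)"
    unfolding inner_vec_def by (auto intro: multi_affine_sum)
qed

text \<open>
  The value at the midpoint is the mean value, hence bounded by the norm.
\<close>

lemma integral_norm_midpoint_le:
  assumes q: "Q_like k q" and c: "c = (1/2) *\<^sub>R (a + b)"
  shows "measure (lebesgue_on (box a b)) (box a b) * (norm (q c))\<^sup>2 \<le> (LINT x|lebesgue_on (box a b). (norm (q x))\<^sup>2)"
proof -
  let ?M = "lebesgue_on (box a b)"
  have cont: "continuous_on UNIV q" by (rule Q_like_continuous[OF q])
  have "multi_affine UNIV (\<lambda>x. q x $ \<alpha> * q c $ \<alpha>)" for \<alpha>
    using multi_affine_cmult[of "- \<alpha>" "\<lambda>x. q x $ \<alpha>" "q c $ \<alpha>"] q multi_affine_mono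
    by (force simp: Q_like_def mult.commute)
  then have "multi_affine UNIV (\<lambda>x. q x \<bullet> q c)"
    unfolding inner_vec_def by (auto intro: multi_affine_sum)
  from integral_box_multi_affine[OF this c]
  have m: "(LINT x|?M. q x \<bullet> q c) = measure ?M (box a b) * (norm (q c))\<^sup>2"
    by (simp add: power2_norm_eq_inner)
  note int = integrable_continuous_bounded[OF _ open_box bounded_box]
  have "2 * (LINT x|?M. q x \<bullet> q c) - measure ?M (box a b) * (norm (q c))\<^sup>2 = (LINT x|?M. 2 * (q x \<bullet> q c) - (norm (q c))\<^sup>2)"
    by (subst Bochner_Integration.integral_diff)
      (auto intro!: int continuous_intros cont simp: space_restrict_space)
  also have "\<dots> \<le> (LINT x|?M. (norm (q x))\<^sup>2)"
  proof (rule integral_mono)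
    show "2 * (q x \<bullet> q c) - (norm (q c))\<^sup>2 \<le> (norm (q x))\<^sup>2" for x
    proof -
      have "0 \<le> (norm (q x - q c))\<^sup>2" by simp
      then show ?thesis
        by (simp add: power2_norm_eq_inner inner_diff_left inner_diff_right inner_commute)
    qed
  qed (auto intro!: int continuous_intros cont)
  finally show ?thesis using m by (simp add: mult.commute)
qed

lemma koszul_const_nth:
  "koszul (\<lambda>_. v) x $ \<alpha> = (\<Sum>i\<in>-\<alpha>. v $ (insert i \<alpha>) * (pos_sign i (insert i \<alpha>) * x $ i))"
proof -
  have "koszul (\<lambda>_. v) x $ \<alpha> = (\<Sum>\<beta>\<in>UNIV. \<Sum>i\<in>\<beta>. if \<beta> - {i} = \<alpha> then v $ \<beta> * (pos_sign i \<beta> * x $ i) else 0)"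
    unfolding koszul_def sum_component vector_scaleR_component
    by (intro sum.cong) (auto simp: axis_def sum_distrib_left intro!: sum.cong)
  also have "\<dots> = (\<Sum>(\<beta>, i) \<in> Sigma UNIV (\<lambda>\<beta>. \<beta>). if \<beta> - {i} = \<alpha> then v $ \<beta> * (pos_sign i \<beta> * x $ i) else 0)"
    by (rule sum.Sigma) auto
  also have "\<dots> = (\<Sum>(\<beta>, i) \<in> (\<lambda>i. (insert i \<alpha>, i)) ` (- \<alpha>). if \<beta> - {i} = \<alpha> then v $ \<beta> * (pos_sign i \<beta> * x $ i) else 0)"
    by (rule sum.mono_neutral_right) (auto simp: image_iff)
  also have "\<dots> = (\<Sum>i\<in>-\<alpha>. v $ (insert i \<alpha>) * (pos_sign i (insert i \<alpha>) * x $ i))"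
    by (subst sum.reindex) (auto simp: inj_on_def)
  finally show ?thesis .
qed

lemma koszul_const_alt_forms:
  fixes v :: "real ^ ('n::{finite,linorder} set)"
  assumes "v \<in> alt_forms (k + 1)"
  shows "koszul (\<lambda>_. v) x \<in> alt_forms k"
  using assms by (auto simp: alt_forms_def koszul_const_nth intro!: sum.neutral)

lemma koszul_const_diff_point: "koszul (\<lambda>_. v) (x - y) = koszul (\<lambda>_. v) x - koszul (\<lambda>_. v) y"
  by (simp add: vec_eq_iff koszul_const_nth right_diff_distrib sum_subtractf)

lemma koszul_const_diff: "koszul (\<lambda>_. v - w) x = koszul (\<lambda>_. v) x - koszul (\<lambda>_. w) x"
  by (simp add: vec_eq_iff koszul_const_nth left_diff_distrib sum_subtractf)

lemma koszul_const_scale: "koszul (\<lambda>_. r *\<^sub>R v) x = r *\<^sub>R koszul (\<lambda>_. v) x"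
  by (simp add: vec_eq_iff koszul_const_nth sum_distrib_left mult.assoc)

lemma norm_koszul_const_le:
  fixes v :: "real ^ ('n::{finite,linorder} set)"
  shows "norm (koszul (\<lambda>_. v) x) \<le> real (CARD('n set) * CARD('n)) * norm v * norm x"
proof -
  have "norm (koszul (\<lambda>_. v) x $ \<alpha>) \<le> real CARD('n) * (norm v * norm x)" for \<alpha>
  proof -
    have "\<bar>v $ (insert i \<alpha>) * (pos_sign i (insert i \<alpha>) * x $ i)\<bar> \<le> norm v * norm x" for i
    proof -
      have "\<bar>pos_sign i (insert i \<alpha>)\<bar> = 1" by (simp add: pos_sign_def power_abs)
      then show ?thesis
        using component_le_norm_cart[of v "insert i \<alpha>"] component_le_norm_cart[of x i]
        by (simp add: abs_mult mult_mono)
    qed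
    then have "norm (koszul (\<lambda>_. v) x $ \<alpha>) \<le> (\<Sum>i\<in>-\<alpha>. norm v * norm x)"
      unfolding koszul_const_nth real_norm_def by (intro order_trans[OF sum_abs] sum_mono)
    also have "\<dots> \<le> real CARD('n) * (norm v * norm x)"
      using card_le_CARD[of "- \<alpha>"] by (simp add: mult_right_mono)
    finally show ?thesis .
  qed
  then have "(\<Sum>\<alpha>\<in>UNIV. norm (koszul (\<lambda>_. v) x $ \<alpha>)) \<le> (\<Sum>\<alpha>\<in>(UNIV :: 'n set set). real CARD('n) * (norm v * norm x))"
    by (intro sum_mono)
  moreover have "norm (koszul (\<lambda>_. v) x) \<le> (\<Sum>\<alpha>\<in>UNIV. norm (koszul (\<lambda>_. v) x $ \<alpha>))"
    by (simp add: norm_le_l1_cart)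
  ultimately show ?thesis by (simp add: mult.assoc)
qed

lemma whitney_formsE:
  assumes "m \<in> whitney_forms k"
  obtains u v where "u \<in> alt_forms k" "v \<in> alt_forms (k + 1)" "m = (\<lambda>x. u + koszul (\<lambda>_. v) x)"
  using assms unfolding whitney_forms_def const_forms_def by blast

lemma whitney_formsI:
  assumes "u \<in> alt_forms k" "v \<in> alt_forms (k + 1)"
  shows "(\<lambda>x. u + koszul (\<lambda>_. v) x) \<in> whitney_forms k"
  unfolding whitney_forms_def mem_Collect_eq
  by (intro exI[of _ "\<lambda>_. u"] exI[of _ "\<lambda>_. v"]) (use assms in \<open>auto simp: const_forms_def\<close>)

lemma whitney_Q_like:
  fixes m :: "'n::{finite,linorder} form"
  assumes "m \<in> whitney_forms k"
  shows "Q_like k m"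
proof -
  obtain u v where u: "u \<in> alt_forms k" and v: "v \<in> alt_forms (k + 1)" and m: "m = (\<lambda>x. u + koszul (\<lambda>_. v) x)"
    using whitney_formsE[OF assms] .
  have coord: "multi_affine {i} (\<lambda>x :: (real, 'n) vec. x $ i)" for i
    using multi_affine_univariate[of "[:0, 1:]" i] by simp
  have "multi_affine (- \<alpha>) (\<lambda>x. m x $ \<alpha>)" for \<alpha>
    unfolding m vector_add_component koszul_const_nth
    by (intro multi_affine_add multi_affine_const multi_affine_sum multi_affine_cmult multi_affine_mono[OF coord]) auto
  moreover have "m x \<in> alt_forms k" for x
    using u koszul_const_alt_forms[OF v] by (simp add: m alt_forms_def)
  ultimately show ?thesis by (simp add: Q_like_def)
qed

lemma cell_d_whitney:
  fixes v :: "real ^ ('n::{finite,linorder} set)"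
  assumes v: "v \<in> alt_forms (k + 1)"
  shows "cell_d k (\<lambda>x. u + koszul (\<lambda>_. v) x) x = real (k + 1) *\<^sub>R v"
proof -
  have fd: "fdiff i (\<lambda>x. (u + koszul (\<lambda>_. v) x) $ \<alpha>) x = v $ (insert i \<alpha>) * pos_sign i (insert i \<alpha>)"
    if "i \<notin> \<alpha>" for i \<alpha>
  proof -
    have "fdiff i (\<lambda>x. (u + koszul (\<lambda>_. v) x) $ \<alpha>) x = koszul (\<lambda>_. v) (x + axis i 1 - x) $ \<alpha>"
      unfolding koszul_const_diff_point by (simp add: fdiff_def)
    also have "\<dots> = (\<Sum>j\<in>-\<alpha>. if j = i then v $ (insert i \<alpha>) * pos_sign i (insert i \<alpha>) else 0)"
      unfolding koszul_const_nth by (intro sum.cong) (auto simp: axis_def)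
    also have "\<dots> = v $ (insert i \<alpha>) * pos_sign i (insert i \<alpha>)" using that by simp
    finally show ?thesis .
  qed
  have "cell_d k (\<lambda>x. u + koszul (\<lambda>_. v) x) x $ \<beta> = real (k + 1) * v $ \<beta>" for \<beta>
  proof (cases "card \<beta> = k + 1")
    case True
    have "(\<Sum>i\<in>\<beta>. pos_sign i \<beta> * fdiff i (\<lambda>x. (u + koszul (\<lambda>_. v) x) $ (\<beta> - {i})) x) = (\<Sum>i\<in>\<beta>. v $ \<beta>)"
    proof (rule sum.cong)
      fix i assume "i \<in> \<beta>"
      then have "pos_sign i \<beta> * fdiff i (\<lambda>x. (u + koszul (\<lambda>_. v) x) $ (\<beta> - {i})) x = (pos_sign i \<beta> * pos_sign i \<beta>) * v $ \<beta>"
        by (subst fd) (auto simp: insert_absorb)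
      then show "pos_sign i \<beta> * fdiff i (\<lambda>x. (u + koszul (\<lambda>_. v) x) $ (\<beta> - {i})) x = v $ \<beta>" by simp
    qed simp
    then show ?thesis using True by (simp add: cell_d_def grad_d_def)
  next
    case False
    then show ?thesis using v by (simp add: cell_d_def grad_d_def alt_forms_def)
  qed
  then show ?thesis by (simp add: vec_eq_iff)
qed

text \<open>
  The Whitney form with the same value and the same exterior derivative as \<open>q\<close> at \<open>c\<close>. The factor
  \<open>1 / (k + 1)\<close> is due to \<open>d \<kappa> v = (k + 1) v\<close> for constant \<open>v\<close>.
\<close>

definition whitney_proj :: "nat \<Rightarrow> real ^ 'n::{finite,linorder} \<Rightarrow> 'n form \<Rightarrow> 'n form" where
  "whitney_proj k c q = (\<lambda>x. q c + koszul (\<lambda>_. (1 / real (k + 1)) *\<^sub>R cell_d k q c) (x - c))"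

lemma whitney_proj_in:
  assumes "Q_like k q"
  shows "whitney_proj k c q \<in> whitney_forms k" "cell_d k (whitney_proj k c q) x = cell_d k q c"
    "whitney_proj k c q c = q c"
proof -
  let ?v = "(1 / real (k + 1)) *\<^sub>R cell_d k q c"
  have v: "?v \<in> alt_forms (k + 1)" using cell_d_alt_forms[of k q c] by (simp add: alt_forms_def)
  have u: "q c - koszul (\<lambda>_. ?v) c \<in> alt_forms k"
    using assms koszul_const_alt_forms[OF v] by (intro alt_forms_diff) (auto simp: Q_like_def)
  have e: "whitney_proj k c q = (\<lambda>x. (q c - koszul (\<lambda>_. ?v) c) + koszul (\<lambda>_. ?v) x)"
    by (auto simp: whitney_proj_def koszul_const_diff_point)
  show "whitney_proj k c q \<in> whitney_forms k" unfolding e by (rule whitney_formsI[OF u v])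
  show "cell_d k (whitney_proj k c q) x = cell_d k q c"
    unfolding e cell_d_whitney[OF v] by simp
  show "whitney_proj k c q c = q c" unfolding e by simp
qed

lemma cell_d_diff: "cell_d k (\<lambda>x. q x - m x) x = cell_d k q x - cell_d k m x"
proof -
  have "fdiff i (\<lambda>x. (q x - m x) $ \<alpha>) x = fdiff i (\<lambda>x. q x $ \<alpha>) x - fdiff i (\<lambda>x. m x $ \<alpha>) x" for i \<alpha>
    by (simp add: fdiff_def)
  then show ?thesis
    by (simp add: vec_eq_iff cell_d_def grad_d_def right_diff_distrib sum_subtractf)
qed

lemma Q_like_diff: "Q_like k q \<Longrightarrow> Q_like k m \<Longrightarrow> Q_like k (\<lambda>x. q x - m x)"
  by (auto simp: Q_like_def intro: alt_forms_diff multi_affine_diff)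

lemma whitney_proj_whitney:
  assumes "m \<in> whitney_forms k"
  shows "whitney_proj k c m = m"
proof -
  obtain u v where v: "v \<in> alt_forms (k + 1)" and m: "m = (\<lambda>x. u + koszul (\<lambda>_. v) x)"
    using whitney_formsE[OF assms] .
  have "(1 / real (k + 1)) *\<^sub>R cell_d k m c = v"
    unfolding m cell_d_whitney[OF v] by simp
  then show ?thesis unfolding whitney_proj_def by (simp add: m koszul_const_diff_point)
qed

lemma whitney_proj_diff:
  "whitney_proj k c (\<lambda>x. q x - m x) x = whitney_proj k c q x - whitney_proj k c m x"
  by (simp add: whitney_proj_def cell_d_diff koszul_const_diff koszul_const_scale scaleR_diff_right)

lemma norm_diff_square_le: "(norm (u - v))\<^sup>2 \<le> 2 * (norm u)\<^sup>2 + 2 * (norm (v :: 'a::real_inner))\<^sup>2"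
proof -
  have "0 \<le> (norm (u + v))\<^sup>2" by simp
  then show ?thesis
    by (simp add: power2_norm_eq_inner inner_add_left inner_add_right inner_diff_left inner_diff_right inner_commute)
qed

text \<open>
  Boundedness of \<open>q \<mapsto> q - whitney_proj k c q\<close> in the graph norm on a box. The exterior derivative of
  the projection is the constant \<open>cell_d k p c\<close>.
\<close>

lemma whitney_proj_estimate:
  fixes p :: "'n::{finite,linorder} form"
  assumes p: "Q_like k p" and c: "c = (1/2) *\<^sub>R (a + b)" and \<rho>: "\<And>x. x \<in> box a b \<Longrightarrow> norm (x - c) \<le> \<rho>"
  defines "L \<equiv> real (CARD('n set) * CARD('n)) * \<rho>"
  shows "(LINT x|lebesgue_on (box a b). (norm (p x - whitney_proj k c p x))\<^sup>2 + (norm (cell_d k p x - cell_d k p c))\<^sup>2)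
    \<le> (6 + 4 * L\<^sup>2) * (LINT x|lebesgue_on (box a b). (norm (p x))\<^sup>2 + (norm (cell_d k p x))\<^sup>2)"
proof -
  let ?M = "lebesgue_on (box a b)" and ?d = "cell_d k p" and ?J = "whitney_proj k c p"
  note int = integrable_continuous_bounded[OF _ open_box bounded_box]
  have cp: "continuous_on UNIV p" and cd: "continuous_on UNIV ?d" and cJ: "continuous_on UNIV ?J"
    using p cell_d_Q_like[OF p] whitney_proj_in(1)[OF p] whitney_Q_like Q_like_continuous by blast+
  let ?P = "\<lambda>x. (norm (p x))\<^sup>2" and ?D = "\<lambda>x. (norm (?d x))\<^sup>2"
  have iP: "integrable ?M ?P" "integrable ?M ?D" by (intro int continuous_intros cp cd)+
  have le: "(norm (p x - ?J x))\<^sup>2 + (norm (?d x - ?d c))\<^sup>2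
      \<le> 2 * ?P x + 4 * ?P c + 2 * ?D x + (2 + 4 * L\<^sup>2) * ?D c" if x: "x \<in> box a b" for x
  proof -
    let ?v = "(1 / real (k + 1)) *\<^sub>R ?d c"
    have nv: "norm ?v \<le> norm (?d c)" by (simp add: divide_le_eq distrib_left)
    have "norm (koszul (\<lambda>_. ?v) (x - c)) \<le> real (CARD('n set) * CARD('n)) * norm ?v * norm (x - c)"
      by (rule norm_koszul_const_le)
    also have "\<dots> \<le> real (CARD('n set) * CARD('n)) * norm (?d c) * \<rho>"
      using nv \<rho>[OF x] by (intro mult_mono) auto
    finally have "norm (koszul (\<lambda>_. ?v) (x - c)) \<le> L * norm (?d c)" by (simp add: L_def mult_ac)
    then have kz: "(norm (koszul (\<lambda>_. ?v) (x - c)))\<^sup>2 \<le> L\<^sup>2 * ?D c"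
      using power_mono[of "norm (koszul (\<lambda>_. ?v) (x - c))" "L * norm (?d c)" 2] by (simp add: power_mult_distrib)
    have "(norm (?J x))\<^sup>2 \<le> 2 * ?P c + 2 * (norm (koszul (\<lambda>_. ?v) (x - c)))\<^sup>2"
      using norm_diff_square_le[of "p c" "- koszul (\<lambda>_. ?v) (x - c)"] by (simp add: whitney_proj_def)
    then have "(norm (p x - ?J x))\<^sup>2 \<le> 2 * ?P x + 4 * ?P c + 4 * L\<^sup>2 * ?D c"
      using norm_diff_square_le[of "p x" "?J x"] kz by linarith
    moreover have "(norm (?d x - ?d c))\<^sup>2 \<le> 2 * ?D x + 2 * ?D c" by (rule norm_diff_square_le)
    ultimately show ?thesis by (simp add: distrib_right)
  qed
  have "(LINT x|?M. (norm (p x - ?J x))\<^sup>2 + (norm (?d x - ?d c))\<^sup>2)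
      \<le> (LINT x|?M. 2 * ?P x + 4 * ?P c + 2 * ?D x + (2 + 4 * L\<^sup>2) * ?D c)"
  proof (rule integral_mono)
    show "x \<in> space ?M \<Longrightarrow> (norm (p x - ?J x))\<^sup>2 + (norm (?d x - ?d c))\<^sup>2
      \<le> 2 * ?P x + 4 * ?P c + 2 * ?D x + (2 + 4 * L\<^sup>2) * ?D c" for x
      by (rule le) (simp add: space_restrict_space)
  qed (intro int continuous_intros cp cd cJ)+
  also have "\<dots> = 2 * integral\<^sup>L ?M ?P + 4 * (measure ?M (box a b) * ?P c) + 2 * integral\<^sup>L ?M ?D
      + (2 + 4 * L\<^sup>2) * (measure ?M (box a b) * ?D c)"
  proof -
    have ic: "integrable ?M (\<lambda>_. r :: real)" for r by (intro int continuous_intros)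
    show ?thesis using iP ic by (simp add: space_restrict_space)
  qed
  also have "\<dots> \<le> 2 * integral\<^sup>L ?M ?P + 4 * integral\<^sup>L ?M ?P + 2 * integral\<^sup>L ?M ?D
      + (2 + 4 * L\<^sup>2) * integral\<^sup>L ?M ?D"
    by (intro add_mono mult_left_mono integral_norm_midpoint_le[OF p c]
        integral_norm_midpoint_le[OF cell_d_Q_like[OF p] c]) auto
  also have "\<dots> \<le> (6 + 4 * L\<^sup>2) * (integral\<^sup>L ?M ?P + integral\<^sup>L ?M ?D)"
  proof -
    have "0 \<le> integral\<^sup>L ?M ?P" "0 \<le> integral\<^sup>L ?M ?D" by (auto intro: integral_nonneg_AE)
    then have "0 \<le> 4 * L\<^sup>2 * integral\<^sup>L ?M ?P + 2 * integral\<^sup>L ?M ?D" by simp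
    then show ?thesis by (simp add: algebra_simps)
  qed
  also have "\<dots> = (6 + 4 * L\<^sup>2) * (LINT x|?M. ?P x + ?D x)" using iP by simp
  finally show ?thesis .
qed

section \<open>Cubical meshes and broken norms\<close>

lemma cubical_mesh_cell:
  assumes "cubical_mesh \<Omega> \<G>" "K \<in> \<G>"
  obtains a b where "K = cbox a b" "interior K = box a b" "box a b \<noteq> {}" "box a b \<subseteq> \<Omega>"
proof -
  obtain a b where "K = cbox a b" using assms by (auto simp: cubical_mesh_def dest: division_ofD(4))
  moreover from this have "interior K = box a b" by (simp add: interior_cbox)
  moreover have "interior K \<noteq> {}" "interior K \<subseteq> \<Omega>" using assms by (auto simp: cubical_mesh_def)
  ultimately show ?thesis using that by metis
qed

lemma cubical_mesh_finite: "cubical_mesh \<Omega> \<G> \<Longrightarrow> finite \<G>"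
  by (auto simp: cubical_mesh_def)

lemma cubical_mesh_disjoint:
  "cubical_mesh \<Omega> \<G> \<Longrightarrow> K \<in> \<G> \<Longrightarrow> K' \<in> \<G> \<Longrightarrow> x \<in> interior K \<Longrightarrow> x \<in> interior K' \<Longrightarrow> K = K'"
  unfolding cubical_mesh_def using division_ofD(5) by blast

lemma cubical_mesh_interior_subset:
  "cubical_mesh \<Omega> \<G> \<Longrightarrow> K \<in> \<G> \<Longrightarrow> interior K \<subseteq> \<Omega>"
  by (auto simp: cubical_mesh_def)

text \<open>
  Up to null sets the domain is the union of the interiors of the cells.
\<close>

lemma cubical_mesh_AE:
  assumes mesh: "cubical_mesh \<Omega> \<G>"
  shows "AE x in lebesgue. x \<in> \<Omega> \<longleftrightarrow> x \<in> (\<Union>K\<in>\<G>. interior K)"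
proof -
  have div: "\<G> division_of closure \<Omega>" using mesh by (simp add: cubical_mesh_def)
  have "negligible (K - interior K)" if "K \<in> \<G>" for K
    using cubical_mesh_cell[OF mesh that] negligible_frontier_interval by metis
  then have "negligible (\<Union>K\<in>\<G>. K - interior K)"
    using cubical_mesh_finite[OF mesh] by (intro negligible_Union) auto
  then have "AE x in lebesgue. x \<notin> (\<Union>K\<in>\<G>. K - interior K)"
    unfolding negligible_iff_null_sets by (rule AE_not_in)
  then show ?thesis
  proof eventually_elim
    case (elim x)
    have "x \<in> \<Omega> \<Longrightarrow> x \<in> \<Union>\<G>" using division_ofD(6)[OF div] closure_subset by blast
    then show ?case using elim cubical_mesh_interior_subset[OF mesh] by blast
  qed
qed

lemma mesh_sum_indicator:
  assumes mesh: "cubical_mesh \<Omega> \<G>" and K: "K \<in> \<G>" "x \<in> interior K"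
  shows "(\<Sum>K\<in>\<G>. indicator (interior K) x *\<^sub>R g K) = (g K :: 'b::real_vector)"
proof -
  have "(\<Sum>K\<in>\<G>. indicator (interior K) x *\<^sub>R g K) = (\<Sum>K'\<in>\<G>. if K' = K then g K else 0)"
    using cubical_mesh_disjoint[OF mesh] K by (intro sum.cong) (auto simp: indicator_def)
  then show ?thesis using K(1) cubical_mesh_finite[OF mesh] by simp
qed

lemma mesh_AE_indicator:
  fixes f :: "real ^ 'n::finite \<Rightarrow> 'b::real_vector"
  assumes mesh: "cubical_mesh \<Omega> \<G>"
  shows "AE x in lebesgue. indicator \<Omega> x *\<^sub>R f x = (\<Sum>K\<in>\<G>. indicator (interior K) x *\<^sub>R f x)"
  using cubical_mesh_AE[OF mesh]
proof eventually_elim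
  case (elim x)
  show ?case
  proof (cases "x \<in> \<Omega>")
    case True
    then obtain K where "K \<in> \<G>" "x \<in> interior K" using elim by blast
    from mesh_sum_indicator[OF mesh this, of "\<lambda>_. f x"] show ?thesis using True by simp
  next
    case False
    then have "\<forall>K\<in>\<G>. x \<notin> interior K" using elim by blast
    then show ?thesis using False by simp
  qed
qed

lemma mesh_measurable:
  fixes f :: "real ^ 'n::finite \<Rightarrow> 'b::euclidean_space"
  assumes mesh: "cubical_mesh \<Omega> \<G>" and \<Omega>: "open \<Omega>"
    and f: "\<And>K. K \<in> \<G> \<Longrightarrow> f \<in> borel_measurable (lebesgue_on (interior K))"
  shows "f \<in> borel_measurable (lebesgue_on \<Omega>)"
proof (rule lebesgue_on_measurable_cong_AE)
  let ?g = "\<lambda>x. \<Sum>K\<in>\<G>. indicator (interior K) x *\<^sub>R f x"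
  have "(\<lambda>x. indicator (interior K) x *\<^sub>R f x) \<in> borel_measurable lebesgue" if "K \<in> \<G>" for K
    using f[OF that] by (subst (asm) borel_measurable_restrict_space_iff) auto
  then show "?g \<in> borel_measurable (lebesgue_on \<Omega>)"
    by (intro measurable_restrict_space1 borel_measurable_sum)
  have "AE x in lebesgue. x \<in> \<Omega> \<longrightarrow> ?g x = f x"
    using mesh_AE_indicator[OF mesh, of f] by eventually_elim auto
  then show "AE x in lebesgue_on \<Omega>. ?g x = f x" using \<Omega> by (simp add: AE_restrict_space_iff)
qed (use \<Omega> in auto)

lemma mesh_integral:
  fixes F :: "real ^ 'n::finite \<Rightarrow> real"
  assumes mesh: "cubical_mesh \<Omega> \<G>" and \<Omega>: "open \<Omega>"
    and F: "\<And>K. K \<in> \<G> \<Longrightarrow> integrable (lebesgue_on (interior K)) F"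
  shows "integrable (lebesgue_on \<Omega>) F"
    and "(LINT x|lebesgue_on \<Omega>. F x) = (\<Sum>K\<in>\<G>. LINT x|lebesgue_on (interior K). F x)"
proof -
  have m: "F \<in> borel_measurable (lebesgue_on \<Omega>)"
    using F by (intro mesh_measurable[OF mesh \<Omega>]) auto
  have m': "(\<lambda>x. indicator \<Omega> x *\<^sub>R F x) \<in> borel_measurable lebesgue"
    using m \<Omega> by (subst (asm) borel_measurable_restrict_space_iff) auto
  have i: "integrable lebesgue (\<lambda>x. indicator (interior K) x *\<^sub>R F x)" if "K \<in> \<G>" for K
    using F[OF that] by (subst (asm) integrable_restrict_space) auto
  then have si: "integrable lebesgue (\<lambda>x. \<Sum>K\<in>\<G>. indicator (interior K) x *\<^sub>R F x)"
    by (rule Bochner_Integration.integrable_sum)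
  note ae = mesh_AE_indicator[OF mesh, of F]
  have "integrable lebesgue (\<lambda>x. indicator \<Omega> x *\<^sub>R F x)"
    by (rule integrable_cong_AE_imp[OF si m']) (use ae in \<open>auto elim: eventually_mono\<close>)
  then show "integrable (lebesgue_on \<Omega>) F" using \<Omega> by (subst integrable_restrict_space) auto
  have "(LINT x|lebesgue_on \<Omega>. F x) = (LINT x|lebesgue. indicator \<Omega> x *\<^sub>R F x)"
    using \<Omega> by (simp add: integral_restrict_space)
  also have "\<dots> = (LINT x|lebesgue. (\<Sum>K\<in>\<G>. indicator (interior K) x *\<^sub>R F x))"
    by (rule integral_cong_AE[OF m' _ ae]) (use si in auto)
  also have "\<dots> = (\<Sum>K\<in>\<G>. LINT x|lebesgue. indicator (interior K) x *\<^sub>R F x)"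
    by (rule Bochner_Integration.integral_sum) (rule i)
  also have "\<dots> = (\<Sum>K\<in>\<G>. LINT x|lebesgue_on (interior K). F x)"
    by (intro sum.cong) (simp_all add: integral_restrict_space)
  finally show "(LINT x|lebesgue_on \<Omega>. F x) = (\<Sum>K\<in>\<G>. LINT x|lebesgue_on (interior K). F x)" .
qed

lemma mesh_sq_int:
  fixes f :: "real ^ 'n::finite \<Rightarrow> 'b::euclidean_space"
  assumes mesh: "cubical_mesh \<Omega> \<G>" and \<Omega>: "open \<Omega>"
    and f: "\<And>K. K \<in> \<G> \<Longrightarrow> sq_int (lebesgue_on (interior K)) f"
  shows "sq_int (lebesgue_on \<Omega>) f"
  using f unfolding sq_int_def
  by (auto intro!: mesh_measurable[OF mesh \<Omega>] mesh_integral(1)[OF mesh \<Omega>])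

lemma sq_int_cell:
  assumes "cubical_mesh \<Omega> \<G>" "open \<Omega>" "K \<in> \<G>" "sq_int (lebesgue_on \<Omega>) f"
  shows "sq_int (lebesgue_on (interior K)) f"
  using assms by (intro sq_int_subset[OF assms(4)]) (auto dest: cubical_mesh_interior_subset)

lemma mesh_ip:
  assumes mesh: "cubical_mesh \<Omega> \<G>" and \<Omega>: "open \<Omega>"
    and f: "sq_int (lebesgue_on \<Omega>) f" and g: "sq_int (lebesgue_on \<Omega>) g"
  shows "ip (lebesgue_on \<Omega>) f g = (\<Sum>K\<in>\<G>. ip (lebesgue_on (interior K)) f g)"
  unfolding ip_def
  by (rule mesh_integral(2)[OF mesh \<Omega>]) (intro sq_int_integrable_inner sq_int_cell[OF mesh \<Omega>] f g)

lemma mesh_nrm: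
  assumes "cubical_mesh \<Omega> \<G>" "open \<Omega>" "sq_int (lebesgue_on \<Omega>) f"
  shows "(nrm (lebesgue_on \<Omega>) f)\<^sup>2 = (\<Sum>K\<in>\<G>. (nrm (lebesgue_on (interior K)) f)\<^sup>2)"
  unfolding nrm_square by (rule mesh_ip) (use assms in auto)

lemma sq_int_cong_AE:
  assumes f: "sq_int (lebesgue_on \<Xi>) f" and ae: "AE x in lebesgue_on \<Xi>. f x = g x" and \<Xi>: "open \<Xi>"
  shows "sq_int (lebesgue_on \<Xi>) g"
proof -
  have m: "g \<in> borel_measurable (lebesgue_on \<Xi>)"
    using f \<Xi> by (intro lebesgue_on_measurable_cong_AE[OF _ _ ae]) (auto simp: sq_int_def)
  moreover have "integrable (lebesgue_on \<Xi>) (\<lambda>x. (norm (g x))\<^sup>2)"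
    by (rule integrable_cong_AE_imp[where g = "\<lambda>x. (norm (f x))\<^sup>2"])
      (use f m ae in \<open>auto simp: sq_int_def elim: eventually_mono\<close>)
  ultimately show ?thesis by (simp add: sq_int_def)
qed

text \<open>
  The broken graph norm is the norm on the whole domain of a single pair-valued function.
\<close>

lemma dh_norm_eq:
  fixes \<G> :: "(real ^ 'n::{finite,linorder}) set set"
  assumes mesh: "cubical_mesh \<Omega> \<G>" and \<Omega>: "open \<Omega>"
    and u: "sq_int (lebesgue_on \<Omega>) u" and w: "sq_int (lebesgue_on \<Omega>) w"
    and ae: "\<And>K. K \<in> \<G> \<Longrightarrow> AE x in lebesgue_on (interior K). ext_d (interior K) k u x = w x"
  shows "dh_norm \<G> k u = nrm (lebesgue_on \<Omega>) (\<lambda>x. (u x, w x))"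
proof -
  have "(d_norm (interior K) k u)\<^sup>2 = (nrm (lebesgue_on (interior K)) (\<lambda>x. (u x, w x)))\<^sup>2" if K: "K \<in> \<G>" for K
  proof -
    have s: "sq_int (lebesgue_on (interior K)) u" "sq_int (lebesgue_on (interior K)) w"
      by (rule sq_int_cell[OF mesh \<Omega> K]; fact)+
    have "AE x in lebesgue_on (interior K). w x = ext_d (interior K) k u x"
      using ae[OF K] by eventually_elim simp
    then have "sq_int (lebesgue_on (interior K)) (ext_d (interior K) k u)"
      by (rule sq_int_cong_AE[OF s(2)]) simp
    then have "nrm (lebesgue_on (interior K)) (ext_d (interior K) k u) = nrm (lebesgue_on (interior K)) w"
      using s(2) ae[OF K] by (intro nrm_cong_AE) (auto simp: sq_int_def)
    then show ?thesis
      by (simp add: d_norm_def L2_norm_eq_nrm nrm_Pair_square s)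
  qed
  then have "dh_norm \<G> k u = sqrt ((nrm (lebesgue_on \<Omega>) (\<lambda>x. (u x, w x)))\<^sup>2)"
    unfolding dh_norm_def mesh_nrm[OF mesh \<Omega> sq_int_Pair[OF u w]] by simp
  then show ?thesis by (simp add: nrm_nonneg)
qed

lemma ext_d_h_cell:
  assumes "cubical_mesh \<Omega> \<G>" "K \<in> \<G>" "x \<in> interior K"
  shows "ext_d_h \<G> k u x = ext_d (interior K) k u x"
  unfolding ext_d_h_def by (rule mesh_sum_indicator[OF assms])

lemma AE_lebesgue_on_I: "open \<Xi> \<Longrightarrow> (\<And>x. x \<in> \<Xi> \<Longrightarrow> P x) \<Longrightarrow> AE x in lebesgue_on \<Xi>. P x"
  by (rule AE_I2) (simp add: space_restrict_space)

lemma ext_d_AE_Q_like: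
  assumes \<Xi>: "open \<Xi>" "bounded \<Xi>" and q: "Q_like k q" and ae: "AE x in lebesgue_on \<Xi>. u x = q x"
  shows "u \<in> L2_forms \<Xi> k" "is_weak_d \<Xi> k u (cell_d k q)" "cell_d k q \<in> L2_forms \<Xi> (k + 1)"
    "AE x in lebesgue_on \<Xi>. ext_d \<Xi> k u x = cell_d k q x"
proof -
  have ae': "AE x in lebesgue_on \<Xi>. q x = u x" using ae by eventually_elim simp
  have qL: "q \<in> L2_forms \<Xi> k" by (rule Q_like_L2_forms[OF q \<Xi>])
  then have "sq_int (lebesgue_on \<Xi>) u" using sq_int_cong_AE[OF _ ae' \<Xi>(1)] by (simp add: L2_forms_iff)
  moreover have "AE x in lebesgue_on \<Xi>. u x \<in> alt_forms k"
    using ae by eventually_elim (use q in \<open>simp add: Q_like_def\<close>)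
  ultimately show "u \<in> L2_forms \<Xi> k" by (simp add: L2_forms_iff)
  show w: "is_weak_d \<Xi> k u (cell_d k q)"
    by (rule is_weak_d_cong_AE[OF is_weak_d_cell_d[OF q \<Xi>] ae' \<Xi>(1)]) (use qL in \<open>simp add: L2_forms_def\<close>)
  show L: "cell_d k q \<in> L2_forms \<Xi> (k + 1)" by (rule Q_like_L2_forms[OF cell_d_Q_like[OF q] \<Xi>])
  show "AE x in lebesgue_on \<Xi>. ext_d \<Xi> k u x = cell_d k q x" by (rule ext_d_eqI(3)[OF \<Xi> L w])
qed

lemma bounded_cell: "cubical_mesh \<Omega> \<G> \<Longrightarrow> bounded \<Omega> \<Longrightarrow> K \<in> \<G> \<Longrightarrow> bounded (interior K)"
  by (rule bounded_subset[OF _ cubical_mesh_interior_subset])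

lemma Ph_space_cell:
  fixes \<G> :: "(real ^ 'n::{finite,linorder}) set set"
  assumes mesh: "cubical_mesh \<Omega> \<G>" and \<Omega>: "open \<Omega>" "bounded \<Omega>" and u: "u \<in> Ph_space \<G> k" and K: "K \<in> \<G>"
  obtains q where "q \<in> whitney_forms k" "AE x in lebesgue_on (interior K). u x = q x"
    "AE x in lebesgue_on (interior K). ext_d_h \<G> k u x = cell_d k q x"
proof -
  obtain q where q: "q \<in> whitney_forms k" and ae: "AE x in lebesgue_on (interior K). u x = q x"
    using u K by (auto simp: Ph_space_def piecewise_in_def)
  have "AE x in lebesgue_on (interior K). ext_d (interior K) k u x = cell_d k q x"
    by (rule ext_d_AE_Q_like(4)[OF open_interior bounded_cell[OF mesh \<Omega>(2) K] whitney_Q_like[OF q] ae])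
  moreover have "AE x in lebesgue_on (interior K). ext_d_h \<G> k u x = ext_d (interior K) k u x"
    using ext_d_h_cell[OF mesh K] by (intro AE_lebesgue_on_I) auto
  ultimately have "AE x in lebesgue_on (interior K). ext_d_h \<G> k u x = cell_d k q x"
    by eventually_elim simp
  with q ae that show ?thesis by blast
qed

lemma Ph_space_sq_int:
  fixes \<G> :: "(real ^ 'n::{finite,linorder}) set set"
  assumes mesh: "cubical_mesh \<Omega> \<G>" and \<Omega>: "open \<Omega>" "bounded \<Omega>" and u: "u \<in> Ph_space \<G> k"
  shows "sq_int (lebesgue_on \<Omega>) u" "sq_int (lebesgue_on \<Omega>) (ext_d_h \<G> k u)"
proof -
  have "sq_int (lebesgue_on (interior K)) u \<and> sq_int (lebesgue_on (interior K)) (ext_d_h \<G> k u)"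
    if K: "K \<in> \<G>" for K
  proof -
    obtain q where q: "q \<in> whitney_forms k" and ae: "AE x in lebesgue_on (interior K). u x = q x"
      "AE x in lebesgue_on (interior K). ext_d_h \<G> k u x = cell_d k q x"
      using Ph_space_cell[OF mesh \<Omega> u K] .
    have b: "open (interior K)" "bounded (interior K)" using bounded_cell[OF mesh \<Omega>(2) K] by auto
    have Q: "Q_like k q" by (rule whitney_Q_like[OF q])
    have ae': "AE x in lebesgue_on (interior K). q x = u x"
      "AE x in lebesgue_on (interior K). cell_d k q x = ext_d_h \<G> k u x"
      using ae by (auto elim: eventually_mono)
    have "sq_int (lebesgue_on (interior K)) q" "sq_int (lebesgue_on (interior K)) (cell_d k q)"
      using Q_like_L2_forms[OF Q b] Q_like_L2_forms[OF cell_d_Q_like[OF Q] b] by (auto simp: L2_forms_iff)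
    from sq_int_cong_AE[OF this(1) ae'(1) b(1)] sq_int_cong_AE[OF this(2) ae'(2) b(1)]
    show ?thesis by simp
  qed
  then show "sq_int (lebesgue_on \<Omega>) u" "sq_int (lebesgue_on \<Omega>) (ext_d_h \<G> k u)"
    by (auto intro: mesh_sq_int[OF mesh \<Omega>(1)])
qed

lemma dh_norm_H_Ph:
  fixes \<G> :: "(real ^ 'n::{finite,linorder}) set set"
  assumes mesh: "cubical_mesh \<Omega> \<G>" and \<Omega>: "open \<Omega>" "bounded \<Omega>"
    and \<omega>: "\<omega> \<in> H_space \<Omega> k" and u: "u \<in> Ph_space \<G> k"
  shows "dh_norm \<G> k (\<lambda>x. \<omega> x - u x) =
    nrm (lebesgue_on \<Omega>) (\<lambda>x. (\<omega> x - u x, ext_d \<Omega> k \<omega> x - ext_d_h \<G> k u x))"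
proof (rule dh_norm_eq[OF mesh \<Omega>(1)])
  note H = H_space_ext_d[OF \<omega> \<Omega>]
  note s = Ph_space_sq_int[OF mesh \<Omega> u]
  show "sq_int (lebesgue_on \<Omega>) (\<lambda>x. \<omega> x - u x)" "sq_int (lebesgue_on \<Omega>) (\<lambda>x. ext_d \<Omega> k \<omega> x - ext_d_h \<G> k u x)"
    using H s by (auto intro: sq_int_diff simp: L2_forms_iff)
  fix K assume K: "K \<in> \<G>"
  obtain q where q: "q \<in> whitney_forms k" and ae: "AE x in lebesgue_on (interior K). u x = q x"
    "AE x in lebesgue_on (interior K). ext_d_h \<G> k u x = cell_d k q x"
    using Ph_space_cell[OF mesh \<Omega> u K] .
  have b: "open (interior K)" "bounded (interior K)" using bounded_cell[OF mesh \<Omega>(2) K] by auto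
  note sub = \<Omega>(1) b(1) cubical_mesh_interior_subset[OF mesh K]
  note c = ext_d_AE_Q_like[OF b whitney_Q_like[OF q] ae(1)]
  note L = L2_forms_subset[OF H(1) sub] L2_forms_subset[OF H(2) sub]
  have "is_weak_d (interior K) k (\<lambda>x. \<omega> x - u x) (\<lambda>x. ext_d \<Omega> k \<omega> x - cell_d k q x)"
    by (rule is_weak_d_diff[OF is_weak_d_subset[OF H(3) sub] c(2) b]) (use L c in \<open>auto simp: L2_forms_iff\<close>)
  from ext_d_eqI(3)[OF b L2_forms_diff[OF L(2) c(3)] this] ae(2)
  show "AE x in lebesgue_on (interior K). ext_d (interior K) k (\<lambda>x. \<omega> x - u x) x = ext_d \<Omega> k \<omega> x - ext_d_h \<G> k u x"
    by eventually_elim simp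
qed

lemma d_norm_diff_eq:
  fixes \<omega> :: "'n::{finite,linorder} form"
  assumes \<omega>: "\<omega> \<in> H_space \<Omega> k" "\<eta> \<in> H_space \<Omega> k" and \<Omega>: "open \<Omega>" "bounded \<Omega>"
  shows "d_norm \<Omega> k (\<lambda>x. \<omega> x - \<eta> x) = nrm (lebesgue_on \<Omega>) (\<lambda>x. (\<omega> x - \<eta> x, ext_d \<Omega> k \<omega> x - ext_d \<Omega> k \<eta> x))"
proof -
  note H = H_space_ext_d[OF \<omega>(1) \<Omega>] H_space_ext_d[OF \<omega>(2) \<Omega>]
  have s: "sq_int (lebesgue_on \<Omega>) \<omega>" "sq_int (lebesgue_on \<Omega>) \<eta>"
    "sq_int (lebesgue_on \<Omega>) (ext_d \<Omega> k \<omega>)" "sq_int (lebesgue_on \<Omega>) (ext_d \<Omega> k \<eta>)"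
    using H by (auto simp: L2_forms_iff)
  have "is_weak_d \<Omega> k (\<lambda>x. \<omega> x - \<eta> x) (\<lambda>x. ext_d \<Omega> k \<omega> x - ext_d \<Omega> k \<eta> x)"
    by (rule is_weak_d_diff[OF H(3,6) \<Omega> s(1,3,2,4)])
  note e = ext_d_eqI[OF \<Omega> L2_forms_diff[OF H(2,5)] this]
  have "nrm (lebesgue_on \<Omega>) (ext_d \<Omega> k (\<lambda>x. \<omega> x - \<eta> x)) = nrm (lebesgue_on \<Omega>) (\<lambda>x. ext_d \<Omega> k \<omega> x - ext_d \<Omega> k \<eta> x)"
    using e(1,3) sq_int_diff[OF s(3,4)] by (intro nrm_cong_AE) (auto simp: L2_forms_def sq_int_def)
  then show ?thesis
    unfolding d_norm_def L2_norm_eq_nrm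
    by (simp add: nrm_Pair_square[OF sq_int_diff[OF s(1,2)] sq_int_diff[OF s(3,4)], symmetric] nrm_nonneg)
qed

section \<open>Projection into the weakly conforming space\<close>

lemma sq_int_L2_forms: "\<omega> \<in> L2_forms \<Xi> k \<Longrightarrow> sq_int (lebesgue_on \<Xi>) \<omega>"
  by (simp add: L2_forms_iff)

text \<open>
  The projection does not change the two terms of the weak continuity condition.
\<close>

lemma integral_box_whitney_proj:
  fixes q :: "'n::{finite,linorder} form"
  assumes q: "Q_like k q" and m: "Qstar_like (k + 1) m" and c: "c = (1/2) *\<^sub>R (a + b)"
  shows "ip (lebesgue_on (box a b)) (cell_d k (whitney_proj k c q)) m = ip (lebesgue_on (box a b)) (cell_d k q) m"
    "ip (lebesgue_on (box a b)) (whitney_proj k c q) (cell_delta k m) = ip (lebesgue_on (box a b)) q (cell_delta k m)"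
proof -
  note J = whitney_proj_in[OF q, of c]
  note JQ = whitney_Q_like[OF J(1)]
  show "ip (lebesgue_on (box a b)) (cell_d k (whitney_proj k c q)) m = ip (lebesgue_on (box a b)) (cell_d k q) m"
    by (simp add: integral_inner_Q_Qstar[OF cell_d_Q_like[OF JQ] m c] integral_inner_Q_Qstar[OF cell_d_Q_like[OF q] m c] J(2)
        del: One_nat_def)
  show "ip (lebesgue_on (box a b)) (whitney_proj k c q) (cell_delta k m) = ip (lebesgue_on (box a b)) q (cell_delta k m)"
    by (simp add: integral_inner_Q_Qstar[OF JQ cell_delta_Qstar_like[OF m] c] integral_inner_Q_Qstar[OF q cell_delta_Qstar_like[OF m] c] J(3))
qed

lemma codiff_cell:
  fixes \<mu> :: "'n::{finite,linorder} form"
  assumes mesh: "cubical_mesh \<Omega> \<G>" and \<Omega>: "open \<Omega>" "bounded \<Omega>" and k: "k < CARD('n)"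
    and \<mu>: "\<mu> \<in> VQstar0_space \<Omega> \<G> (k + 1)" and K: "K \<in> \<G>"
  obtains m where "Qstar_like (k + 1) m" "AE x in lebesgue_on (interior K). \<mu> x = m x"
    "AE x in lebesgue_on (interior K). codiff \<Omega> (k + 1) \<mu> x = cell_delta k m x"
proof -
  obtain m where m: "m \<in> Qstar_forms (k + 1)" and ae: "AE x in lebesgue_on (interior K). \<mu> x = m x"
    using \<mu> K by (auto simp: VQstar0_space_def piecewise_in_def)
  have mQ: "Qstar_like (k + 1) m" by (rule Qstar_forms_Qstar_like[OF m]) (use k in simp)
  have b: "open (interior K)" "bounded (interior K)" using bounded_cell[OF mesh \<Omega>(2) K] by auto
  note sub = \<Omega>(1) b(1) cubical_mesh_interior_subset[OF mesh K]
  have \<mu>H: "\<mu> \<in> Hstar_space \<Omega> (k + 1)" using \<mu> by (auto simp: VQstar0_space_def Hstar0_space_def)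
  note H = Hstar_space_codiff[OF \<mu>H \<Omega> k]
  have "AE x in lebesgue_on (interior K). codiff \<Omega> (k + 1) \<mu> x = cell_delta k m x"
  proof (rule is_weak_delta_unique[OF b is_weak_delta_subset[OF H(3) sub] is_weak_delta_cell_delta[OF mQ b] _ _ ae])
    show "codiff \<Omega> (k + 1) \<mu> \<in> L2_forms (interior K) k" by (rule L2_forms_subset[OF H(2) sub])
    show "cell_delta k m \<in> L2_forms (interior K) k"
      by (rule Qstar_like_L2_forms[OF cell_delta_Qstar_like[OF mQ] b])
    show "\<mu> \<in> borel_measurable (lebesgue_on (interior K))"
      using L2_forms_subset[OF H(1) sub] by (simp add: L2_forms_def)
  qed
  with mQ ae that show ?thesis by blast
qed

lemma VQ_space_cell:
  fixes \<eta> :: "'n::{finite,linorder} form"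
  assumes mesh: "cubical_mesh \<Omega> \<G>" and \<Omega>: "open \<Omega>" "bounded \<Omega>"
    and \<eta>: "\<eta> \<in> VQ_space \<Omega> \<G> k" and K: "K \<in> \<G>"
  obtains q where "Q_like k q" "AE x in lebesgue_on (interior K). \<eta> x = q x"
    "AE x in lebesgue_on (interior K). ext_d \<Omega> k \<eta> x = cell_d k q x"
proof -
  obtain q where q: "q \<in> Q_forms k" and ae: "AE x in lebesgue_on (interior K). \<eta> x = q x"
    using \<eta> K by (auto simp: VQ_space_def piecewise_in_def)
  have qQ: "Q_like k q" by (rule Q_forms_Q_like[OF q])
  have b: "open (interior K)" "bounded (interior K)" using bounded_cell[OF mesh \<Omega>(2) K] by auto
  note sub = \<Omega>(1) b(1) cubical_mesh_interior_subset[OF mesh K]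
  have \<eta>H: "\<eta> \<in> H_space \<Omega> k" using \<eta> by (simp add: VQ_space_def)
  note H = H_space_ext_d[OF \<eta>H \<Omega>]
  have "AE x in lebesgue_on (interior K). ext_d (interior K) k \<eta> x = ext_d \<Omega> k \<eta> x"
    by (rule ext_d_eqI(3)[OF b L2_forms_subset[OF H(2) sub] is_weak_d_subset[OF H(3) sub]])
  with ext_d_AE_Q_like(4)[OF b qQ ae]
  have "AE x in lebesgue_on (interior K). ext_d \<Omega> k \<eta> x = cell_d k q x" by eventually_elim simp
  with qQ ae that show ?thesis by blast
qed

lemma ip_cong_AE_lebesgue_on:
  assumes "sq_int (lebesgue_on \<Xi>) f" "sq_int (lebesgue_on \<Xi>) g" and \<Xi>: "open \<Xi>"
    and ae: "AE x in lebesgue_on \<Xi>. f x = f' x" "AE x in lebesgue_on \<Xi>. g x = g' x"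
  shows "ip (lebesgue_on \<Xi>) f g = ip (lebesgue_on \<Xi>) f' g'"
  using assms sq_int_cong_AE[OF assms(1) ae(1) \<Xi>] sq_int_cong_AE[OF assms(2) ae(2) \<Xi>]
  by (intro ip_cong_AE) (auto simp: sq_int_def)

lemma nrm_cong_AE_lebesgue_on:
  assumes "sq_int (lebesgue_on \<Xi>) f" and \<Xi>: "open \<Xi>" and ae: "AE x in lebesgue_on \<Xi>. f x = g x"
  shows "nrm (lebesgue_on \<Xi>) f = nrm (lebesgue_on \<Xi>) g"
  using assms(1) sq_int_cong_AE[OF assms(1) ae \<Xi>] ae by (intro nrm_cong_AE) (auto simp: sq_int_def)

lemma Wdef_space_orthogonal:
  fixes \<G> :: "(real ^ 'n::{finite,linorder}) set set"
  assumes mesh: "cubical_mesh \<Omega> \<G>" and \<Omega>: "open \<Omega>" "bounded \<Omega>" and k: "k < CARD('n)"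
    and v: "v \<in> Ph_space \<G> k" and \<psi>: "\<psi> \<in> Hstar_space \<Omega> (k + 1)"
  shows "(\<Sum>K\<in>\<G>. L2_inner (interior K) (ext_d (interior K) k v) \<psi>
      - L2_inner (interior K) v (codiff \<Omega> (k + 1) \<psi>)) =
    ip (lebesgue_on \<Omega>) (ext_d_h \<G> k v) \<psi> - ip (lebesgue_on \<Omega>) v (codiff \<Omega> (k + 1) \<psi>)"
proof -
  note s = Ph_space_sq_int[OF mesh \<Omega> v]
  note H = Hstar_space_codiff[OF \<psi> \<Omega> k]
  have "ip (lebesgue_on (interior K)) (ext_d (interior K) k v) \<psi> = ip (lebesgue_on (interior K)) (ext_d_h \<G> k v) \<psi>"
    if "K \<in> \<G>" for K
    unfolding ip_def
    by (rule Bochner_Integration.integral_cong) (use ext_d_h_cell[OF mesh that] in \<open>auto simp: space_restrict_space\<close>)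
  then show ?thesis
    by (simp add: L2_inner_eq_ip sum_subtractf mesh_ip[OF mesh \<Omega>(1) s(2) sq_int_L2_forms[OF H(1)]]
        mesh_ip[OF mesh \<Omega>(1) s(1) sq_int_L2_forms[OF H(2)]] del: One_nat_def)
qed

text \<open>
  The cellwise projection of a conforming form satisfies the weak continuity condition, and it is
  quasi-optimal among the piecewise Whitney forms.
\<close>

lemma VQ_projection:
  fixes \<eta> :: "'n::{finite,linorder} form"
  assumes mesh: "cubical_mesh \<Omega> \<G>" and \<Omega>: "open \<Omega>" "bounded \<Omega>" and k: "k < CARD('n)"
    and R: "\<And>x. x \<in> \<Omega> \<Longrightarrow> norm x \<le> R" and \<eta>: "\<eta> \<in> VQ_space \<Omega> \<G> k"
  obtains v where "v \<in> Wdef_space \<Omega> \<G> k"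
    "\<forall>u\<in>Ph_space \<G> k.
      nrm (lebesgue_on \<Omega>) (\<lambda>x. (\<eta> x - v x, ext_d \<Omega> k \<eta> x - ext_d_h \<G> k v x))
        \<le> sqrt (6 + 4 * (real (CARD('n set) * CARD('n)) * (2 * R))\<^sup>2) *
          nrm (lebesgue_on \<Omega>) (\<lambda>x. (\<eta> x - u x, ext_d \<Omega> k \<eta> x - ext_d_h \<G> k u x))"
proof -
  let ?M = "\<lambda>K. lebesgue_on (interior K)"
  define P where "P K q a b \<longleftrightarrow> Q_like k q \<and> (AE x in ?M K. \<eta> x = q x) \<and>
      (AE x in ?M K. ext_d \<Omega> k \<eta> x = cell_d k q x) \<and>
      interior K = box a b \<and> box a b \<noteq> {} \<and> box a b \<subseteq> \<Omega>" for K q a b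
  have "\<exists>q a b. P K q a b" if K: "K \<in> \<G>" for K
  proof -
    obtain q where q: "Q_like k q" "AE x in ?M K. \<eta> x = q x" "AE x in ?M K. ext_d \<Omega> k \<eta> x = cell_d k q x"
      using VQ_space_cell[OF mesh \<Omega> \<eta> K] .
    obtain a b where "interior K = box a b" "box a b \<noteq> {}" "box a b \<subseteq> \<Omega>"
      using cubical_mesh_cell[OF mesh K] .
    with q have "P K q a b" unfolding P_def by simp
    then show ?thesis by blast
  qed
  then obtain q a b where P: "\<And>K. K \<in> \<G> \<Longrightarrow> P K (q K) (a K) (b K)" by metis
  have q: "Q_like k (q K)" "AE x in ?M K. \<eta> x = q K x" "AE x in ?M K. ext_d \<Omega> k \<eta> x = cell_d k (q K) x"
    "interior K = box (a K) (b K)" "box (a K) (b K) \<noteq> {}" "box (a K) (b K) \<subseteq> \<Omega>" if "K \<in> \<G>" for K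
    using P[OF that] unfolding P_def by auto
  define c where "c K = (1/2) *\<^sub>R (a K + b K)" for K
  define J where "J K = whitney_proj k (c K) (q K)" for K
  define v where "v x = (\<Sum>K\<in>\<G>. indicator (interior K) x *\<^sub>R J K x)" for x
  have J: "J K \<in> whitney_forms k" "cell_d k (J K) x = cell_d k (q K) (c K)" if "K \<in> \<G>" for K x
    unfolding J_def using whitney_proj_in[OF q(1)[OF that]] by auto
  note JQ = whitney_Q_like[OF J(1)]
  have b: "open (interior K)" "bounded (interior K)" if "K \<in> \<G>" for K
    using bounded_cell[OF mesh \<Omega>(2) that] by auto
  have vJ: "AE x in ?M K. v x = J K x" if "K \<in> \<G>" for K
    using mesh_sum_indicator[OF mesh that] by (intro AE_lebesgue_on_I) (auto simp: v_def)
  have vPh: "v \<in> Ph_space \<G> k"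
    unfolding Ph_space_def piecewise_in_def using J(1) vJ by blast
  have dvJ: "AE x in ?M K. ext_d_h \<G> k v x = cell_d k (J K) x" if "K \<in> \<G>" for K
  proof -
    have "AE x in ?M K. ext_d_h \<G> k v x = ext_d (interior K) k v x"
      using ext_d_h_cell[OF mesh that] by (intro AE_lebesgue_on_I) auto
    with ext_d_AE_Q_like(4)[OF b[OF that] JQ[OF that] vJ[OF that]] show ?thesis
      by eventually_elim simp
  qed
  note sv = Ph_space_sq_int[OF mesh \<Omega> vPh]
  have \<eta>H: "\<eta> \<in> H_space \<Omega> k" using \<eta> by (simp add: VQ_space_def)
  note H = H_space_ext_d[OF \<eta>H \<Omega>]
  note s\<eta> = sq_int_L2_forms[OF H(1)] sq_int_L2_forms[OF H(2)]
  have W: "v \<in> Wdef_space \<Omega> \<G> k"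
    unfolding Wdef_space_def
  proof (intro CollectI conjI ballI vPh)
    fix \<mu> assume \<mu>: "\<mu> \<in> VQstar0_space \<Omega> \<G> (k + 1)"
    have \<mu>0: "\<mu> \<in> Hstar0_space \<Omega> (k + 1)" using \<mu> by (simp add: VQstar0_space_def)
    then have \<mu>H: "\<mu> \<in> Hstar_space \<Omega> (k + 1)" by (simp add: Hstar0_space_def)
    note H' = Hstar_space_codiff[OF \<mu>H \<Omega> k]
    note s\<mu> = sq_int_L2_forms[OF H'(1)] sq_int_L2_forms[OF H'(2)]
    have "ip (?M K) (ext_d_h \<G> k v) \<mu> = ip (?M K) (ext_d \<Omega> k \<eta>) \<mu> \<and>
        ip (?M K) v (codiff \<Omega> (k + 1) \<mu>) = ip (?M K) \<eta> (codiff \<Omega> (k + 1) \<mu>)" if K: "K \<in> \<G>" for K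
    proof -
      obtain m where m: "Qstar_like (k + 1) m" and ae: "AE x in ?M K. \<mu> x = m x"
        "AE x in ?M K. codiff \<Omega> (k + 1) \<mu> x = cell_delta k m x"
        using codiff_cell[OF mesh \<Omega> k \<mu> K] .
      note sc = sq_int_cell[OF mesh \<Omega>(1) K]
      note e = ip_cong_AE_lebesgue_on[OF _ _ b(1)[OF K]]
      note I = integral_box_whitney_proj[OF q(1)[OF K] m c_def]
      have "ip (?M K) (ext_d_h \<G> k v) \<mu> = ip (?M K) (cell_d k (J K)) m"
        by (rule e[OF sc[OF sv(2)] sc[OF s\<mu>(1)] dvJ[OF K] ae(1)])
      also have "\<dots> = ip (?M K) (cell_d k (q K)) m"
        unfolding q(4)[OF K] J_def by (rule I(1))
      also have "\<dots> = ip (?M K) (ext_d \<Omega> k \<eta>) \<mu>"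
        by (rule e[OF sc[OF s\<eta>(2)] sc[OF s\<mu>(1)] q(3)[OF K] ae(1), symmetric])
      finally have 1: "ip (?M K) (ext_d_h \<G> k v) \<mu> = ip (?M K) (ext_d \<Omega> k \<eta>) \<mu>" .
      have "ip (?M K) v (codiff \<Omega> (k + 1) \<mu>) = ip (?M K) (J K) (cell_delta k m)"
        by (rule e[OF sc[OF sv(1)] sc[OF s\<mu>(2)] vJ[OF K] ae(2)])
      also have "\<dots> = ip (?M K) (q K) (cell_delta k m)"
        unfolding q(4)[OF K] J_def by (rule I(2))
      also have "\<dots> = ip (?M K) \<eta> (codiff \<Omega> (k + 1) \<mu>)"
        by (rule e[OF sc[OF s\<eta>(1)] sc[OF s\<mu>(2)] q(2)[OF K] ae(2), symmetric])
      finally show ?thesis using 1 by simp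
    qed
    then have "ip (lebesgue_on \<Omega>) (ext_d_h \<G> k v) \<mu> = ip (lebesgue_on \<Omega>) (ext_d \<Omega> k \<eta>) \<mu>"
      "ip (lebesgue_on \<Omega>) v (codiff \<Omega> (k + 1) \<mu>) = ip (lebesgue_on \<Omega>) \<eta> (codiff \<Omega> (k + 1) \<mu>)"
      unfolding mesh_ip[OF mesh \<Omega>(1) sv(2) s\<mu>(1)] mesh_ip[OF mesh \<Omega>(1) s\<eta>(2) s\<mu>(1)]
        mesh_ip[OF mesh \<Omega>(1) sv(1) s\<mu>(2)] mesh_ip[OF mesh \<Omega>(1) s\<eta>(1) s\<mu>(2)]
      by (auto intro: sum.cong)
    then show "(\<Sum>K\<in>\<G>. L2_inner (interior K) (ext_d (interior K) k v) \<mu>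
        - L2_inner (interior K) v (codiff \<Omega> (k + 1) \<mu>)) = 0"
      unfolding Wdef_space_orthogonal[OF mesh \<Omega> k vPh \<mu>H]
      using adjoint_Hstar0[OF \<eta>H \<mu>0 \<Omega> k] by simp
  qed
  define L where "L = real (CARD('n set) * CARD('n)) * (2 * R)"
  have "nrm (lebesgue_on \<Omega>) (\<lambda>x. (\<eta> x - v x, ext_d \<Omega> k \<eta> x - ext_d_h \<G> k v x))
      \<le> sqrt (6 + 4 * L\<^sup>2) * nrm (lebesgue_on \<Omega>) (\<lambda>x. (\<eta> x - u x, ext_d \<Omega> k \<eta> x - ext_d_h \<G> k u x))"
    if u: "u \<in> Ph_space \<G> k" for u
  proof -
    note su = Ph_space_sq_int[OF mesh \<Omega> u]
    have s1: "sq_int (lebesgue_on \<Omega>) (\<lambda>x. (\<eta> x - v x, ext_d \<Omega> k \<eta> x - ext_d_h \<G> k v x))"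
      and s2: "sq_int (lebesgue_on \<Omega>) (\<lambda>x. (\<eta> x - u x, ext_d \<Omega> k \<eta> x - ext_d_h \<G> k u x))"
      by (intro sq_int_Pair sq_int_diff s\<eta> sv su)+
    have cell: "(nrm (?M K) (\<lambda>x. (\<eta> x - v x, ext_d \<Omega> k \<eta> x - ext_d_h \<G> k v x)))\<^sup>2
        \<le> (6 + 4 * L\<^sup>2) * (nrm (?M K) (\<lambda>x. (\<eta> x - u x, ext_d \<Omega> k \<eta> x - ext_d_h \<G> k u x)))\<^sup>2" if K: "K \<in> \<G>" for K
    proof -
      obtain m where m: "m \<in> whitney_forms k" and ae: "AE x in ?M K. u x = m x"
        "AE x in ?M K. ext_d_h \<G> k u x = cell_d k m x"
        using Ph_space_cell[OF mesh \<Omega> u K] .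
      \<comment> \<open>The projection reproduces \<open>m\<close>, so \<open>p\<close> and \<open>q K\<close> have the same projection error.\<close>
      define p where "p x = q K x - m x" for x
      have pQ: "Q_like k p" unfolding p_def[abs_def] by (rule Q_like_diff[OF q(1)[OF K] whitney_Q_like[OF m]])
      have dp: "cell_d k p x = cell_d k (q K) x - cell_d k m x" for x
        unfolding p_def[abs_def] by (rule cell_d_diff)
      have dm: "cell_d k m x = cell_d k m (c K)" for x
        using whitney_proj_in(2)[OF whitney_Q_like[OF m], of "c K" x] unfolding whitney_proj_whitney[OF m] .
      have pJ: "p x - whitney_proj k (c K) p x = q K x - J K x" for x
        unfolding p_def[abs_def] whitney_proj_diff J_def by (simp add: whitney_proj_whitney[OF m])
      have dpJ: "cell_d k p x - cell_d k p (c K) = cell_d k (q K) x - cell_d k (J K) x" for x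
        using dm[of x] by (simp add: dp J(2)[OF K])
      note n = nrm_cong_AE_lebesgue_on[OF sq_int_cell[OF mesh \<Omega>(1) K] b(1)[OF K]]
      have "nrm (?M K) (\<lambda>x. (\<eta> x - v x, ext_d \<Omega> k \<eta> x - ext_d_h \<G> k v x)) =
          nrm (?M K) (\<lambda>x. (p x - whitney_proj k (c K) p x, cell_d k p x - cell_d k p (c K)))"
        unfolding pJ dpJ
        by (rule n[OF s1]) (use q(2,3)[OF K] vJ[OF K] dvJ[OF K] in \<open>eventually_elim; simp\<close>)
      then have "(nrm (?M K) (\<lambda>x. (\<eta> x - v x, ext_d \<Omega> k \<eta> x - ext_d_h \<G> k v x)))\<^sup>2 =
          (LINT x|?M K. (norm (p x - whitney_proj k (c K) p x))\<^sup>2 + (norm (cell_d k p x - cell_d k p (c K)))\<^sup>2)"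
        by (simp add: nrm_square_integral norm_Pair)
      also have "\<dots> \<le> (6 + 4 * L\<^sup>2) * (LINT x|?M K. (norm (p x))\<^sup>2 + (norm (cell_d k p x))\<^sup>2)"
        unfolding q(4)[OF K] L_def
      proof (rule whitney_proj_estimate[OF pQ c_def])
        fix x assume x: "x \<in> box (a K) (b K)"
        have "a K $ i < b K $ i" for i using x by (auto simp: mem_box_cart intro: less_trans)
        then have "c K \<in> box (a K) (b K)" by (simp add: c_def mem_box_cart field_simps)
        then have "norm (c K) \<le> R" "norm x \<le> R" using R q(6)[OF K] x by blast+
        then show "norm (x - c K) \<le> 2 * R" using norm_triangle_ineq4[of x "c K"] by linarith
      qed
      also have "(LINT x|?M K. (norm (p x))\<^sup>2 + (norm (cell_d k p x))\<^sup>2) = (nrm (?M K) (\<lambda>x. (p x, cell_d k p x)))\<^sup>2"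
        by (simp add: nrm_square_integral norm_Pair)
      also have "nrm (?M K) (\<lambda>x. (p x, cell_d k p x)) = nrm (?M K) (\<lambda>x. (\<eta> x - u x, ext_d \<Omega> k \<eta> x - ext_d_h \<G> k u x))"
        unfolding dp p_def
        by (rule n[OF s2, symmetric]) (use q(2,3)[OF K] ae in \<open>eventually_elim; simp\<close>)
      finally show ?thesis .
    qed
    have "(nrm (lebesgue_on \<Omega>) (\<lambda>x. (\<eta> x - v x, ext_d \<Omega> k \<eta> x - ext_d_h \<G> k v x)))\<^sup>2
        \<le> (6 + 4 * L\<^sup>2) * (nrm (lebesgue_on \<Omega>) (\<lambda>x. (\<eta> x - u x, ext_d \<Omega> k \<eta> x - ext_d_h \<G> k u x)))\<^sup>2"
      unfolding mesh_nrm[OF mesh \<Omega>(1) s1] mesh_nrm[OF mesh \<Omega>(1) s2] sum_distrib_left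
      by (rule sum_mono) (rule cell)
    also have "\<dots> = (sqrt (6 + 4 * L\<^sup>2) * nrm (lebesgue_on \<Omega>) (\<lambda>x. (\<eta> x - u x, ext_d \<Omega> k \<eta> x - ext_d_h \<G> k u x)))\<^sup>2"
      by (simp add: power_mult_distrib)
    finally show ?thesis by (rule power2_le_imp_le) (simp add: nrm_nonneg)
  qed
  then show ?thesis unfolding L_def by (intro that[OF W] ballI)
qed

text \<open>
  The sign of the first component is chosen so that the inner product with \<open>(v, d\<^sub>h v)\<close> is the
  consistency error.
\<close>

lemma delta_norm_eq:
  fixes \<mu> :: "'n::{finite,linorder} form"
  assumes \<mu>: "\<mu> \<in> Hstar_space \<Omega> (k + 1)" "\<nu> \<in> Hstar_space \<Omega> (k + 1)"
    and \<Omega>: "open \<Omega>" "bounded \<Omega>" and k: "k < CARD('n)"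
  shows "delta_norm \<Omega> (k + 1) (\<lambda>x. \<mu> x - \<nu> x) =
    nrm (lebesgue_on \<Omega>) (\<lambda>x. (codiff \<Omega> (k + 1) \<nu> x - codiff \<Omega> (k + 1) \<mu> x, \<mu> x - \<nu> x))"
proof -
  note H = Hstar_space_codiff[OF \<mu>(1) \<Omega> k] Hstar_space_codiff[OF \<mu>(2) \<Omega> k]
  note s = H(1,2,4,5)[THEN sq_int_L2_forms]
  note d = codiff_diff[OF \<mu> \<Omega> k]
  have "nrm (lebesgue_on \<Omega>) (codiff \<Omega> (k + 1) (\<lambda>x. \<mu> x - \<nu> x)) =
      nrm (lebesgue_on \<Omega>) (\<lambda>x. codiff \<Omega> (k + 1) \<mu> x - codiff \<Omega> (k + 1) \<nu> x)"
    using Hstar_space_codiff(2)[OF d(1) \<Omega> k] d(2) sq_int_L2_forms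
    by (intro nrm_cong_AE_lebesgue_on \<Omega>) auto
  also have "\<dots> = nrm (lebesgue_on \<Omega>) (\<lambda>x. codiff \<Omega> (k + 1) \<nu> x - codiff \<Omega> (k + 1) \<mu> x)"
    by (simp add: nrm_def norm_minus_commute)
  finally have e: "nrm (lebesgue_on \<Omega>) (codiff \<Omega> (k + 1) (\<lambda>x. \<mu> x - \<nu> x)) = \<dots>" .
  have "nrm (lebesgue_on \<Omega>) (\<lambda>x. (codiff \<Omega> (k + 1) \<nu> x - codiff \<Omega> (k + 1) \<mu> x, \<mu> x - \<nu> x)) =
      sqrt ((nrm (lebesgue_on \<Omega>) (\<lambda>x. (codiff \<Omega> (k + 1) \<nu> x - codiff \<Omega> (k + 1) \<mu> x, \<mu> x - \<nu> x)))\<^sup>2)"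
    by (simp add: nrm_nonneg)
  also have "\<dots> = sqrt ((nrm (lebesgue_on \<Omega>) (\<lambda>x. \<mu> x - \<nu> x))\<^sup>2 +
      (nrm (lebesgue_on \<Omega>) (\<lambda>x. codiff \<Omega> (k + 1) \<nu> x - codiff \<Omega> (k + 1) \<mu> x))\<^sup>2)"
    unfolding nrm_Pair_square[OF sq_int_diff[OF s(4,2)] sq_int_diff[OF s(1,3)]] by (simp only: add.commute)
  finally show ?thesis unfolding delta_norm_def L2_norm_eq_nrm e ..
qed

section \<open>The error estimate\<close>

lemma quadratic_bound:
  fixes e a c :: real
  assumes le: "e\<^sup>2 \<le> e * (a + c) + c * a" and nn: "0 \<le> e" "0 \<le> a" "0 \<le> c"
  shows "e \<le> 2 * (a + c)"
proof (rule ccontr)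
  assume "\<not> e \<le> 2 * (a + c)"
  then have e: "2 * (a + c) < e" by simp
  have "c * a \<le> (a + c) * (a + c)" using nn by (simp add: algebra_simps)
  also have "\<dots> \<le> (a + c) * e" using e nn by (intro mult_left_mono) auto
  finally have "e\<^sup>2 \<le> (2 * (a + c)) * e" using le by (simp add: algebra_simps)
  also have "\<dots> < e * e" using e nn by (intro mult_strict_right_mono) auto
  finally show False by (simp add: power2_eq_square)
qed

lemma error_estimate:
  fixes \<Omega> :: "(real ^ 'n::{finite,linorder}) set"
  assumes mesh: "cubical_mesh \<Omega> \<G>" and \<Omega>: "open \<Omega>" "bounded \<Omega>" and k: "k < CARD('n)"
    and R: "\<And>x. x \<in> \<Omega> \<Longrightarrow> norm x \<le> R"
    and f: "f \<in> L2_forms \<Omega> k" and sol: "is_solution \<Omega> k f \<omega>" and dsol: "is_discrete_solution \<Omega> \<G> k f \<omega>\<^sub>h"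
    and u: "u \<in> Ph_space \<G> k" and \<eta>: "\<eta> \<in> VQ_space \<Omega> \<G> k" and \<psi>: "\<psi> \<in> VQstar0_space \<Omega> \<G> (k + 1)"
  shows "dh_norm \<G> k (\<lambda>x. \<omega> x - \<omega>\<^sub>h x) \<le>
    2 * (1 + sqrt (6 + 4 * (real (CARD('n set) * CARD('n)) * (2 * R))\<^sup>2)) *
      (dh_norm \<G> k (\<lambda>x. \<omega> x - u x) + d_norm \<Omega> k (\<lambda>x. \<omega> x - \<eta> x) +
       delta_norm \<Omega> (k + 1) (\<lambda>x. ext_d \<Omega> k \<omega> x - \<psi> x))"
proof -
  let ?M = "lebesgue_on \<Omega>"
  define C where "C = sqrt (6 + 4 * (real (CARD('n set) * CARD('n)) * (2 * R))\<^sup>2)"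
  obtain v where v: "v \<in> Wdef_space \<Omega> \<G> k" and
    vu': "\<forall>u\<in>Ph_space \<G> k. nrm ?M (\<lambda>x. (\<eta> x - v x, ext_d \<Omega> k \<eta> x - ext_d_h \<G> k v x)) \<le>
      C * nrm ?M (\<lambda>x. (\<eta> x - u x, ext_d \<Omega> k \<eta> x - ext_d_h \<G> k u x))"
    using VQ_projection[OF mesh \<Omega> k R \<eta>] unfolding C_def .
  note vu = bspec[OF vu' u]
  have \<omega>H: "\<omega> \<in> H_space \<Omega> k" using sol by (simp add: is_solution_def)
  have \<eta>H: "\<eta> \<in> H_space \<Omega> k" using \<eta> by (simp add: VQ_space_def)
  have hW: "\<omega>\<^sub>h \<in> Wdef_space \<Omega> \<G> k" using dsol by (simp add: is_discrete_solution_def)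
  have Ph: "w \<in> Ph_space \<G> k" if "w \<in> Wdef_space \<Omega> \<G> k" for w using that by (simp add: Wdef_space_def)
  note H\<omega> = H_space_ext_d[OF \<omega>H \<Omega>] and H\<eta> = H_space_ext_d[OF \<eta>H \<Omega>]
  note s\<omega> = H\<omega>(1,2)[THEN sq_int_L2_forms] and s\<eta> = H\<eta>(1,2)[THEN sq_int_L2_forms]
  note sPh = Ph_space_sq_int[OF mesh \<Omega>]
  note sv = sPh[OF Ph[OF v]] and sh = sPh[OF Ph[OF hW]] and su = sPh[OF u]
  note \<sigma> = solution_codiff[OF \<Omega> k f sol]
  have \<psi>H: "\<psi> \<in> Hstar_space \<Omega> (k + 1)" using \<psi> by (simp add: VQstar0_space_def Hstar0_space_def)
  note c\<psi> = Hstar_space_codiff[OF \<psi>H \<Omega> k] and c\<sigma> = Hstar_space_codiff[OF \<sigma>(1) \<Omega> k]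
  note s\<psi> = c\<psi>(1,2)[THEN sq_int_L2_forms] and s\<sigma> = c\<sigma>(2)[THEN sq_int_L2_forms] and sf = f[THEN sq_int_L2_forms]
  let ?E = "\<lambda>x. (\<omega> x - \<omega>\<^sub>h x, ext_d \<Omega> k \<omega> x - ext_d_h \<G> k \<omega>\<^sub>h x)"
  let ?P = "\<lambda>x. (codiff \<Omega> (k + 1) \<psi> x - codiff \<Omega> (k + 1) (ext_d \<Omega> k \<omega>) x, ext_d \<Omega> k \<omega> x - \<psi> x)"
  let ?U = "\<lambda>x. (\<omega> x, ext_d \<Omega> k \<omega> x)" and ?Uh = "\<lambda>x. (\<omega>\<^sub>h x, ext_d_h \<G> k \<omega>\<^sub>h x)"
  let ?V = "\<lambda>x. (v x, ext_d_h \<G> k v x)"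
  have sE: "sq_int ?M ?E" and sP: "sq_int ?M ?P" and sU: "sq_int ?M ?U" and sUh: "sq_int ?M ?Uh" and sV: "sq_int ?M ?V"
    by (intro sq_int_Pair sq_int_diff s\<omega> sh s\<psi> s\<sigma> sv)+
  \<comment> \<open>The orthogonality of \<open>w\<close> to the discrete dual space allows inserting \<open>\<psi>\<close>.\<close>
  have consistency: "ip ?M ?E (\<lambda>x. (w x, ext_d_h \<G> k w x)) = ip ?M ?P (\<lambda>x. (w x, ext_d_h \<G> k w x))"
    if w: "w \<in> Wdef_space \<Omega> \<G> k" for w
  proof -
    note sw = sPh[OF Ph[OF w]]
    have "ip ?M (ext_d_h \<G> k \<omega>\<^sub>h) (ext_d_h \<G> k w) + ip ?M \<omega>\<^sub>h w = ip ?M f w"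
      using dsol w by (simp add: is_discrete_solution_def L2_inner_eq_ip)
    then have 1: "ip ?M ?E (\<lambda>x. (w x, ext_d_h \<G> k w x)) = ip ?M \<omega> w + ip ?M (ext_d \<Omega> k \<omega>) (ext_d_h \<G> k w) - ip ?M f w"
      by (simp add: ip_Pair[OF sq_int_diff[OF s\<omega>(1) sh(1)] sq_int_diff[OF s\<omega>(2) sh(2)] sw] ip_diff_left s\<omega> sh sw)
    have "ip ?M (codiff \<Omega> (k + 1) (ext_d \<Omega> k \<omega>)) w = ip ?M (\<lambda>x. f x - \<omega> x) w"
      by (rule ip_cong_AE_lebesgue_on[OF s\<sigma> sw(1) \<Omega>(1) \<sigma>(2)]) simp
    then have c: "ip ?M (codiff \<Omega> (k + 1) (ext_d \<Omega> k \<omega>)) w = ip ?M f w - ip ?M \<omega> w"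
      by (simp add: ip_diff_left sf s\<omega> sw)
    have "ip ?M (ext_d_h \<G> k w) \<psi> - ip ?M w (codiff \<Omega> (k + 1) \<psi>) = 0"
      using w \<psi> unfolding Wdef_space_orthogonal[OF mesh \<Omega> k Ph[OF w] \<psi>H, symmetric] Wdef_space_def by blast
    then have o: "ip ?M \<psi> (ext_d_h \<G> k w) = ip ?M (codiff \<Omega> (k + 1) \<psi>) w"
      by (simp only: ip_commute[of _ \<psi>] ip_commute[of _ "codiff \<Omega> (k + 1) \<psi>"])
    have "ip ?M ?P (\<lambda>x. (w x, ext_d_h \<G> k w x)) =
        (ip ?M (codiff \<Omega> (k + 1) \<psi>) w - ip ?M (codiff \<Omega> (k + 1) (ext_d \<Omega> k \<omega>)) w) +
        (ip ?M (ext_d \<Omega> k \<omega>) (ext_d_h \<G> k w) - ip ?M \<psi> (ext_d_h \<G> k w))"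
      unfolding ip_Pair[OF sq_int_diff[OF s\<psi>(2) s\<sigma>] sq_int_diff[OF s\<omega>(2) s\<psi>(1)] sw]
        ip_diff_left[OF s\<psi>(2) s\<sigma> sw(1)] ip_diff_left[OF s\<omega>(2) s\<psi>(1) sw(2)] ..
    then show ?thesis using 1 c o by linarith
  qed
  define e where "e = nrm ?M ?E"
  define p where "p = nrm ?M ?P"
  define a where "a = nrm ?M (\<lambda>x. ?U x - ?V x)"
  have nn: "0 \<le> e" "0 \<le> p" "0 \<le> a" by (simp_all add: e_def p_def a_def nrm_nonneg)
  have EU: "?E = (\<lambda>x. ?U x - ?Uh x)" by simp
  have "e\<^sup>2 = ip ?M ?E (\<lambda>x. ?U x - ?Uh x)" unfolding e_def nrm_square by simp
  also have "\<dots> = ip ?M ?E ?U - ip ?M ?E ?Uh" by (rule ip_diff_right[OF sU sUh sE])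
  also have "\<dots> = ip ?M ?E (\<lambda>x. ?U x - ?V x) + ip ?M ?P (\<lambda>x. ?V x - ?Uh x)"
    unfolding ip_diff_right[OF sU sV sE] ip_diff_right[OF sV sUh sP]
    using consistency[OF v] consistency[OF hW] by simp
  also have "\<dots> \<le> e * a + p * nrm ?M (\<lambda>x. ?V x - ?Uh x)"
    using ip_le_nrm[OF sE sq_int_diff[OF sU sV]] ip_le_nrm[OF sP sq_int_diff[OF sV sUh]]
    unfolding e_def a_def p_def by linarith
  also have "\<dots> \<le> e * a + p * (a + e)"
  proof -
    have "nrm ?M (\<lambda>x. ?V x - ?Uh x) \<le> nrm ?M (\<lambda>x. ?V x - ?U x) + nrm ?M (\<lambda>x. ?U x - ?Uh x)"
      by (rule nrm_triangle[OF sV sU sUh])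
    also have "nrm ?M (\<lambda>x. ?V x - ?U x) = a" unfolding a_def nrm_def by (subst norm_minus_commute) simp
    also have "nrm ?M (\<lambda>x. ?U x - ?Uh x) = e" unfolding e_def by simp
    finally show ?thesis using nn by (intro add_left_mono mult_left_mono)
  qed
  finally have "e\<^sup>2 \<le> e * (a + p) + p * a" by (simp add: algebra_simps)
  from quadratic_bound[OF this nn(1,3,2)] have e: "e \<le> 2 * (a + p)" .
  define dq where "dq = d_norm \<Omega> k (\<lambda>x. \<omega> x - \<eta> x)"
  define du where "du = dh_norm \<G> k (\<lambda>x. \<omega> x - u x)"
  have dq: "dq = nrm ?M (\<lambda>x. (\<omega> x - \<eta> x, ext_d \<Omega> k \<omega> x - ext_d \<Omega> k \<eta> x))"
    unfolding dq_def by (rule d_norm_diff_eq[OF \<omega>H \<eta>H \<Omega>])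
  have du: "du = nrm ?M (\<lambda>x. (\<omega> x - u x, ext_d \<Omega> k \<omega> x - ext_d_h \<G> k u x))"
    unfolding du_def by (rule dh_norm_H_Ph[OF mesh \<Omega> \<omega>H u])
  have sN: "sq_int ?M (\<lambda>x. (\<eta> x, ext_d \<Omega> k \<eta> x))" and sUu: "sq_int ?M (\<lambda>x. (u x, ext_d_h \<G> k u x))"
    by (intro sq_int_Pair s\<eta> su)+
  have "a \<le> dq + nrm ?M (\<lambda>x. (\<eta> x - v x, ext_d \<Omega> k \<eta> x - ext_d_h \<G> k v x))"
    using nrm_triangle[OF sU sN sV] unfolding a_def dq by simp
  also have "\<dots> \<le> dq + C * nrm ?M (\<lambda>x. (\<eta> x - u x, ext_d \<Omega> k \<eta> x - ext_d_h \<G> k u x))"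
    using vu by simp
  also have "\<dots> \<le> dq + C * (dq + du)"
  proof -
    have "nrm ?M (\<lambda>x. (\<eta> x, ext_d \<Omega> k \<eta> x) - (\<omega> x, ext_d \<Omega> k \<omega> x)) = dq"
      unfolding dq nrm_def by (subst norm_minus_commute) simp
    then have "nrm ?M (\<lambda>x. (\<eta> x - u x, ext_d \<Omega> k \<eta> x - ext_d_h \<G> k u x)) \<le> dq + du"
      using nrm_triangle[OF sN sU sUu] unfolding du by simp
    then show ?thesis unfolding C_def by (intro add_left_mono mult_left_mono) auto
  qed
  finally have a: "a \<le> dq + C * (dq + du)" .
  have C: "C \<ge> 0" by (simp add: C_def)
  have "0 \<le> du" "0 \<le> C * p" unfolding du by (auto simp: nrm_nonneg C nn)
  then have "a + p \<le> (1 + C) * (du + dq + p)" using a by (simp add: algebra_simps)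
  then have "2 * (a + p) \<le> 2 * ((1 + C) * (du + dq + p))" by (rule mult_left_mono) simp
  with e have "e \<le> 2 * ((1 + C) * (du + dq + p))" by (rule order_trans)
  then have "e \<le> 2 * (1 + C) * (du + dq + p)" by (simp only: mult.assoc)
  moreover have "dh_norm \<G> k (\<lambda>x. \<omega> x - \<omega>\<^sub>h x) = e"
    unfolding e_def by (rule dh_norm_H_Ph[OF mesh \<Omega> \<omega>H Ph[OF hW]])
  moreover have "delta_norm \<Omega> (k + 1) (\<lambda>x. ext_d \<Omega> k \<omega> x - \<psi> x) = p"
    unfolding p_def by (rule delta_norm_eq[OF \<sigma>(1) \<psi>H \<Omega> k])
  ultimately show ?thesis unfolding C_def du_def dq_def by simp
qed


lemma zero_is_Q_form: "(\<lambda>x. 0) \<in> Q_forms k"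
proof -
  have "(\<lambda>x. 0) \<in> tensor_polys r" for r :: "'a::finite \<Rightarrow> nat"
    unfolding tensor_polys_def by (auto intro!: exI[of _ "0 :: nat"] exI[of _ "\<lambda>_ _. 0 :: real poly"])
  then show ?thesis
    unfolding Q_forms_def by (auto intro!: exI[of _ "\<lambda>_ _. 0"])
qed

text \<open>
  The infima in the theorem are over nonempty sets.
\<close>

lemma zero_in_discrete_spaces:
  fixes \<Omega> :: "(real ^ 'n::{finite,linorder}) set"
  assumes \<Omega>: "open \<Omega>" "bounded \<Omega>" and k: "k < CARD('n)"
  shows "(\<lambda>x. 0) \<in> Ph_space \<G> k" "(\<lambda>x. 0) \<in> VQ_space \<Omega> \<G> k" "(\<lambda>x. 0) \<in> VQstar0_space \<Omega> \<G> (k + 1)"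
proof -
  have pw: "(\<lambda>x. 0) \<in> piecewise_in \<G> S" if "(\<lambda>x. 0) \<in> S" for S :: "'n form set"
    using that by (auto simp: piecewise_in_def)
  have koszul0: "koszul (\<lambda>_. 0) = (\<lambda>_ :: (real, 'n) vec. 0)"
    by (rule ext) (simp add: vec_eq_iff koszul_const_nth)
  have "(\<lambda>x :: (real, 'n) vec. 0 + koszul (\<lambda>_. 0) x) \<in> whitney_forms k"
    by (rule whitney_formsI) (auto simp: alt_forms_def)
  then have "(\<lambda>x :: (real, 'n) vec. 0) \<in> whitney_forms k" by (simp only: koszul0 add_0)
  then show "(\<lambda>x. 0) \<in> Ph_space \<G> k" unfolding Ph_space_def by (rule pw)
  have L: "(\<lambda>x. 0) \<in> L2_forms \<Omega> l" for l
    by (rule continuous_L2_forms[OF _ \<Omega>]) (auto simp: alt_forms_def)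
  have "is_weak_d \<Omega> l (\<lambda>x. 0) (\<lambda>x. 0)" for l by (simp add: is_weak_d_def)
  then have "(\<lambda>x. 0) \<in> H_space \<Omega> k" using L by (auto simp: H_space_def)
  then show "(\<lambda>x. 0) \<in> VQ_space \<Omega> \<G> k" unfolding VQ_space_def using pw[OF zero_is_Q_form] by simp
  have w: "is_weak_delta \<Omega> k (\<lambda>x. 0) (\<lambda>x. 0)" by (simp add: is_weak_delta_def)
  note c = codiff_eqI[OF \<Omega> k L L w]
  have "test_function \<Omega> (\<lambda>x. 0 :: real ^ ('n set))"
    by (rule test_functionI[of _ "{}"]) (auto intro: times_diff_const)
  then have t: "(\<lambda>x. 0) \<in> test_forms \<Omega> (k + 1)" by (simp add: test_forms_def alt_forms_def)
  have "nrm (lebesgue_on \<Omega>) (codiff \<Omega> (k + 1) (\<lambda>x. 0)) = nrm (lebesgue_on \<Omega>) (\<lambda>x. 0 :: real ^ ('n set))"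
    by (rule nrm_cong_AE_lebesgue_on[OF sq_int_L2_forms[OF Hstar_space_codiff(2)[OF c(1) \<Omega> k]] \<Omega>(1) c(2)])
  then have "delta_norm \<Omega> (k + 1) (\<lambda>x. 0 - 0) = 0"
    unfolding delta_norm_def L2_norm_eq_nrm by (simp add: nrm_def)
  then have "(\<lambda>x. 0) \<in> Hstar0_space \<Omega> (k + 1)"
    unfolding Hstar0_space_def using c(1) t by (intro CollectI conjI allI impI bexI[of _ "\<lambda>x. 0"]) auto
  moreover have "(\<lambda>x :: (real, 'n) vec. 0) \<in> Qstar_forms (k + 1)"
  proof -
    have "hodge_star 0 = (0 :: real ^ ('n set))" by (simp add: vec_eq_iff hodge_star_nth)
    then show ?thesis unfolding Qstar_forms_def using zero_is_Q_form by force
  qed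
  ultimately show "(\<lambda>x. 0) \<in> VQstar0_space \<Omega> \<G> (k + 1)" unfolding VQstar0_space_def using pw by simp
qed

lemma le_add_INF:
  fixes f :: "'a \<Rightarrow> real"
  assumes "A \<noteq> {}" and "0 < C" and "\<And>x. x \<in> A \<Longrightarrow> e \<le> C * (f x + r)"
  shows "e \<le> C * ((INF x\<in>A. f x) + r)"
proof -
  have "e / C - r \<le> (INF x\<in>A. f x)"
    using assms by (intro cINF_greatest) (auto simp: field_simps)
  then show ?thesis using assms(2) by (simp add: field_simps)
qed

theorem theorem4p3:
  fixes \<Omega> :: "(real ^ 'n::{finite,linorder}) set" and k :: nat and \<sigma>\<^sub>0 :: real
  assumes "k \<le> CARD('n) - 1"
    and "open \<Omega>" and "connected \<Omega>" and "bounded \<Omega>" and "\<Omega> \<noteq> {}"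
    and "\<sigma>\<^sub>0 \<ge> 1"
  shows "\<exists>C::real. \<forall>\<G> f \<omega> \<omega>\<^sub>h.
    cubical_mesh \<Omega> \<G> \<and> shape_regularity \<G> \<le> \<sigma>\<^sub>0 \<and> f \<in> L2_forms \<Omega> k \<and>
    is_solution \<Omega> k f \<omega> \<and> is_discrete_solution \<Omega> \<G> k f \<omega>\<^sub>h \<longrightarrow>
      dh_norm \<G> k (\<lambda>x. \<omega> x - \<omega>\<^sub>h x)
        \<le> C * ((INF \<mu>\<^sub>h \<in> Ph_space \<G> k. dh_norm \<G> k (\<lambda>x. \<omega> x - \<mu>\<^sub>h x))
             + (INF \<eta>\<^sub>h \<in> VQ_space \<Omega> \<G> k. d_norm \<Omega> k (\<lambda>x. \<omega> x - \<eta>\<^sub>h x))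
             + (INF \<psi>\<^sub>h \<in> VQstar0_space \<Omega> \<G> (k + 1).
                  delta_norm \<Omega> (k + 1) (\<lambda>x. ext_d \<Omega> k \<omega> x - \<psi>\<^sub>h x)))"
proof -
  have k: "k < CARD('n)" using assms(1) zero_less_card_finite[where 'a = 'n] by linarith
  obtain R where R: "\<And>x. x \<in> \<Omega> \<Longrightarrow> norm x \<le> R" using assms(4) unfolding bounded_iff by auto
  define C where "C = 2 * (1 + sqrt (6 + 4 * (real (CARD('n set) * CARD('n)) * (2 * R))\<^sup>2))"
  have C: "C > 0" unfolding C_def by (intro mult_pos_pos add_pos_nonneg) simp_all
  show ?thesis
  proof (intro exI[of _ C] allI impI, elim conjE)
    fix \<G> f \<omega> \<omega>\<^sub>h
    assume mesh: "cubical_mesh \<Omega> \<G>" and f: "f \<in> L2_forms \<Omega> k"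
      and sol: "is_solution \<Omega> k f \<omega>" "is_discrete_solution \<Omega> \<G> k f \<omega>\<^sub>h"
    let ?e = "dh_norm \<G> k (\<lambda>x. \<omega> x - \<omega>\<^sub>h x)"
    let ?A = "INF \<mu>\<^sub>h \<in> Ph_space \<G> k. dh_norm \<G> k (\<lambda>x. \<omega> x - \<mu>\<^sub>h x)"
    let ?B = "INF \<eta>\<^sub>h \<in> VQ_space \<Omega> \<G> k. d_norm \<Omega> k (\<lambda>x. \<omega> x - \<eta>\<^sub>h x)"
    let ?D = "INF \<psi>\<^sub>h \<in> VQstar0_space \<Omega> \<G> (k + 1). delta_norm \<Omega> (k + 1) (\<lambda>x. ext_d \<Omega> k \<omega> x - \<psi>\<^sub>h x)"
    note ne = zero_in_discrete_spaces[OF assms(2,4) k, of \<G>]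
    have 1: "?e \<le> C * (dh_norm \<G> k (\<lambda>x. \<omega> x - u x) + (d_norm \<Omega> k (\<lambda>x. \<omega> x - \<eta> x) +
        delta_norm \<Omega> (k + 1) (\<lambda>x. ext_d \<Omega> k \<omega> x - \<psi> x)))"
      if "u \<in> Ph_space \<G> k" "\<eta> \<in> VQ_space \<Omega> \<G> k" "\<psi> \<in> VQstar0_space \<Omega> \<G> (k + 1)" for u \<eta> \<psi>
      using error_estimate[OF mesh assms(2,4) k R f sol that] unfolding C_def by (simp only: add.assoc)
    have 2: "?e \<le> C * (d_norm \<Omega> k (\<lambda>x. \<omega> x - \<eta> x) +
        (?A + delta_norm \<Omega> (k + 1) (\<lambda>x. ext_d \<Omega> k \<omega> x - \<psi> x)))"
      if "\<eta> \<in> VQ_space \<Omega> \<G> k" "\<psi> \<in> VQstar0_space \<Omega> \<G> (k + 1)" for \<eta> \<psi>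
    proof -
      have "Ph_space \<G> k \<noteq> {}" using ne(1) by blast
      from le_add_INF[OF this C 1[OF _ that]] show ?thesis by (simp only: add.left_commute)
    qed
    have 3: "?e \<le> C * (delta_norm \<Omega> (k + 1) (\<lambda>x. ext_d \<Omega> k \<omega> x - \<psi> x) + (?A + ?B))"
      if "\<psi> \<in> VQstar0_space \<Omega> \<G> (k + 1)" for \<psi>
    proof -
      have "VQ_space \<Omega> \<G> k \<noteq> {}" using ne(2) by blast
      from le_add_INF[OF this C 2[OF _ that]] show ?thesis by (simp only: add.left_commute add.commute)
    qed
    have "VQstar0_space \<Omega> \<G> (k + 1) \<noteq> {}" using ne(3) by blast
    from le_add_INF[OF this C 3] show "?e \<le> C * (?A + ?B + ?D)" by (simp only: add.commute)
  qed
qed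

end
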